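(* Let $d,n,m$ be positive integers. For any $P_1,\ldots,P_m,Q \in M_n(\mathbb{H}[x_1,\ldots,x_d])$ the following are equivalent: (1) For every $a \in \mathbb{H}^d$ and every (column vector) $\mathbf{v} \in \mathbb{H}^n$ such that $P_1(a)\mathbf{v}=\ldots=P_m(a)\mathbf{v}=\mathbf{0}$, we have $Q(a)\mathbf{v}=\mathbf{0}$. (2) $Q$ belongs to the smallest real left ideal of $M_n(\mathbb{H}[x_1,\ldots,x_d])$ containing $P_1,\ldots,P_m$.
   Context: $\mathbb{H}$ denotes the real quaternions. $\mathbb{H}[x_1,\ldots,x_d]$ denotes the ring of all polynomial functions from $\mathbb{H}^d$ to $\mathbb{H}$, i.e. the image of the natural (evaluation) map $\mathbb{H}\langle x_1,\ldots,x_d\rangle\to \mathrm{Functions}(\mathbb{H}^d,\mathbb{H})$, where the variables $x_i$ commute neither with each other nor with the elements of $\mathbb{H}$; equivalently, it is the subring of the ring of all functions $\mathbb{H}^d\to\mathbb{H}$ (with pointwise operations) generated by the constant functions and the coordinate functions. It is invariant under pointwise quaternionic conjugation (since $\bar f=-\frac12(f+ifi+jfj+kfk)$), and pointwise conjugation is its involution. For a ring with involution $A$, the ring $M_n(A)$ carries the conjugated transpose involution $[a_{i,j}]^\ast=[a_{j,i}^\ast]$. A left ideal $I$ of a ring with involution $B$ is called real if for every $k$ and all $b_1,\ldots,b_k \in B$ such that $b_1^\ast b_1+\ldots+b_k^\ast b_k \in I$ we have $b_1,\ldots,b_k \in I$. An intersection of real left ideals is a real left ideal, so every subset of $B$ is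 contained in a smallest real left ideal. *)

theory Defs
  imports "HOL-Analysis.Analysis" "HOL-Algebra.Ideal" "HOL-Library.Function_Algebras"
begin

section \<open>Quaternions\<close>

text \<open>\<open>Quat a b c d\<close> is the real quaternion $a + bi + cj + dk$.\<close>

datatype quat = Quat (qre: real) (qi: real) (qj: real) (qk: real)

lemma quat_eq_iff: "x = y \<longleftrightarrow> qre x = qre y \<and> qi x = qi y \<and> qj x = qj y \<and> qk x = qk y"
  by (cases x; cases y) simp

instantiation quat :: ring_1
begin

definition "0 = Quat 0 0 0 0"

definition "1 = Quat 1 0 0 0"

definition "x + y = Quat (qre x + qre y) (qi x + qi y) (qj x + qj y) (qk x + qk y)"

definition "- x = Quat (- qre x) (- qi x) (- qj x) (- qk x)"

definition "x - y = Quat (qre x - qre y) (qi x - qi y) (qj x - qj y) (qk x - qk y)"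

definition "x * y = Quat
  (qre x * qre y - qi x * qi y - qj x * qj y - qk x * qk y)
  (qre x * qi y + qi x * qre y + qj x * qk y - qk x * qj y)
  (qre x * qj y - qi x * qk y + qj x * qre y + qk x * qi y)
  (qre x * qk y + qi x * qj y - qj x * qi y + qk x * qre y)"

instance
  by standard
    (simp_all add: quat_eq_iff zero_quat_def one_quat_def plus_quat_def uminus_quat_def
      minus_quat_def times_quat_def algebra_simps)

end

lemmas quat_defs = zero_quat_def one_quat_def plus_quat_def uminus_quat_def
  minus_quat_def times_quat_def

definition qcnj :: "quat \<Rightarrow> quat" where
  "qcnj x = Quat (qre x) (- qi x) (- qj x) (- qk x)"

lemma quat_unit_mult:
  defines "i \<equiv> Quat 0 1 0 0" and "j \<equiv> Quat 0 0 1 0" and "k \<equiv> Quat 0 0 0 1"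
  shows "i * i = - 1" "j * j = - 1" "k * k = - 1" "i * j * k = - 1"
  by (simp_all add: assms quat_defs)

lemma qcnj_eq:
  defines "i \<equiv> Quat 0 1 0 0" and "j \<equiv> Quat 0 0 1 0" and "k \<equiv> Quat 0 0 0 1"
  shows "qcnj x = Quat (- 1 / 2) 0 0 0 * (x + i * x * i + j * x * j + k * x * k)"
  by (simp add: assms quat_defs qcnj_def)

lemma qcnj_add: "qcnj (x + y) = qcnj x + qcnj y"
  and qcnj_mult: "qcnj (x * y) = qcnj y * qcnj x"
  and qcnj_qcnj: "qcnj (qcnj x) = x"
  and qcnj_0: "qcnj 0 = 0"
  by (simp_all add: quat_defs qcnj_def quat_eq_iff algebra_simps)

lemma qcnj_sum: "qcnj (sum f A) = (\<Sum>x\<in>A. qcnj (f x))"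
  by (induction A rule: infinite_finite_induct) (simp_all add: qcnj_0 qcnj_add)


section \<open>Polynomial functions\<close>

text \<open>The subring of the ring of all functions $\mathbb{H}^d \to \mathbb{H}$ (pointwise operations)
  generated by the constants and the coordinate functions.\<close>

inductive_set quat_polyfun :: "(quat ^ 'd \<Rightarrow> quat) set" where
  const: "(\<lambda>x. c) \<in> quat_polyfun"
| coord: "(\<lambda>x. x $ i) \<in> quat_polyfun"
| uminus: "f \<in> quat_polyfun \<Longrightarrow> - f \<in> quat_polyfun"
| add: "f \<in> quat_polyfun \<Longrightarrow> g \<in> quat_polyfun \<Longrightarrow> f + g \<in> quat_polyfun"
| mult: "f \<in> quat_polyfun \<Longrightarrow> g \<in> quat_polyfun \<Longrightarrow> f * g \<in> quat_polyfun"

definition fun_cnj :: "('a \<Rightarrow> quat) \<Rightarrow> 'a \<Rightarrow> quat" where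
  "fun_cnj f = (\<lambda>x. qcnj (f x))"

lemma quat_polyfun_cnj:
  assumes "f \<in> quat_polyfun"
  shows "fun_cnj f \<in> quat_polyfun"
proof -
  have "fun_cnj f = (\<lambda>_. Quat (- 1 / 2) 0 0 0) * (f + (\<lambda>_. Quat 0 1 0 0) * f * (\<lambda>_. Quat 0 1 0 0)
      + (\<lambda>_. Quat 0 0 1 0) * f * (\<lambda>_. Quat 0 0 1 0) + (\<lambda>_. Quat 0 0 0 1) * f * (\<lambda>_. Quat 0 0 0 1))"
    by (simp add: fun_eq_iff fun_cnj_def qcnj_eq)
  then show ?thesis
    using assms by (simp only: quat_polyfun.intros)
qed

lemma quat_polyfun_0: "0 \<in> quat_polyfun" and quat_polyfun_1: "1 \<in> quat_polyfun"
  unfolding zero_fun_def one_fun_def by (rule quat_polyfun.const)+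

lemma quat_polyfun_sum: "(\<And>i. i \<in> A \<Longrightarrow> f i \<in> quat_polyfun) \<Longrightarrow> sum f A \<in> quat_polyfun"
  by (induction A rule: infinite_finite_induct) (simp_all add: quat_polyfun_0 quat_polyfun.add)


section \<open>Matrix rings\<close>

text \<open>The product is \<open>**\<close>; the type-class product on vectors is componentwise.\<close>

definition matrix_ring :: "'a::semiring_1 set \<Rightarrow> ('a ^ 'n ^ 'n) ring" where
  "matrix_ring A = \<lparr>carrier = {M. \<forall>i j. M $ i $ j \<in> A}, mult = (**), one = mat 1, zero = 0, add = (+)\<rparr>"

definition matrix_star :: "('a \<Rightarrow> 'a) \<Rightarrow> 'a ^ 'n ^ 'n \<Rightarrow> 'a ^ 'n ^ 'n" where
  "matrix_star s M = (\<chi> i j. s (M $ j $ i))"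

definition matrix_eval :: "('a \<Rightarrow> 'b) ^ 'n ^ 'n \<Rightarrow> 'a \<Rightarrow> 'b ^ 'n ^ 'n" where
  "matrix_eval M a = (\<chi> i j. (M $ i $ j) a)"

abbreviation quat_matrix_ring :: "((quat ^ 'd \<Rightarrow> quat) ^ 'n ^ 'n) ring" where
  "quat_matrix_ring \<equiv> matrix_ring quat_polyfun"

abbreviation quat_matrix_star :: "(quat ^ 'd \<Rightarrow> quat) ^ 'n ^ 'n \<Rightarrow> (quat ^ 'd \<Rightarrow> quat) ^ 'n ^ 'n" where
  "quat_matrix_star \<equiv> matrix_star fun_cnj"

lemma quat_polyfun_mat_1: "mat 1 $ i $ j \<in> quat_polyfun"
  by (simp add: mat_def quat_polyfun_0 quat_polyfun_1)

lemma quat_polyfun_matrix_mult: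
  assumes "\<And>i j. M $ i $ j \<in> quat_polyfun" and "\<And>i j. N $ i $ j \<in> quat_polyfun"
  shows "(M ** N) $ i $ j \<in> quat_polyfun"
  using assms by (auto simp: matrix_matrix_mult_def intro!: quat_polyfun_sum quat_polyfun.mult)

lemma ring_quat_matrix_ring: "ring quat_matrix_ring"
proof (intro ringI abelian_groupI monoidI)
  fix x :: "(quat ^ 'd \<Rightarrow> quat) ^ 'n ^ 'n"
  assume x: "x \<in> carrier quat_matrix_ring"
  then have "- x \<in> carrier quat_matrix_ring"
    by (simp add: matrix_ring_def quat_polyfun.uminus)
  moreover have "- x \<oplus>\<^bsub>quat_matrix_ring\<^esub> x = \<zero>\<^bsub>quat_matrix_ring\<^esub>"
    by (simp add: matrix_ring_def)
  ultimately show "\<exists>y\<in>carrier quat_matrix_ring. y \<oplus>\<^bsub>quat_matrix_ring\<^esub> x = \<zero>\<^bsub>quat_matrix_ring\<^esub>"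
    by blast
next
  fix x y z :: "(quat ^ 'd \<Rightarrow> quat) ^ 'n ^ 'n"
  show "(x \<oplus>\<^bsub>quat_matrix_ring\<^esub> y) \<otimes>\<^bsub>quat_matrix_ring\<^esub> z
      = x \<otimes>\<^bsub>quat_matrix_ring\<^esub> z \<oplus>\<^bsub>quat_matrix_ring\<^esub> y \<otimes>\<^bsub>quat_matrix_ring\<^esub> z"
    by (simp add: matrix_ring_def matrix_matrix_mult_def vec_eq_iff distrib_right sum.distrib)
qed (auto simp: matrix_ring_def quat_polyfun.add quat_polyfun_0 quat_polyfun_mat_1
      quat_polyfun_matrix_mult matrix_add_ldistrib matrix_mul_assoc add.assoc add.commute)

lemma quat_matrix_star:
  fixes M N :: "(quat ^ 'd \<Rightarrow> quat) ^ 'n ^ 'n"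
  shows "M \<in> carrier quat_matrix_ring \<Longrightarrow> quat_matrix_star M \<in> carrier quat_matrix_ring"
    and "quat_matrix_star (M + N) = quat_matrix_star M + quat_matrix_star N"
    and "quat_matrix_star (M ** N) = quat_matrix_star N ** quat_matrix_star M"
    and "quat_matrix_star (quat_matrix_star M) = M"
proof -
  have sum_apply: "sum f A x = (\<Sum>k\<in>A. f k x)" for f :: "'n \<Rightarrow> quat ^ 'd \<Rightarrow> quat" and A x
    by (induction A rule: infinite_finite_induct) simp_all
  show "M \<in> carrier quat_matrix_ring \<Longrightarrow> quat_matrix_star M \<in> carrier quat_matrix_ring"
    by (simp add: matrix_ring_def matrix_star_def quat_polyfun_cnj)
  show "quat_matrix_star (M ** N) = quat_matrix_star N ** quat_matrix_star M"
    by (simp add: matrix_star_def matrix_matrix_mult_def vec_eq_iff fun_eq_iff fun_cnj_def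
        sum_apply qcnj_sum qcnj_mult)
qed (simp_all add: matrix_star_def vec_eq_iff fun_eq_iff fun_cnj_def
      qcnj_add qcnj_qcnj)


section \<open>Real left ideals\<close>

definition left_ideal :: "('a, 'b) ring_scheme \<Rightarrow> 'a set \<Rightarrow> bool" where
  "left_ideal R I \<longleftrightarrow> additive_subgroup I R \<and> (\<forall>a\<in>carrier R. \<forall>x\<in>I. a \<otimes>\<^bsub>R\<^esub> x \<in> I)"

definition real_left_ideal :: "('a, 'b) ring_scheme \<Rightarrow> ('a \<Rightarrow> 'a) \<Rightarrow> 'a set \<Rightarrow> bool" where
  "real_left_ideal R star I \<longleftrightarrow> left_ideal R I \<and>
    (\<forall>(k::nat) b. b \<in> {1..k} \<rightarrow> carrier R \<longrightarrow>
      (\<Oplus>\<^bsub>R\<^esub>i\<in>{1..k}. star (b i) \<otimes>\<^bsub>R\<^esub> b i) \<in> I \<longrightarrow> (\<forall>i\<in>{1..k}. b i \<in> I))"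

definition smallest_real_left_ideal ::
  "('a, 'b) ring_scheme \<Rightarrow> ('a \<Rightarrow> 'a) \<Rightarrow> 'a set \<Rightarrow> 'a set" where
  "smallest_real_left_ideal R star S = \<Inter> {I. real_left_ideal R star I \<and> S \<subseteq> I}"

lemma (in ring) real_left_ideal_carrier: "real_left_ideal R star (carrier R)"
  unfolding real_left_ideal_def left_ideal_def
  by (auto intro!: additive_subgroupI add.subgroup_self)

lemma (in ring) real_left_ideal_smallest:
  assumes S: "S \<subseteq> carrier R"
  shows "real_left_ideal R star (smallest_real_left_ideal R star S)"
    and "S \<subseteq> smallest_real_left_ideal R star S"
    and "real_left_ideal R star I \<Longrightarrow> S \<subseteq> I \<Longrightarrow> smallest_real_left_ideal R star S \<subseteq> I"
proof -
  let ?F = "{I. real_left_ideal R star I \<and> S \<subseteq> I}"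
  have ne: "?F \<noteq> {}"
    using real_left_ideal_carrier S by auto
  have sub: "subgroup I (add_monoid R)" if "I \<in> ?F" for I
    using that by (auto simp: real_left_ideal_def left_ideal_def additive_subgroup_def)
  have "additive_subgroup (\<Inter>?F) R"
    using add.subgroups_Inter[OF sub ne] by (rule additive_subgroupI)
  moreover have "a \<otimes> x \<in> \<Inter>?F" if "a \<in> carrier R" "x \<in> \<Inter>?F" for a x
    using that by (auto simp: real_left_ideal_def left_ideal_def)
  moreover have "b i \<in> \<Inter>?F"
    if b: "b \<in> {1..k} \<rightarrow> carrier R" and s: "(\<Oplus>i\<in>{1..k}. star (b i) \<otimes> b i) \<in> \<Inter>?F"
      and i: "i \<in> {1..k}" for b i and k :: nat
  proof
    fix I assume I: "I \<in> ?F"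
    then have "(\<Oplus>i\<in>{1..k}. star (b i) \<otimes> b i) \<in> I"
      using s by blast
    with I b i show "b i \<in> I"
      unfolding real_left_ideal_def by blast
  qed
  ultimately show "real_left_ideal R star (smallest_real_left_ideal R star S)"
    unfolding real_left_ideal_def left_ideal_def smallest_real_left_ideal_def by blast
qed (auto simp: smallest_real_left_ideal_def)

end

theory Submission
  imports Defs "HOL-Algebra.Algebraic_Closure_Type" "HOL-Computational_Algebra.Fraction_Field"
begin

text \<open>
  The solution condition defines a real left ideal, which gives one direction. For the other one, a real
  left ideal $J$ corresponds to a module $N$ of rows, and it suffices to separate a row $q \notin N$
  from $N$ by a point and a vector. The real-valued polynomial functions $s$ with $s q \in N$ form a
  real ideal $I$; let $P$ be a prime ideal minimal over $I$, which is again real. Gram--Schmidt yields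
  $s \notin P$ and $c$ in the span of the given rows such that $w = s q - c$ is orthogonal to these rows
  modulo $P$. If $w$ vanished modulo $P$, some multiple $t w$ with $t \notin P$ would have its
  coordinates in $I$, so that $(t w)^* (t w) \in J$; realness would give $t w \in N$ and
  $t s \in I \subseteq P$. Hence $w w^* \notin P$, and $q w^* \notin P$ while $r w^* \in P$ for the
  given rows $r$. The real Nullstellensatz for $P$ provides a point $a$ where $q w^*$ does not
  vanish but all $r w^*$ do, and the vector is $w(a)^*$.

  For the real Nullstellensatz, the residue field of $P$ is embedded into a real closed field, and the
  Cohen--Hoermander elimination procedure transfers a finite system of sign conditions from there to
  the real numbers, one variable at a time.
\<close>

hide_const (open) Module.smult Polynomials.degree Polynomials.lead_coeff up_ring.coeff up_ring.monom Coset.order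
unbundle no fps_syntax

section \<open>Polynomials over real closed fields\<close>

text \<open>Noncommutativity stays harmless because conjugation of quaternions is itself polynomial:
  the four real coordinates of a polynomial function are again polynomial functions, so that prime
  ideals are needed only in the commutative ring of real-valued ones. Minimality of \<open>P\<close>
  over \<open>I\<close> replaces localisation: each element of \<open>P\<close> is carried into
  \<open>I\<close> by a multiplier outside \<open>P\<close>, and finitely many elements have a
  common one. Only finitely many functions have to vanish at the point that is sought, so finite
  generation of ideals never enters.

  The ordered residue field may be non-archimedean, so its elements cannot simply be approximated by
  reals; the point has to be moved by elimination. Instead of formulas, the elimination compares two
  families of polynomials over two real closed fields, cell by cell along the line. The signs
  \<open>sg\<close> are integers because they are compared across two fields. Polynomials in the
  other variables serve as coefficients, and the sign conditions on them generate a filter on the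
  real points, proper by induction on the number of variables.\<close>

definition sg :: "'a::linordered_idom \<Rightarrow> int" where
  "sg x = (if 0 < x then 1 else if x = 0 then 0 else - 1)"

lemma sg_eq_iff [simp]: "sg x = 0 \<longleftrightarrow> x = 0" "sg x = 1 \<longleftrightarrow> 0 < x" "sg x = - 1 \<longleftrightarrow> x < 0"
  "0 = sg x \<longleftrightarrow> x = 0" "1 = sg x \<longleftrightarrow> 0 < x" "- 1 = sg x \<longleftrightarrow> x < 0"
  by (auto simp: sg_def)

lemma sg_0 [simp]: "sg 0 = 0" by (simp add: sg_def)

lemma sg_minus [simp]: "sg (- x) = - sg x"
  by (auto simp: sg_def)

lemma sg_mult [simp]: "sg (x * y) = sg x * sg y"
  by (auto simp: sg_def zero_less_mult_iff mult_less_0_iff)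

lemma sg_cases: "sg x = 0 \<or> sg x = 1 \<or> sg x = - 1"
  by (auto simp: sg_def)

lemma sg_eq_cases:
  "sg x = sg y \<Longrightarrow> (0 < x \<longleftrightarrow> 0 < y) \<and> (x = 0 \<longleftrightarrow> y = 0) \<and> (x < 0 \<longleftrightarrow> y < 0)"
  by (metis sg_eq_iff(1-3))

lemma sg_mono: "x \<le> y \<Longrightarrow> sg x \<le> sg y"
  by (auto simp: sg_def)

text \<open>Among ordered fields, the intermediate value property of polynomials characterises the
  real closed ones. It is the property on which the elimination rests and the one to be verified for
  the residue closure.\<close>

class rcf = linordered_field +
  assumes poly_IVT_rcf: "a < b \<Longrightarrow> (\<Sum>k\<le>n. f k * a ^ k) < 0 \<Longrightarrow> 0 < (\<Sum>k\<le>n. f k * b ^ k) \<Longrightarrow>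
    \<exists>x. a < x \<and> x < b \<and> (\<Sum>k\<le>n. f k * x ^ k) = 0"

instance real :: rcf
proof
  fix a b :: real and n f
  assume *: "a < b" "(\<Sum>k\<le>n. f k * a ^ k) < 0" "0 < (\<Sum>k\<le>n. f k * b ^ k)"
  define p where "p = (\<Sum>k\<le>n. monom (f k) k)"
  have p: "poly p x = (\<Sum>k\<le>n. f k * x ^ k)" for x
    by (simp add: p_def poly_sum poly_monom)
  show "\<exists>x. a < x \<and> x < b \<and> (\<Sum>k\<le>n. f k * x ^ k) = 0"
    using poly_IVT_pos[of a b p] * unfolding p by blast
qed

lemma rcf_IVT_pos:
  fixes p :: "'a::rcf poly"
  assumes "a < b" "poly p a < 0" "0 < poly p b"
  shows "\<exists>x. a < x \<and> x < b \<and> poly p x = 0"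
  using poly_IVT_rcf[of a b "coeff p" "degree p"] assms by (simp add: poly_altdef)

lemma rcf_IVT:
  fixes p :: "'a::rcf poly"
  assumes "a < b" "poly p a * poly p b < 0"
  shows "\<exists>x. a < x \<and> x < b \<and> poly p x = 0"
  using rcf_IVT_pos[of a b p] rcf_IVT_pos[of a b "- p"] assms by (auto simp: mult_less_0_iff)

lemma sg_poly_const:
  fixes p :: "'a::rcf poly"
  assumes "x \<le> y" "\<And>z. x \<le> z \<Longrightarrow> z \<le> y \<Longrightarrow> poly p z \<noteq> 0"
  shows "sg (poly p x) = sg (poly p y)"
proof (cases "x = y")
  case False
  then have xy: "x < y" using assms(1) by simp
  have "poly p x \<noteq> 0" "poly p y \<noteq> 0" using assms by auto
  moreover have "\<not> poly p x * poly p y < 0"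
    using rcf_IVT[OF xy, of p] assms(2) by (meson less_imp_le)
  ultimately show ?thesis
    by (auto simp: sg_def mult_less_0_iff not_less_iff_gr_or_eq)
qed simp

text \<open>Between consecutive roots \<open>a\<close> and \<open>b\<close> write \<open>p = (x - a)^m (x - b)^n q\<close>; the cofactor of
  \<open>(x - a)^(m - 1) (x - b)^(n - 1)\<close> in the derivative changes sign on $[a, b]$.\<close>

lemma rcf_Rolle_consecutive:
  fixes p :: "'a::rcf poly"
  assumes ab: "a < b" and pa: "poly p a = 0" and pb: "poly p b = 0"
    and nz: "\<And>z. a < z \<Longrightarrow> z < b \<Longrightarrow> poly p z \<noteq> 0"
  shows "\<exists>z. a < z \<and> z < b \<and> poly (pderiv p) z = 0"
proof -
  have p0: "p \<noteq> 0"
    using nz[of "(a + b) / 2"] ab by auto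
  obtain q where q: "p = [:-a, 1:] ^ order a p * q" "\<not> [:-a, 1:] dvd q"
    using order_decomp[OF p0] by blast
  have q0: "q \<noteq> 0" using q(2) by auto
  have qb: "poly q b = 0"
    using pb ab arg_cong[OF q(1), of "\<lambda>p. poly p b"] by simp
  obtain r where r: "q = [:-b, 1:] ^ order b q * r" "\<not> [:-b, 1:] dvd r"
    using order_decomp[OF q0] by blast
  obtain m where m: "order a p = Suc m"
    using pa p0 by (metis not0_implies_Suc order_root)
  obtain n where n: "order b q = Suc n"
    using qb q0 by (metis not0_implies_Suc order_root)
  have p: "p = [:-a, 1:] ^ Suc m * ([:-b, 1:] ^ Suc n * r)"
    using q(1) r(1) unfolding m n by simp
  define s where "s = smult (of_nat (Suc m)) ([:-b, 1:] * r) + smult (of_nat (Suc n)) ([:-a, 1:] * r)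
      + [:-a, 1:] * [:-b, 1:] * pderiv r"
  have d: "pderiv p = [:-a, 1:] ^ m * [:-b, 1:] ^ n * s"
    unfolding p s_def by (simp add: pderiv_mult pderiv_power_Suc pderiv_pCons algebra_simps del: power_Suc)
      (simp add: algebra_simps flip: smult_add_left)
  have ra: "poly r a \<noteq> 0"
  proof
    assume "poly r a = 0"
    then have "poly q a = 0" using arg_cong[OF r(1), of "\<lambda>p. poly p a"] by simp
    then show False using q(2) by (simp add: poly_eq_0_iff_dvd)
  qed
  have rb: "poly r b \<noteq> 0"
    using r(2) by (simp add: poly_eq_0_iff_dvd)
  have rz: "poly r z \<noteq> 0" if "a \<le> z" "z \<le> b" for z
  proof (cases "z = a \<or> z = b")
    case False
    then have "poly p z \<noteq> 0" using nz[of z] that by auto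
    then show ?thesis unfolding p by auto
  qed (use ra rb in auto)
  have sr: "sg (poly r a) = sg (poly r b)"
    by (rule sg_poly_const) (use ab rz in auto)
  have sa: "poly s a = of_nat (Suc m) * ((a - b) * poly r a)"
    by (simp add: s_def algebra_simps)
  have sb: "poly s b = of_nat (Suc n) * ((b - a) * poly r b)"
    by (simp add: s_def algebra_simps)
  have "(a - b) * poly r a * ((b - a) * poly r b) < 0"
    using sr ra rb ab by (auto simp: sg_def mult_less_0_iff zero_less_mult_iff split: if_splits)
  then have "poly s a * poly s b < 0"
    unfolding sa sb by (auto simp: mult_less_0_iff zero_less_mult_iff simp del: of_nat_Suc)
  from rcf_IVT[OF ab this] obtain z where "a < z" "z < b" "poly s z = 0" by blast
  then show ?thesis by (auto simp: d)
qed

text \<open>A nonzero polynomial has finitely many roots, so there is a smallest root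
  \<open>c\<close> beyond \<open>a\<close>; then \<open>a\<close> and \<open>c\<close> are
  consecutive.\<close>

lemma rcf_Rolle:
  fixes p :: "'a::rcf poly"
  assumes ab: "a < b" and pa: "poly p a = 0" and pb: "poly p b = 0"
  shows "\<exists>z. a < z \<and> z < b \<and> poly (pderiv p) z = 0"
proof (cases "p = 0")
  case True
  then show ?thesis using dense[OF ab] by auto
next
  case False
  define R where "R = {z. a < z \<and> poly p z = 0}"
  have fin: "finite R"
    by (rule finite_subset[OF _ poly_roots_finite[OF False]]) (auto simp: R_def)
  have b: "b \<in> R" using ab pb by (simp add: R_def)
  define c where "c = Min R"
  have c: "c \<in> R" "c \<le> b" using fin b unfolding c_def by (auto intro: Min_in)
  have "\<exists>z. a < z \<and> z < c \<and> poly (pderiv p) z = 0"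
  proof (rule rcf_Rolle_consecutive)
    show "poly p z \<noteq> 0" if "a < z" "z < c" for z
      using that Min_le[OF fin, of z] unfolding c_def by (auto simp: R_def)
  qed (use c pa in \<open>auto simp: R_def\<close>)
  then show ?thesis using c(2) by auto
qed

lemma rcf_MVT:
  fixes p :: "'a::rcf poly"
  assumes ab: "a < b"
  shows "\<exists>z. a < z \<and> z < b \<and> poly p b - poly p a = (b - a) * poly (pderiv p) z"
proof -
  \<comment> \<open>Subtracting the chord, with everything multiplied by \<open>b - a\<close> to
    avoid a quotient, makes the values at both ends equal. Their common value is removed before
    Rolle is applied.\<close>
  define q where "q = smult (b - a) p - smult (poly p b - poly p a) [:-a, 1:]"
  have "poly q a = (b - a) * poly p a" "poly q b = (b - a) * poly p a"
    by (simp_all add: q_def algebra_simps)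
  then have "\<exists>z. a < z \<and> z < b \<and> poly (pderiv (q - [:(b - a) * poly p a:])) z = 0"
    by (intro rcf_Rolle[OF ab]) simp_all
  then show ?thesis
    by (auto simp: q_def pderiv_diff pderiv_smult pderiv_pCons)
qed

lemma rcf_strict_mono:
  fixes p :: "'a::rcf poly"
  assumes "a < b" "\<And>z. a < z \<Longrightarrow> z < b \<Longrightarrow> 0 < poly (pderiv p) z"
  shows "poly p a < poly p b"
proof -
  obtain z where "a < z" "z < b" "poly p b - poly p a = (b - a) * poly (pderiv p) z"
    using rcf_MVT[OF assms(1)] by blast
  with assms show ?thesis
    by (metis diff_gt_0_iff_gt mult_pos_pos)
qed

text \<open>The explicit lower bound \<open>lead_coeff p\<close> carries the induction along the
  Horner form: for \<open>p \<noteq> 0\<close> the leading coefficient does not change, and beyond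
  \<open>1 + \<bar>a\<bar> / lead_coeff p\<close> the product \<open>x * poly p x\<close> absorbs
  the new constant term \<open>a\<close>.\<close>

lemma poly_pos_at_top:
  fixes p :: "'a::linordered_field poly"
  assumes "0 < lead_coeff p"
  shows "\<exists>N>0. \<forall>x\<ge>N. lead_coeff p \<le> poly p x"
  using assms
proof (induction p)
  case (pCons a p)
  show ?case
  proof (cases "p = 0")
    case True
    then show ?thesis using pCons by (intro exI[of _ 1]) auto
  next
    case False
    then have "0 < lead_coeff p" using pCons by simp
    then obtain N where N: "0 < N" "\<And>x. N \<le> x \<Longrightarrow> lead_coeff p \<le> poly p x"
      using pCons by auto
    define M where "M = max N (1 + \<bar>a\<bar> / lead_coeff p)"
    have "lead_coeff p \<le> a + x * poly p x" if "M \<le> x" for x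
    proof -
      have x: "1 + \<bar>a\<bar> / lead_coeff p \<le> x" "N \<le> x" "0 < x"
        using that N(1) by (auto simp: M_def)
      have "\<bar>a\<bar> / lead_coeff p * lead_coeff p = \<bar>a\<bar>"
        using \<open>0 < lead_coeff p\<close> by (metis less_irrefl nonzero_eq_divide_eq)
      then have "lead_coeff p + \<bar>a\<bar> = (1 + \<bar>a\<bar> / lead_coeff p) * lead_coeff p"
        by (simp add: algebra_simps)
      also have "\<dots> \<le> x * poly p x"
        using x N(2)[OF x(2)] \<open>0 < lead_coeff p\<close> by (intro mult_mono) auto
      finally show ?thesis by linarith
    qed
    then show ?thesis using False N(1) by (intro exI[of _ M]) (auto simp: M_def)
  qed
qed simp

section \<open>Sign tables\<close>

text \<open>These points will be the one-point cells of a table. Zero polynomials are left out, as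
  they would make every point a root.\<close>

definition root_class :: "'j set \<Rightarrow> ('j \<Rightarrow> 'a::comm_ring_1 poly) \<Rightarrow> 'a \<Rightarrow> bool" where
  "root_class J f x \<longleftrightarrow> (\<exists>j\<in>J. f j \<noteq> 0 \<and> poly (f j) x = 0)"

lemma finite_root_class:
  fixes f :: "'j \<Rightarrow> 'a::idom poly"
  assumes "finite J"
  shows "finite {x. root_class J f x}"
proof -
  have "{x. root_class J f x} = (\<Union>j\<in>{j\<in>J. f j \<noteq> 0}. {x. poly (f j) x = 0})"
    by (auto simp: root_class_def)
  then show ?thesis using assms poly_roots_finite by auto
qed

lemma root_class_reflect:
  fixes h :: "'j \<Rightarrow> 'a::idom poly"
  shows "root_class J (\<lambda>j. pcompose (h j) [:0, -1:]) x \<longleftrightarrow> root_class J h (- x)"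
  by (simp add: root_class_def poly_pcompose pcompose_eq_0_iff)

text \<open>The maps \<open>p\<close> and \<open>q\<close> number, from left to right and with gaps, the cells into which the roots
  of the two families cut the two lines.\<close>

locale sign_table =
  fixes J :: "'j set" and f :: "'j \<Rightarrow> 'a::rcf poly" and g :: "'j \<Rightarrow> 'b::rcf poly"
    and p :: "'a \<Rightarrow> int" and q :: "'b \<Rightarrow> int"
  assumes fin: "finite J"
    and mono_p: "mono p" and mono_q: "mono q"
    and range_eq: "range p = range q"
    and compat: "\<And>x y j. p x = q y \<Longrightarrow> j \<in> J \<Longrightarrow> sg (poly (f j) x) = sg (poly (g j) y)"
    and sep_p: "\<And>x y. x \<le> y \<Longrightarrow> (\<And>z. x \<le> z \<Longrightarrow> z \<le> y \<Longrightarrow> \<not> root_class J f z) \<Longrightarrow> p x = p y"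
    and sep_q: "\<And>x y. x \<le> y \<Longrightarrow> (\<And>z. x \<le> z \<Longrightarrow> z \<le> y \<Longrightarrow> \<not> root_class J g z) \<Longrightarrow> q x = q y"
begin

lemma swap: "sign_table J g f q p"
  by (rule sign_table.intro)
    (fact fin mono_p mono_q range_eq[symmetric] compat[OF sym, symmetric] sep_p sep_q)+

lemma ex_q: "\<exists>y. q y = p x"
  using range_eq by (metis rangeE rangeI)

lemma ex_p: "\<exists>x. p x = q y"
  using range_eq by (metis rangeE rangeI)

lemma between_p: "x \<le> z \<Longrightarrow> z \<le> y \<Longrightarrow> p x = p y \<Longrightarrow> p z = p x"
  using mono_p by (metis antisym monoD)

lemma less_p: "p x < p y \<Longrightarrow> x < y"
  using mono_p by (metis linorder_not_less monoD)

lemma zero_iff: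
  assumes "j \<in> J"
  shows "f j = 0 \<longleftrightarrow> g j = 0"
proof
  assume "f j = 0"
  then have "poly (g j) y = 0" for y
    using ex_p[of y] compat[OF _ assms] by (metis poly_0 sg_0 sg_eq_iff(1))
  then show "g j = 0" using poly_all_0_iff_0 by blast
next
  assume "g j = 0"
  then have "poly (f j) x = 0" for x
    using ex_q[of x] compat[OF _ assms] by (metis poly_0 sg_0 sg_eq_iff(1))
  then show "f j = 0" using poly_all_0_iff_0 by blast
qed

lemma root_class_iff: "p x = q y \<Longrightarrow> root_class J f x \<longleftrightarrow> root_class J g y"
  unfolding root_class_def using zero_iff compat sg_eq_iff(1) by metis

text \<open>By comparison with the other line, all points of a cell that contains a root are roots.
  Cells are convex, so a second point would produce an interval of roots.\<close>

lemma root_class_singleton: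
  assumes "root_class J f x" "p x = p y"
  shows "x = y"
proof (rule ccontr)
  assume "x \<noteq> y"
  obtain w where w: "q w = p x" using ex_q by blast
  have *: "root_class J f z" if "p z = p x" for z
    using root_class_iff[of z w] root_class_iff[of x w] that w assms(1) by simp
  define u v where "u = min x y" and "v = max x y"
  have uv: "u < v" "p u = p x" "p v = p x"
    using \<open>x \<noteq> y\<close> assms(2) by (auto simp: u_def v_def min_def max_def)
  then have "{u..v} \<subseteq> {z. root_class J f z}"
    using * between_p[of u _ v] by auto
  then show False
    using finite_root_class[OF fin, of f] infinite_Icc[OF uv(1)] finite_subset by blast
qed

text \<open>The cell of a point that is no root is a gap. It reaches either to the next root, which
  has a larger number, or to infinity.\<close>

lemma right_end:
  assumes "\<not> root_class J f x"
  obtains (bounded) z where "x < z" "root_class J f z" "\<And>u. x \<le> u \<Longrightarrow> u < z \<Longrightarrow> p u = p x" "p x < p z"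
  | (unbounded) "\<And>u. x \<le> u \<Longrightarrow> p u = p x"
proof (cases "{z. x < z \<and> root_class J f z} = {}")
  case True
  have "p u = p x" if "x \<le> u" for u
    using sep_p[OF that] True assms by (metis (mono_tags, lifting) Collect_empty_eq order_le_less)
  then show ?thesis by (rule unbounded)
next
  case False
  define Z where "Z = {z. x < z \<and> root_class J f z}"
  have Z: "finite Z" "Z \<noteq> {}"
    using False finite_root_class[OF fin, of f] by (auto simp: Z_def)
  define z where "z = Min Z"
  have z: "x < z" "root_class J f z"
    using Min_in[OF Z] by (auto simp: z_def Z_def)
  have 1: "p u = p x" if "x \<le> u" "u < z" for u
  proof -
    have "\<not> root_class J f v" if "x \<le> v" "v \<le> u" for v
    proof
      assume "root_class J f v"
      then have "v \<in> Z" using that assms by (cases "v = x") (auto simp: Z_def)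
      then show False using Min_le[OF Z(1), of v] that \<open>u < z\<close> by (simp add: z_def)
    qed
    then show ?thesis using sep_p[OF that(1)] by simp
  qed
  have "p x \<noteq> p z" using root_class_singleton[OF z(2), of x] z(1) by auto
  moreover have "p x \<le> p z" using z(1) mono_p by (simp add: monoD)
  ultimately show ?thesis using bounded[OF z 1] by simp
qed

lemma class_open_right:
  assumes "\<not> root_class J f x"
  shows "\<exists>u>x. p u = p x"
  using assms
proof (cases rule: right_end)
  case (bounded z)
  then show ?thesis using dense[OF bounded(1)] by (meson less_imp_le)
next
  case unbounded
  then show ?thesis by (meson gt_ex less_imp_le)
qed

text \<open>Negating the numbers restores monotonicity after \<open>x\<close> is replaced by
  \<open>- x\<close>. Reflection turns right ends of gaps into left ends, so that only right ends
  have to be studied.\<close>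

lemma reflect:
  "sign_table J (\<lambda>j. pcompose (f j) [:0, -1:]) (\<lambda>j. pcompose (g j) [:0, -1:]) (\<lambda>x. - p (- x)) (\<lambda>y. - q (- y))"
proof
  have rg: "range (\<lambda>x. - r (- x)) = uminus ` range r" for r :: "'c::group_add \<Rightarrow> int"
    by (auto simp: image_iff) (metis minus_minus)
  show "mono (\<lambda>x. - p (- x))" "mono (\<lambda>x. - q (- x))"
    using mono_p mono_q by (auto simp: mono_def)
  show "range (\<lambda>x. - p (- x)) = range (\<lambda>y. - q (- y))"
    unfolding rg range_eq ..
  show "- p (- x) = - p (- y)"
    if "x \<le> y" and *: "\<And>z. x \<le> z \<Longrightarrow> z \<le> y \<Longrightarrow> \<not> root_class J (\<lambda>j. pcompose (f j) [:0, -1:]) z" for x y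
  proof -
    have "p (- y) = p (- x)"
    proof (rule sep_p)
      fix z assume "- y \<le> z" "z \<le> - x"
      then have "x \<le> - z" "- z \<le> y" by auto
      then show "\<not> root_class J f z" using *[of "- z"] by (simp add: root_class_reflect)
    qed (use that in simp)
    then show ?thesis by simp
  qed
  show "- q (- x) = - q (- y)"
    if "x \<le> y" and *: "\<And>z. x \<le> z \<Longrightarrow> z \<le> y \<Longrightarrow> \<not> root_class J (\<lambda>j. pcompose (g j) [:0, -1:]) z" for x y
  proof -
    have "q (- y) = q (- x)"
    proof (rule sep_q)
      fix z assume "- y \<le> z" "z \<le> - x"
      then have "x \<le> - z" "- z \<le> y" by auto
      then show "\<not> root_class J g z" using *[of "- z"] by (simp add: root_class_reflect)
    qed (use that in simp)
    then show ?thesis by simp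
  qed
qed (use fin compat in \<open>auto simp: poly_pcompose\<close>)

section \<open>Signs attained on a gap where the derivatives are positive\<close>

text \<open>Since \<open>h\<close> increases on the gap, a positive value forces \<open>h\<close> to
  be positive at the right end of the gap. The right end of the matching gap is a root with the same
  number, so \<open>k\<close> is positive there as well, and therefore already shortly before it. If
  the gap is unbounded, the positive derivative makes the leading coefficient of \<open>k\<close>
  positive.\<close>

lemma positive_attained:
  fixes h :: "'a poly" and k :: "'b poly"
  assumes degk: "degree k > 0"
    and root_sg: "\<And>x y. root_class J f x \<Longrightarrow> p x = q y \<Longrightarrow> sg (poly h x) = sg (poly k y)"
    and x: "\<not> root_class J f x" "0 < poly h x"
    and dh: "\<And>u. p u = p x \<Longrightarrow> 0 < poly (pderiv h) u"
    and dk: "\<And>u. q u = p x \<Longrightarrow> 0 < poly (pderiv k) u"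
  shows "\<exists>y. q y = p x \<and> 0 < poly k y"
proof -
  interpret S: sign_table J g f q p by (rule swap)
  obtain y where y: "q y = p x" using ex_q by blast
  have ny: "\<not> root_class J g y" using root_class_iff[of x y] x(1) y by simp
  show ?thesis
    using ny
  proof (cases rule: S.right_end)
    case unbounded
    have pk0: "pderiv k \<noteq> 0" using degk by (simp add: pderiv_eq_0_iff)
    have "0 < lead_coeff (pderiv k)"
    proof (rule ccontr)
      assume "\<not> 0 < lead_coeff (pderiv k)"
      then have *: "0 < lead_coeff (- pderiv k)"
        using pk0 by (metis degree_minus coeff_minus leading_coeff_0_iff linorder_neqE_linordered_idom neg_0_less_iff_less)
      obtain N where N: "\<And>u. u \<ge> N \<Longrightarrow> lead_coeff (- pderiv k) \<le> poly (- pderiv k) u"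
        using poly_pos_at_top[OF *] by blast
      have "0 < poly (- pderiv k) (max N y)"
        using N[of "max N y"] * by linarith
      moreover have "0 < poly (pderiv k) (max N y)"
        by (rule dk) (use unbounded[of "max N y"] y in simp)
      ultimately show False by simp
    qed
    also have "lead_coeff (pderiv k) = of_nat (degree k) * lead_coeff k"
      using degk by (simp add: degree_pderiv coeff_pderiv)
    finally have *: "0 < lead_coeff k"
      using degk by (simp add: zero_less_mult_iff)
    obtain N where N: "\<And>u. u \<ge> N \<Longrightarrow> lead_coeff k \<le> poly k u"
      using poly_pos_at_top[OF *] by blast
    have "0 < poly k (max N y)"
      using N[of "max N y"] * by linarith
    then show ?thesis using unbounded[of "max N y"] y by auto
  next
    case (bounded w)
    have "0 < poly k w"
      using x(1)
    proof (cases rule: right_end)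
      case unbounded
      obtain x' where x': "p x' = q w" using ex_p by blast
      then have "x < x'" using less_p bounded(4) y by simp
      then have "p x' = p x" using unbounded[of x'] by simp
      then show ?thesis using x' bounded(4) y by simp
    next
      case xb: (bounded z)
      \<comment> \<open>\<open>z\<close> and \<open>w\<close> are the first roots after matching
        gaps. Both numberings have the same range, so no number lies between that of the gap and
        that of the root, and \<open>z\<close> and \<open>w\<close> carry the same one.\<close>
      have "p z \<le> q w"
      proof -
        obtain x' where x': "p x' = q w" using ex_p by blast
        then have "x < x'" using less_p bounded(4) y by simp
        then have "z \<le> x'" using xb(3)[of x'] x' bounded(4) y by (metis less_imp_le not_less order_less_irrefl)
        then show ?thesis using mono_p x' by (metis monoD)
      qed
      moreover have "q w \<le> p z"
      proof -
        obtain y' where y': "q y' = p z" using ex_q by blast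
        then have "y < y'" using S.less_p xb(4) y by simp
        then have "w \<le> y'" using bounded(3)[of y'] y' xb(4) y by (metis less_imp_le not_less order_less_irrefl)
        then show ?thesis using mono_q y' by (metis monoD)
      qed
      ultimately have "sg (poly h z) = sg (poly k w)"
        using root_sg[OF xb(2)] by simp
      moreover have "poly h x < poly h z"
        by (rule rcf_strict_mono) (use xb(1) dh[OF xb(3)] in auto)
      ultimately show ?thesis using x(2) by (meson less_trans sg_eq_cases)
    qed
    \<comment> \<open>The intermediate value theorem may only yield a zero \<open>v\<close> of
      \<open>k\<close>; by monotonicity any later point \<open>u\<close> of the gap has a positive
      value.\<close>
    moreover have "\<exists>v. y \<le> v \<and> v < w \<and> 0 \<le> poly k v"
    proof (cases "poly k y < 0")
      case True
      then show ?thesis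
        using rcf_IVT_pos[OF bounded(1) True \<open>0 < poly k w\<close>] by (metis less_imp_le order_refl)
    qed (use bounded(1) in \<open>auto simp: not_less intro: exI[of _ y]\<close>)
    then obtain v where v: "y \<le> v" "v < w" "0 \<le> poly k v" by blast
    obtain u where u: "v < u" "u < w" using dense[OF v(2)] by blast
    have "poly k v < poly k u"
    proof (rule rcf_strict_mono[OF u(1)])
      fix z assume "v < z" "z < u"
      then have "y \<le> z" "z < w" using u v by linarith+
      then show "0 < poly (pderiv k) z" using dk[of z] bounded(3)[of z] y by simp
    qed
    then show ?thesis using v u bounded(3)[of u] y by (intro exI[of _ u]) auto
  qed
qed

text \<open>The polynomial \<open>- h (- x)\<close> again has a positive derivative, and its
  positive values are the negative values of \<open>h\<close>.\<close>

lemma negative_attained: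
  fixes h :: "'a poly" and k :: "'b poly"
  assumes degk: "degree k > 0"
    and root_sg: "\<And>x y. root_class J f x \<Longrightarrow> p x = q y \<Longrightarrow> sg (poly h x) = sg (poly k y)"
    and x: "\<not> root_class J f x" "poly h x < 0"
    and dh: "\<And>u. p u = p x \<Longrightarrow> 0 < poly (pderiv h) u"
    and dk: "\<And>u. q u = p x \<Longrightarrow> 0 < poly (pderiv k) u"
  shows "\<exists>y. q y = p x \<and> poly k y < 0"
proof -
  interpret R: sign_table J "\<lambda>j. pcompose (f j) [:0, -1:]" "\<lambda>j. pcompose (g j) [:0, -1:]"
    "\<lambda>x. - p (- x)" "\<lambda>y. - q (- y)"
    by (rule reflect)
  have "\<exists>y. - q (- y) = - p (- (- x)) \<and> 0 < poly (- pcompose k [:0, -1:]) y"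
  proof (rule R.positive_attained)
    show "0 < degree (- pcompose k [:0, -1:])" using degk by (simp add: degree_pcompose)
    show "sg (poly (- pcompose h [:0, -1:]) u) = sg (poly (- pcompose k [:0, -1:]) v)"
      if "root_class J (\<lambda>j. pcompose (f j) [:0, -1:]) u" "- p (- u) = - q (- v)" for u v
      using that root_sg[of "- u" "- v"] by (simp add: root_class_reflect poly_pcompose)
    show "0 < poly (pderiv (- pcompose h [:0, -1:])) u" if "- p (- u) = - p (- (- x))" for u
      using that dh[of "- u"] by (simp add: pderiv_minus pderiv_pcompose poly_pcompose pderiv_pCons)
    show "0 < poly (pderiv (- pcompose k [:0, -1:])) u" if "- q (- u) = - p (- (- x))" for u
      using that dk[of "- u"] by (simp add: pderiv_minus pderiv_pcompose poly_pcompose pderiv_pCons)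
  qed (use x in \<open>auto simp: root_class_reflect poly_pcompose\<close>)
  then obtain y where "q (- y) = p x" "poly k (- y) < 0"
    by (auto simp: poly_pcompose)
  then show ?thesis by blast
qed

text \<open>Only sign zero is new: if \<open>h\<close> vanishes at \<open>x\<close>, it is negative
  before and positive after \<open>x\<close> within the gap. Hence \<open>k\<close> attains both
  signs on the matching gap, and the intermediate value theorem provides a zero, which stays in the
  gap by convexity.\<close>

lemma sign_attained:
  fixes h :: "'a poly" and k :: "'b poly"
  assumes degk: "degree k > 0"
    and root_sg: "\<And>x y. root_class J f x \<Longrightarrow> p x = q y \<Longrightarrow> sg (poly h x) = sg (poly k y)"
    and x: "\<not> root_class J f x"
    and dh: "\<And>u. p u = p x \<Longrightarrow> 0 < poly (pderiv h) u"
    and dk: "\<And>u. q u = p x \<Longrightarrow> 0 < poly (pderiv k) u"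
  shows "\<exists>y. q y = p x \<and> sg (poly k y) = sg (poly h x)"
proof -
  consider (pos) "0 < poly h x" | (neg) "poly h x < 0" | (zero) "poly h x = 0" by fastforce
  then show ?thesis
  proof cases
    case pos
    from positive_attained[OF degk root_sg x pos dh dk] obtain y where "q y = p x" "0 < poly k y" by blast
    then show ?thesis using pos by (intro exI[of _ y]) (simp add: sg_def)
  next
    case neg
    from negative_attained[OF degk root_sg x neg dh dk] obtain y where "q y = p x" "poly k y < 0" by blast
    then show ?thesis using neg by (intro exI[of _ y]) (simp add: sg_def)
  next
    case zero
    interpret R: sign_table J "\<lambda>j. pcompose (f j) [:0, -1:]" "\<lambda>j. pcompose (g j) [:0, -1:]"
      "\<lambda>x. - p (- x)" "\<lambda>y. - q (- y)"
      by (rule reflect)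
    have "\<not> root_class J (\<lambda>j. pcompose (f j) [:0, -1:]) (- x)"
      using x by (simp add: root_class_reflect)
    from R.class_open_right[OF this] obtain u where u: "- x < u" "p (- u) = p x"
      by auto
    have nr: "\<not> root_class J f (- u)"
      using root_class_singleton[of "- u" x] u x by auto
    have mono: "poly h a < poly h b" if "a < b" "p a = p x" "p b = p x" for a b
    proof (rule rcf_strict_mono[OF that(1)])
      fix z assume "a < z" "z < b"
      then show "0 < poly (pderiv h) z" using dh[of z] between_p[of a z b] that by simp
    qed
    have dh': "0 < poly (pderiv h) w" if "p w = p (- u)" for w
      using dh that u(2) by simp
    have dk': "0 < poly (pderiv k) w" if "q w = p (- u)" for w
      using dk that u(2) by simp
    have "poly h (- u) < 0" using mono[of "- u" x] u zero by simp
    from negative_attained[OF degk root_sg nr this dh' dk'] u(2)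
    obtain y1 where y1: "q y1 = p x" "poly k y1 < 0" by auto
    obtain v where v: "x < v" "p v = p x"
      using class_open_right[OF x] by blast
    have nr: "\<not> root_class J f v"
      using root_class_singleton[of v x] v x by auto
    have dh': "0 < poly (pderiv h) w" if "p w = p v" for w
      using dh that v(2) by simp
    have dk': "0 < poly (pderiv k) w" if "q w = p v" for w
      using dk that v(2) by simp
    have "0 < poly h v" using mono[of x v] v zero by simp
    from positive_attained[OF degk root_sg nr this dh' dk'] v(2)
    obtain y2 where y2: "q y2 = p x" "0 < poly k y2" by auto
    have *: "\<exists>y. q y = p x \<and> poly k y = 0"
      if ab: "a < b" "q a = p x" "q b = p x" "poly k a * poly k b < 0" for a b
    proof -
      obtain z where "a < z" "z < b" "poly k z = 0"
        using rcf_IVT[OF ab(1,4)] by blast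
      then show ?thesis
        using sign_table.between_p[OF swap, of a z b] ab by auto
    qed
    have "\<exists>y. q y = p x \<and> poly k y = 0"
    proof (cases y1 y2 rule: linorder_cases)
      case less
      then show ?thesis by (rule *) (use y1 y2 in \<open>auto simp: mult_less_0_iff\<close>)
    next
      case greater
      then show ?thesis by (rule *) (use y1 y2 in \<open>auto simp: mult_less_0_iff\<close>)
    qed (use y1 y2 in auto)
    then show ?thesis using zero by (auto simp: sg_def)
  qed
qed


end

text \<open>On a cell where the derivative of \<open>h\<close> has constant sign, the last summand takes the
  values $-1$, $0$, $1$ in this order, so that the cell is cut at the root of \<open>h\<close>.\<close>

definition refine :: "'c::linordered_idom poly \<Rightarrow> ('c \<Rightarrow> int) \<Rightarrow> 'c \<Rightarrow> int" where
  "refine h r x = 3 * r x + 1 + sg (poly (pderiv h) x) * sg (poly h x)"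

text \<open>The added term lies between 0 and 2, so that quotient and remainder modulo 3 recover
  both pieces of information.\<close>

lemma refine_eqD:
  assumes "refine h r x = refine k s y"
  shows "r x = s y" "sg (poly (pderiv h) x) * sg (poly h x) = sg (poly (pderiv k) y) * sg (poly k y)"
proof -
  have "sg a * sg b = 0 \<or> sg a * sg b = 1 \<or> sg a * sg b = - 1" for a b :: "'c::linordered_idom"
    by (auto simp: sg_def)
  from this[of "poly (pderiv h) x" "poly h x"] this[of "poly (pderiv k) y" "poly k y"] assms
  show "r x = s y" "sg (poly (pderiv h) x) * sg (poly h x) = sg (poly (pderiv k) y) * sg (poly k y)"
    unfolding refine_def by presburger+
qed

section \<open>Refinement of a table by one more polynomial\<close>

context sign_table
begin

lemma same_class: "p x = p y \<Longrightarrow> j \<in> J \<Longrightarrow> sg (poly (f j) x) = sg (poly (f j) y)"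
  using ex_q[of x] compat by metis

context
  fixes d e :: 'j
  assumes deg: "degree (f e) > 0" "degree (g e) > 0"
    and d: "d \<in> J" "f d = pderiv (f e)" "g d = pderiv (g e)"
    and root_sg: "\<And>x y. root_class J f x \<Longrightarrow> p x = q y \<Longrightarrow> sg (poly (f e) x) = sg (poly (g e) y)"
begin

text \<open>At a root of the table the sign of the new polynomial is given by
  \<open>root_sg\<close>. On a gap the derivative has no zero, hence a constant sign, and after
  passing to the negatives if necessary \<open>sign_attained\<close> applies.\<close>

lemma refine_range: "\<exists>y. refine (g e) q y = refine (f e) p x"
proof (cases "root_class J f x")
  case True
  obtain y where y: "q y = p x" using ex_q by blast
  then show ?thesis
    using root_sg[OF True, of y] compat[of x y d] d by (intro exI[of _ y]) (simp add: refine_def)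
next
  case False
  have f0: "f d \<noteq> 0" using deg(1) d by (simp add: pderiv_eq_0_iff)
  have "poly (f d) x \<noteq> 0" using False f0 d(1) by (auto simp: root_class_def)
  then consider (pos) "sg (poly (f d) x) = 1" | (neg) "sg (poly (f d) x) = - 1"
    using sg_cases by auto
  then show ?thesis
  proof cases
    case pos
    have dh: "0 < poly (pderiv (f e)) u" if "p u = p x" for u
      using same_class[OF that d(1)] pos d by (simp flip: sg_eq_iff(2))
    have dk: "0 < poly (pderiv (g e)) u" if "q u = p x" for u
      using compat[of x u d] that pos d by (simp flip: sg_eq_iff(2))
    obtain y where y: "q y = p x" "sg (poly (g e) y) = sg (poly (f e) x)"
      using sign_attained[OF deg(2) root_sg False dh dk] by blast
    then show ?thesis
      using compat[of x y d] d by (intro exI[of _ y]) (simp add: refine_def)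
  next
    case neg
    have dh: "0 < poly (pderiv (- f e)) u" if "p u = p x" for u
      using same_class[OF that d(1)] neg d by (simp add: pderiv_minus flip: sg_eq_iff(2))
    have dk: "0 < poly (pderiv (- g e)) u" if "q u = p x" for u
      using compat[of x u d] that neg d by (simp add: pderiv_minus flip: sg_eq_iff(2))
    have dg: "0 < degree (- g e)" using deg(2) by simp
    have rs: "sg (poly (- f e) x) = sg (poly (- g e) y)" if "root_class J f x" "p x = q y" for x y
      using root_sg[OF that] by simp
    obtain y where y: "q y = p x" "sg (poly (- g e) y) = sg (poly (- f e) x)"
      using sign_attained[OF dg rs False dh dk] by blast
    then show ?thesis
      using compat[of x y d] d by (intro exI[of _ y]) (simp add: refine_def)
  qed
qed

text \<open>Numbers of different old cells are now at least 3 apart, while the corrections differ by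
  at most 2. Two distinct points of one cell lie in a gap, where the polynomial is strictly monotone
  in the direction given by the sign of its derivative; multiplied by that sign, it increases in
  either case.\<close>

lemma refine_mono: "mono (refine (f e) p)"
proof
  fix x y :: 'a assume xy: "x \<le> y"
  have f0: "f d \<noteq> 0" using deg(1) d by (simp add: pderiv_eq_0_iff)
  have "p x \<le> p y" using xy mono_p by (simp add: monoD)
  then consider "p x < p y" | "p x = p y" "x = y" | (lt) "p x = p y" "x < y" using xy by fastforce
  then show "refine (f e) p x \<le> refine (f e) p y"
  proof cases
    case 1
    have "\<bar>sg a * sg b\<bar> \<le> 1" for a b :: 'a
      by (auto simp: sg_def)
    from this[of "poly (pderiv (f e)) x" "poly (f e) x"] this[of "poly (pderiv (f e)) y" "poly (f e) y"] 1
    show ?thesis unfolding refine_def by linarith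
  next
    case lt
    have c: "sg (poly (f d) z) = sg (poly (f d) x)" if "x < z" "z < y" for z
      using same_class[OF _ d(1), of z x] between_p[of x z y] lt that by simp
    have cy: "sg (poly (f d) y) = sg (poly (f d) x)"
      using same_class[OF lt(1) d(1)] by simp
    have "poly (f d) x \<noteq> 0"
      using root_class_singleton[of x y] lt d(1) f0 by (auto simp: root_class_def)
    then consider (pos) "sg (poly (f d) x) = 1" | (neg) "sg (poly (f d) x) = - 1"
      using sg_cases by auto
    then show ?thesis
    proof cases
      case pos
      have less: "poly (f e) x < poly (f e) y"
        by (rule rcf_strict_mono[OF lt(2)]) (use c pos d in \<open>simp flip: sg_eq_iff(2)\<close>)
      show ?thesis
        unfolding refine_def d(2)[symmetric] cy pos lt(1) using sg_mono[of "poly (f e) x" "poly (f e) y"] less by simp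
    next
      case neg
      have less: "poly (- f e) x < poly (- f e) y"
        by (rule rcf_strict_mono[OF lt(2)]) (use c neg d in \<open>simp add: pderiv_minus flip: sg_eq_iff(2)\<close>)
      show ?thesis
        unfolding refine_def d(2)[symmetric] cy neg lt(1) using sg_mono[of "poly (f e) y" "poly (f e) x"] less by simp
    qed
  qed simp
qed

lemma refine_sep:
  assumes "x \<le> y" "\<And>z. x \<le> z \<Longrightarrow> z \<le> y \<Longrightarrow> \<not> root_class (insert e J) f z"
  shows "refine (f e) p x = refine (f e) p y"
proof -
  have p: "p x = p y"
    by (rule sep_p[OF assms(1)]) (use assms(2) in \<open>auto simp: root_class_def\<close>)
  moreover have "sg (poly (f e) x) = sg (poly (f e) y)"
  proof (rule sg_poly_const[OF assms(1)])
    fix z assume z: "x \<le> z" "z \<le> y"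
    have "f e \<noteq> 0" using deg(1) by auto
    then show "poly (f e) z \<noteq> 0" using assms(2)[OF z] by (auto simp: root_class_def)
  qed
  ultimately show ?thesis
    using same_class[OF p d(1)] d(2) by (simp add: refine_def)
qed

text \<open>The refined number determines the product of the signs of the polynomial and its
  derivative. Where the derivative does not vanish, its sign cancels; where it vanishes, the point
  is a root of the old table and \<open>root_sg\<close> decides.\<close>

lemma refine_compat:
  assumes "refine (f e) p x = refine (g e) q y"
  shows "p x = q y" "sg (poly (f e) x) = sg (poly (g e) y)"
proof -
  note * = refine_eqD[OF assms]
  show 1: "p x = q y" by (fact *(1))
  have s: "sg (poly (pderiv (f e)) x) = sg (poly (pderiv (g e)) y)"
    using compat[OF 1 d(1)] d by simp
  show "sg (poly (f e) x) = sg (poly (g e) y)"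
  proof (cases "poly (pderiv (f e)) x = 0")
    case True
    have "root_class J f x"
      using True d deg(1) by (auto simp: root_class_def pderiv_eq_0_iff intro!: bexI[of _ d])
    then show ?thesis using root_sg 1 by simp
  next
    case False
    then show ?thesis using *(2) unfolding s by (metis mult_cancel_left s sg_eq_iff(1))
  qed
qed

lemma extend:
  "sign_table (insert e J) f g (refine (f e) p) (refine (g e) q)"
proof -
  interpret S: sign_table J g f q p by (rule swap)
  have rs: "sg (poly (g e) y) = sg (poly (f e) x)" if "root_class J g y" "q y = p x" for x y
  proof -
    have "root_class J f x" using root_class_iff[of x y] that by simp
    then show ?thesis using root_sg[of x y] that by simp
  qed
  have S1: "\<exists>x. refine (f e) p x = refine (g e) q y" for y
    by (rule S.refine_range[OF deg(2,1) d(1,3,2)]) (rule rs)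
  have S2: "mono (refine (g e) q)"
    by (rule S.refine_mono[OF deg(2,1) d(1,3,2)]) (rule rs)
  have S3: "refine (g e) q x = refine (g e) q y"
    if "x \<le> y" "\<And>z. x \<le> z \<Longrightarrow> z \<le> y \<Longrightarrow> \<not> root_class (insert e J) g z" for x y
    by (rule S.refine_sep[OF deg(2,1) d(1,3,2) _ that]) (rule rs)
  have 1: "range (refine (f e) p) = range (refine (g e) q)"
  proof (intro subset_antisym subsetI)
    fix u assume "u \<in> range (refine (f e) p)"
    then obtain x where "u = refine (f e) p x" by blast
    moreover obtain y where "refine (g e) q y = refine (f e) p x" using refine_range by blast
    ultimately show "u \<in> range (refine (g e) q)" by (simp add: image_iff) (rule exI[of _ y], simp)
  next
    fix u assume "u \<in> range (refine (g e) q)"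
    then obtain y where "u = refine (g e) q y" by blast
    moreover obtain x where "refine (f e) p x = refine (g e) q y" using S1 by blast
    ultimately show "u \<in> range (refine (f e) p)" by (simp add: image_iff) (rule exI[of _ x], simp)
  qed
  have 2: "sg (poly (f j) x) = sg (poly (g j) y)"
    if "refine (f e) p x = refine (g e) q y" "j \<in> insert e J" for x y j
  proof (cases "j = e")
    case True
    then show ?thesis using refine_compat(2)[OF that(1)] by simp
  next
    case False
    then show ?thesis using compat[OF refine_compat(1)[OF that(1)], of j] that(2) by simp
  qed
  show ?thesis
  proof (rule sign_table.intro)
    show "finite (insert e J)" using fin by simp
    show "mono (refine (f e) p)" "mono (refine (g e) q)" by (fact refine_mono S2)+
    show "range (refine (f e) p) = range (refine (g e) q)" by (fact 1)
  qed (fact 2 refine_sep S3)+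
qed

end

end

section \<open>Transfer of signs\<close>

text \<open>Degrees are treated from the top downwards. At stage \<open>n\<close> only derivatives
  of, and remainders by, elements of degree \<open>Suc n\<close> are added. They have degree at most
  \<open>n\<close>, so the stages already completed are not disturbed and the process stops at
  degree 0.\<close>

lemma finite_closure:
  fixes deg :: "'x \<Rightarrow> nat"
  assumes der: "\<And>x. x \<in> U \<Longrightarrow> der x \<in> U" "\<And>x. x \<in> U \<Longrightarrow> 0 < deg x \<Longrightarrow> deg (der x) < deg x"
    and rm: "\<And>x y. x \<in> U \<Longrightarrow> y \<in> U \<Longrightarrow> 0 < deg y \<Longrightarrow> rm x y \<in> U \<and> deg (rm x y) < deg y"
    and A: "finite A" "A \<subseteq> U"
  shows "\<exists>B. finite B \<and> A \<subseteq> B \<and> B \<subseteq> U \<and> (\<forall>x\<in>B. 0 < deg x \<longrightarrow> der x \<in> B) \<and>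
    (\<forall>x\<in>B. \<forall>y\<in>B. 0 < deg y \<longrightarrow> deg y \<le> deg x \<longrightarrow> rm x y \<in> B)"
proof -
  define N where "N = Max (insert 0 (deg ` A))"
  have "\<exists>B. finite B \<and> A \<subseteq> B \<and> B \<subseteq> U \<and> (\<forall>x\<in>B. n < deg x \<longrightarrow> der x \<in> B) \<and>
    (\<forall>x\<in>B. \<forall>y\<in>B. n < deg y \<longrightarrow> deg y \<le> deg x \<longrightarrow> rm x y \<in> B)" if "n \<le> N" for n
    using that
  proof (induction n rule: inc_induct)
    case base
    have "deg x \<le> N" if "x \<in> A" for x
      unfolding N_def using A(1) that by (intro Max_ge) auto
    then show ?case using A by (intro exI[of _ A]) (auto simp: not_less[symmetric])
  next
    case (step n)
    then obtain B where B: "finite B" "A \<subseteq> B" "B \<subseteq> U"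
      "\<And>x. x \<in> B \<Longrightarrow> Suc n < deg x \<Longrightarrow> der x \<in> B"
      "\<And>x y. x \<in> B \<Longrightarrow> y \<in> B \<Longrightarrow> Suc n < deg y \<Longrightarrow> deg y \<le> deg x \<Longrightarrow> rm x y \<in> B"
      by blast
    define C where "C = der ` {x \<in> B. deg x = Suc n} \<union> (\<lambda>(x, y). rm x y) ` (B \<times> {y \<in> B. deg y = Suc n})"
    have C: "finite C" "C \<subseteq> U" "\<And>x. x \<in> C \<Longrightarrow> deg x \<le> n"
    proof -
      show "finite C" unfolding C_def using B(1) by simp
      show "C \<subseteq> U" unfolding C_def using B(3) der(1) rm by (auto simp: subset_iff)
      show "deg x \<le> n" if x: "x \<in> C" for x
      proof -
        have "deg x < Suc n"
          using x unfolding C_def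
        proof (elim UnE imageE CollectE conjE)
          fix y assume "x = der y" "y \<in> B" "deg y = Suc n"
          then show ?thesis using der(2)[of y] B(3) by auto
        next
          fix z assume "x = (case z of (x, y) \<Rightarrow> rm x y)" "z \<in> B \<times> {y \<in> B. deg y = Suc n}"
          then show ?thesis using rm[of "fst z" "snd z"] B(3) by (auto split: prod.splits)
        qed
        then show ?thesis by simp
      qed
    qed
    have D: "der x \<in> B \<union> C" if "x \<in> B \<union> C" "n < deg x" for x
    proof -
      have "x \<in> B" using that C(3)[of x] by auto
      then show ?thesis using B(4)[of x] that(2) by (cases "deg x = Suc n") (auto simp: C_def)
    qed
    have R: "rm x y \<in> B \<union> C" if "x \<in> B \<union> C" "y \<in> B \<union> C" "n < deg y" "deg y \<le> deg x" for x y
    proof -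
      have "x \<in> B" "y \<in> B" using that C(3)[of x] C(3)[of y] by auto
      then show ?thesis using B(5)[of x y] that by (cases "deg y = Suc n") (auto simp: C_def)
    qed
    show ?case
      by (rule exI[of _ "B \<union> C"]) (use B(1-3) C(1,2) D R in blast)
  qed
  from this[of 0] show ?thesis by simp
qed

text \<open>Polynomials enter in order of increasing degree. If \<open>j\<close> has maximal degree
  in \<open>S\<close>, its derivative and its remainders by members of \<open>S\<close> have smaller
  degree and are already in the table; at a root of \<open>f k\<close>, the sign of
  \<open>f j\<close> is that of the remainder, hence known. The induction starts with constants, for
  which the whole line is a single cell.\<close>

lemma sign_table_exists:
  fixes f :: "'j \<Rightarrow> 'a::rcf poly" and g :: "'j \<Rightarrow> 'b::rcf poly"
  assumes B: "finite B"
    and deg: "\<And>j. j \<in> B \<Longrightarrow> degree (g j) = degree (f j)"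
    and const: "\<And>j. j \<in> B \<Longrightarrow> degree (f j) = 0 \<Longrightarrow> sg (coeff (f j) 0) = sg (coeff (g j) 0)"
    and der: "\<And>j. j \<in> B \<Longrightarrow> 0 < degree (f j) \<Longrightarrow>
      der j \<in> B \<and> f (der j) = pderiv (f j) \<and> g (der j) = pderiv (g j)"
    and rm: "\<And>j k. j \<in> B \<Longrightarrow> k \<in> B \<Longrightarrow> 0 < degree (f k) \<Longrightarrow> degree (f k) \<le> degree (f j) \<Longrightarrow>
      rm j k \<in> B \<and> degree (f (rm j k)) < degree (f k) \<and>
      (\<forall>x. poly (f k) x = 0 \<longrightarrow> sg (poly (f j) x) = sg (poly (f (rm j k)) x)) \<and>
      (\<forall>y. poly (g k) y = 0 \<longrightarrow> sg (poly (g j) y) = sg (poly (g (rm j k)) y))"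
  shows "\<exists>p q. sign_table B f g p q"
proof -
  have "\<exists>p q. sign_table S f g p q"
    if "S \<subseteq> B" and "\<And>j k. j \<in> S \<Longrightarrow> k \<in> B \<Longrightarrow> degree (f k) < degree (f j) \<Longrightarrow> k \<in> S" for S
    using that
  proof (induction "card S" arbitrary: S rule: less_induct)
    case (less S)
    have fin: "finite S" using less.prems(1) B finite_subset by blast
    show ?case
    proof (cases "\<forall>j\<in>S. degree (f j) = 0")
      case True
      have "sg (poly (f j) x) = sg (poly (g j) y)" if "j \<in> S" for j x y
      proof -
        have "j \<in> B" using that less.prems(1) by blast
        have d: "degree (f j) = 0" using True that by blast
        obtain a where a: "f j = [:a:]" using degree_eq_zeroE[OF d] .
        have "degree (g j) = 0" using deg[OF \<open>j \<in> B\<close>] d by simp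
        then obtain b where b: "g j = [:b:]" by (rule degree_eq_zeroE)
        show ?thesis using const[OF \<open>j \<in> B\<close> d] a b by simp
      qed
      then have "sign_table S f g (\<lambda>_. 0) (\<lambda>_. 0)"
        using fin by (intro sign_table.intro) (auto simp: mono_def)
      then show ?thesis by blast
    next
      case False
      then have ne: "S \<noteq> {}" by auto
      have "Max ((\<lambda>j. degree (f j)) ` S) \<in> (\<lambda>j. degree (f j)) ` S"
        by (rule Max_in) (use fin ne in auto)
      then obtain j where j: "j \<in> S" "degree (f j) = Max ((\<lambda>j. degree (f j)) ` S)" by auto
      have max: "degree (f k) \<le> degree (f j)" if "k \<in> S" for k
        unfolding j(2) using fin that by (intro Max_ge) auto
      have jB: "j \<in> B" using j(1) less.prems(1) by blast
      have pos: "0 < degree (f j)" using False max by (metis gr0I le_0_eq)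
      define S' where "S' = S - {j}"
      have S: "S = insert j S'" using j(1) by (auto simp: S'_def)
      have low: "k \<in> S'" if "k \<in> B" "degree (f k) < degree (f j)" for k
        using less.prems(2)[OF j(1) that] that(2) by (auto simp: S'_def)
      have "\<exists>p q. sign_table S' f g p q"
      proof (rule less.hyps)
        show "card S' < card S" unfolding S'_def by (rule card_Diff1_less[OF fin j(1)])
        show "l \<in> S'" if "k \<in> S'" "l \<in> B" "degree (f l) < degree (f k)" for k l
          using low[OF that(2)] max[of k] that by (auto simp: S'_def)
      qed (use less.prems(1) in \<open>auto simp: S'_def\<close>)
      then obtain p q where "sign_table S' f g p q" by blast
      then interpret sign_table S' f g p q .
      have d: "der j \<in> S'" "f (der j) = pderiv (f j)" "g (der j) = pderiv (g j)"
        using der[OF jB pos] low[of "der j"] pos by (auto simp: degree_pderiv)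
      have "sign_table (insert j S') f g (refine (f j) p) (refine (g j) q)"
      proof (rule extend[OF pos _ d])
        show "0 < degree (g j)" using pos deg[OF jB] by simp
        show "sg (poly (f j) x) = sg (poly (g j) y)" if x: "root_class S' f x" and pq: "p x = q y" for x y
        proof -
          obtain k where k: "k \<in> S'" "f k \<noteq> 0" "poly (f k) x = 0"
            using x by (auto simp: root_class_def)
          have kB: "k \<in> B" "k \<in> S" using k(1) less.prems(1) by (auto simp: S'_def)
          have kpos: "0 < degree (f k)"
          proof (rule ccontr)
            assume "\<not> 0 < degree (f k)"
            then obtain a where "f k = [:a:]" by (metis degree_eq_zeroE gr0I)
            then show False using k by simp
          qed
          have y: "poly (g k) y = 0" using compat[OF pq k(1)] k(3) by simp
          note r = rm[OF jB kB(1) kpos max[OF kB(2)]]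
          have "rm j k \<in> S'" using r max[OF kB(2)] by (intro low) auto
          then show ?thesis using r k(3) y compat[OF pq, of "rm j k"] by auto
        qed
      qed
      then show ?thesis using S by metis
    qed
  qed
  from this[of B] show ?thesis by blast
qed

text \<open>\<open>C\<close> is a ring of coefficients with two interpretations: the first component in a real closed
  field, the second one depending on a point \<open>i\<close>; the signs agree once \<open>i\<close> is deep enough
  in the filter \<open>F\<close>.\<close>

locale coeff_ring =
  fixes C :: "('a::rcf \<times> ('i \<Rightarrow> 'b::rcf)) set" and F :: "'i filter"
  assumes one: "(1, \<lambda>_. 1) \<in> C"
    and uminus: "(a, \<alpha>) \<in> C \<Longrightarrow> (- a, \<lambda>i. - \<alpha> i) \<in> C"
    and add: "(a, \<alpha>) \<in> C \<Longrightarrow> (b, \<beta>) \<in> C \<Longrightarrow> (a + b, \<lambda>i. \<alpha> i + \<beta> i) \<in> C"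
    and mult: "(a, \<alpha>) \<in> C \<Longrightarrow> (b, \<beta>) \<in> C \<Longrightarrow> (a * b, \<lambda>i. \<alpha> i * \<beta> i) \<in> C"
    and sg: "(a, \<alpha>) \<in> C \<Longrightarrow> \<forall>\<^sub>F i in F. sg (\<alpha> i) = sg a"
begin

lemma zero: "(0, \<lambda>_. 0) \<in> C"
  using add[OF one uminus[OF one]] by simp

lemma sum: "(\<And>k. k \<in> K \<Longrightarrow> (a k, \<alpha> k) \<in> C) \<Longrightarrow> (sum a K, \<lambda>i. \<Sum>k\<in>K. \<alpha> k i) \<in> C"
  by (induction K rule: infinite_finite_induct) (auto intro: zero add)

lemma of_nat: "(of_nat n, \<lambda>_. of_nat n) \<in> C"
  by (induction n) (auto intro: zero add one)

text \<open>The degree bound is uniform in \<open>i\<close>. Agreement of signs holds only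
  eventually, and this survives conjunction over finitely many coefficients only.\<close>

definition polys :: "('a poly \<times> ('i \<Rightarrow> 'b poly)) set" where
  "polys = {(h, H). (\<forall>k. (coeff h k, \<lambda>i. coeff (H i) k) \<in> C) \<and> (\<exists>n. degree h \<le> n \<and> (\<forall>i. degree (H i) \<le> n))}"

lemma polysI:
  assumes "\<And>k. (coeff h k, \<lambda>i. coeff (H i) k) \<in> C" "degree h \<le> n" "\<And>i. degree (H i) \<le> n"
  shows "(h, H) \<in> polys"
  using assms by (auto simp: polys_def)

lemma polysE:
  assumes "(h, H) \<in> polys"
  obtains n where "\<And>k. (coeff h k, \<lambda>i. coeff (H i) k) \<in> C" "degree h \<le> n" "\<And>i. degree (H i) \<le> n"
  using assms by (auto simp: polys_def)

lemma polys_const: "(a, \<alpha>) \<in> C \<Longrightarrow> ([:a:], \<lambda>i. [:\<alpha> i:]) \<in> polys"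
  by (rule polysI[of _ _ 0]) (auto simp: coeff_pCons zero split: nat.splits)

lemma polys_var: "([:0, 1:], \<lambda>_. [:0, 1:]) \<in> polys"
  by (rule polysI[of _ _ 1]) (auto simp: coeff_pCons zero one split: nat.splits)

lemma polys_uminus: "(h, H) \<in> polys \<Longrightarrow> (- h, \<lambda>i. - H i) \<in> polys"
  by (elim polysE, rule polysI) (auto intro: uminus)

lemma polys_add:
  assumes "(h, H) \<in> polys" "(k, K) \<in> polys"
  shows "(h + k, \<lambda>i. H i + K i) \<in> polys"
proof -
  obtain m n where *: "\<And>l. (coeff h l, \<lambda>i. coeff (H i) l) \<in> C" "\<And>l. (coeff k l, \<lambda>i. coeff (K i) l) \<in> C"
    "degree h \<le> m" "degree k \<le> n" "\<And>i. degree (H i) \<le> m" "\<And>i. degree (K i) \<le> n"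
    using assms by (elim polysE) blast
  show ?thesis
    by (rule polysI[of _ _ "max m n"])
      (use *(1,2) *(3-6)[THEN le_trans, of "max m n"] in \<open>auto intro!: add degree_add_le\<close>)
qed

lemma polys_mult:
  assumes "(h, H) \<in> polys" "(k, K) \<in> polys"
  shows "(h * k, \<lambda>i. H i * K i) \<in> polys"
proof -
  obtain m n where *: "\<And>l. (coeff h l, \<lambda>i. coeff (H i) l) \<in> C" "\<And>l. (coeff k l, \<lambda>i. coeff (K i) l) \<in> C"
    "degree h \<le> m" "degree k \<le> n" "\<And>i. degree (H i) \<le> m" "\<And>i. degree (K i) \<le> n"
    using assms by (elim polysE) blast
  show ?thesis
  proof (rule polysI[of _ _ "m + n"])
    show "(coeff (h * k) l, \<lambda>i. coeff (H i * K i) l) \<in> C" for l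
      unfolding coeff_mult by (intro sum mult *)
    show "degree (h * k) \<le> m + n" "degree (H i * K i) \<le> m + n" for i
      using * degree_mult_le add_mono le_trans by meson+
  qed
qed

lemma polys_pderiv:
  assumes "(h, H) \<in> polys"
  shows "(pderiv h, \<lambda>i. pderiv (H i)) \<in> polys"
proof -
  obtain n where *: "\<And>l. (coeff h l, \<lambda>i. coeff (H i) l) \<in> C" "degree h \<le> n" "\<And>i. degree (H i) \<le> n"
    using assms by (elim polysE) blast
  show ?thesis
    by (rule polysI[of _ _ n])
      (use * in \<open>auto simp: coeff_pderiv degree_pderiv intro!: mult of_nat le_trans[OF diff_le_self]
        simp del: of_nat_Suc\<close>)
qed

lemma sg_coeff:
  assumes "(h, H) \<in> polys"
  shows "\<forall>\<^sub>F i in F. \<forall>k. sg (coeff (H i) k) = sg (coeff h k)"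
proof -
  obtain n where *: "\<And>l. (coeff h l, \<lambda>i. coeff (H i) l) \<in> C" "degree h \<le> n" "\<And>i. degree (H i) \<le> n"
    using assms by (elim polysE) blast
  have "\<forall>\<^sub>F i in F. \<forall>k\<in>{..n}. sg (coeff (H i) k) = sg (coeff h k)"
    using sg[OF *(1)] by (intro eventually_ball_finite) auto
  then show ?thesis
  proof eventually_elim
    case (elim i)
    have "coeff (H i) k = 0" "coeff h k = 0" if "n < k" for k
      using that *(2,3) by (metis coeff_eq_0 le_less_trans)+
    then show ?case using elim by (metis atMost_iff not_less sg_0)
  qed
qed

lemma degree_eq_if_sg_coeff:
  fixes h :: "'c::linordered_idom poly" and k :: "'d::linordered_idom poly"
  assumes "\<forall>n. sg (coeff h n) = sg (coeff k n)"
  shows "degree h = degree k"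
proof -
  have "coeff h n = 0 \<longleftrightarrow> coeff k n = 0" for n
    using assms by (metis sg_eq_iff(1))
  then show ?thesis
    by (metis coeff_eq_0 degree_le dual_order.antisym)
qed

text \<open>A remainder has to reproduce nothing but the signs at the roots of the divisor. For the
  second component this is demanded eventually, because the leading coefficient of the divisor may
  vanish at some \<open>i\<close>.\<close>

definition rem :: "('a poly \<times> ('i \<Rightarrow> 'b poly)) \<Rightarrow> ('a poly \<times> ('i \<Rightarrow> 'b poly)) \<Rightarrow> ('a poly \<times> ('i \<Rightarrow> 'b poly)) \<Rightarrow> bool" where
  "rem h k r \<longleftrightarrow> r \<in> polys \<and> degree (fst r) < degree (fst k) \<and>
    (\<forall>x. poly (fst k) x = 0 \<longrightarrow> sg (poly (fst h) x) = sg (poly (fst r) x)) \<and>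
    (\<forall>\<^sub>F i in F. \<forall>y. poly (snd k i) y = 0 \<longrightarrow> sg (poly (snd h i) y) = sg (poly (snd r i) y))"

lemma rem_exists:
  assumes h: "(h, H) \<in> polys" and k: "(k, K) \<in> polys" "0 < degree k"
  shows "\<exists>r. rem (h, H) (k, K) r"
  using h
proof (induction "degree h" arbitrary: h H rule: less_induct)
  case less
  show ?case
  proof (cases "degree h < degree k")
    case True
    then show ?thesis using less.prems by (intro exI[of _ "(h, H)"]) (simp add: rem_def)
  next
    case False
    define n m where "n = degree k" and "m = degree h - n"
    define a b where "a = lead_coeff h" and "b = lead_coeff k"
    \<comment> \<open>These are the coefficients at the degrees of \<open>h\<close> and
      \<open>k\<close>; they need not be the leading coefficients of \<open>H i\<close> and
      \<open>K i\<close> for every \<open>i\<close>.\<close>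
    define \<alpha> \<beta> where "\<alpha> = (\<lambda>i. coeff (H i) (degree h))" and "\<beta> = (\<lambda>i. coeff (K i) n)"
    have ab: "(a, \<alpha>) \<in> C" "(b, \<beta>) \<in> C"
      using less.prems k(1) by (auto simp: a_def b_def \<alpha>_def \<beta>_def n_def elim: polysE)
    have b0: "b \<noteq> 0" using k(2) by (auto simp: b_def)
    have var: "([:0, 1:] ^ m, \<lambda>_. [:0, 1:] ^ m) \<in> polys"
    proof (induction m)
      case 0
      then show ?case using polys_const[OF one] by (simp add: one_pCons)
    next
      case (Suc m)
      then show ?case unfolding power_Suc by (rule polys_mult[OF polys_var])
    qed
    \<comment> \<open>Pseudo-division, since \<open>C\<close> is only a ring. The factor is the
      square \<open>b * b\<close> and not \<open>b\<close>, so that the sign of \<open>h\<close> at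
      the roots of \<open>k\<close> is preserved.\<close>
    define h' where "h' = [:b * b:] * h + - ([:a * b:] * ([:0, 1:] ^ m * k))"
    define H' where "H' = (\<lambda>i. [:\<beta> i * \<beta> i:] * H i + - ([:\<alpha> i * \<beta> i:] * ([:0, 1:] ^ m * K i)))"
    have h': "(h', H') \<in> polys"
      unfolding h'_def H'_def
      by (intro polys_add polys_uminus polys_mult polys_const mult ab less.prems k(1) var)
    have hm: "degree h = m + n" using False by (simp add: m_def n_def)
    have c: "coeff ([:0, 1:] ^ m * k) l = (if l < m then 0 else coeff k (l - m))" for l
      by (simp add: coeff_monom_mult flip: monom_altdef[of 1, simplified])
    have "degree h' < degree h"
    proof (rule degree_lessI)
      show "h' \<noteq> 0 \<or> 0 < degree h" using False k(2) by linarith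
      show "\<forall>l\<ge>degree h. coeff h' l = 0"
      proof (intro allI impI)
        fix l assume l: "degree h \<le> l"
        show "coeff h' l = 0"
        proof (cases "l = degree h")
          case True
          then show ?thesis unfolding h'_def by (simp add: c hm a_def b_def n_def)
        next
          case False
          then have "coeff h l = 0" "coeff k (l - m) = 0"
            using l hm by (auto intro!: coeff_eq_0 simp: n_def)
          then show ?thesis unfolding h'_def by (simp add: c)
        qed
      qed
    qed
    from less.hyps[OF this h'] obtain r where r: "rem (h', H') (k, K) r" by blast
    have 1: "sg (poly h x) = sg (poly h' x)" if "poly k x = 0" for x
      using that b0 by (auto simp: h'_def sg_def zero_less_mult_iff)
    have 2: "\<forall>\<^sub>F i in F. \<forall>y. poly (K i) y = 0 \<longrightarrow> sg (poly (H i) y) = sg (poly (H' i) y)"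
      using sg[OF ab(2)]
    proof eventually_elim
      case (elim i)
      then have "\<beta> i \<noteq> 0" using b0 by (metis sg_eq_iff(1))
      then show ?case by (auto simp: H'_def sg_def zero_less_mult_iff)
    qed
    have "rem (h, H) (k, K) r"
      using r 1 eventually_conj[OF 2, of "\<lambda>i. \<forall>y. poly (K i) y = 0 \<longrightarrow> sg (poly (H' i) y) = sg (poly (snd r i) y)"]
      unfolding rem_def fst_conv snd_conv by (auto elim: eventually_mono)
    then show ?thesis by blast
  qed
qed

text \<open>A finite family \<open>B\<close> containing \<open>A\<close> is closed under derivatives
  and remainders. Deep enough in the filter, all its coefficients have matching signs and all its
  remainders are valid, which is what a sign table for \<open>B\<close> requires. The table covers
  the whole line, so a single \<open>i\<close> serves all \<open>x\<close>.\<close>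

theorem sign_transfer:
  assumes A: "finite A" "A \<subseteq> polys"
  shows "\<forall>\<^sub>F i in F. \<forall>x. \<exists>y. \<forall>j\<in>A. sg (poly (fst j) x) = sg (poly (snd j i) y)"
proof -
  define der where "der = (\<lambda>(h :: 'a poly, H :: 'i \<Rightarrow> 'b poly). (pderiv h, \<lambda>i. pderiv (H i)))"
  define rm where "rm = (\<lambda>h k. SOME r. rem h k r)"
  have rm: "rem h k (rm h k)" if "h \<in> polys" "k \<in> polys" "0 < degree (fst k)" for h k
    using rem_exists[of "fst h" "snd h" "fst k" "snd k"] that unfolding rm_def by (auto intro: someI_ex)
  have "\<exists>B. finite B \<and> A \<subseteq> B \<and> B \<subseteq> polys \<and> (\<forall>x\<in>B. 0 < degree (fst x) \<longrightarrow> der x \<in> B) \<and>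
    (\<forall>x\<in>B. \<forall>y\<in>B. 0 < degree (fst y) \<longrightarrow> degree (fst y) \<le> degree (fst x) \<longrightarrow> rm x y \<in> B)"
    by (rule finite_closure) (use A rm in \<open>auto simp: der_def degree_pderiv rem_def intro: polys_pderiv\<close>)
  then obtain B where B: "finite B" "A \<subseteq> B" "B \<subseteq> polys" "\<And>x. x \<in> B \<Longrightarrow> 0 < degree (fst x) \<Longrightarrow> der x \<in> B"
    "\<And>x y. x \<in> B \<Longrightarrow> y \<in> B \<Longrightarrow> 0 < degree (fst y) \<Longrightarrow> degree (fst y) \<le> degree (fst x) \<Longrightarrow> rm x y \<in> B"
    by blast
  have 1: "\<forall>\<^sub>F i in F. \<forall>j\<in>B. \<forall>k. sg (coeff (snd j i) k) = sg (coeff (fst j) k)"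
    using B(1,3) sg_coeff by (intro eventually_ball_finite) auto
  have 2: "\<forall>\<^sub>F i in F. \<forall>j\<in>B. \<forall>k\<in>B. 0 < degree (fst k) \<longrightarrow>
      (\<forall>y. poly (snd k i) y = 0 \<longrightarrow> sg (poly (snd j i) y) = sg (poly (snd (rm j k) i) y))"
    using B(1)
  proof (intro eventually_ball_finite ballI)
    fix j k assume "j \<in> B" "k \<in> B"
    then show "\<forall>\<^sub>F i in F. 0 < degree (fst k) \<longrightarrow>
        (\<forall>y. poly (snd k i) y = 0 \<longrightarrow> sg (poly (snd j i) y) = sg (poly (snd (rm j k) i) y))"
      using rm[of j k] B(3) by (cases "0 < degree (fst k)") (auto simp: rem_def)
  qed auto
  from 1 2 show ?thesis
  proof eventually_elim
    case (elim i)
    have "\<exists>p q. sign_table B fst (\<lambda>j. snd j i) p q"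
    proof (rule sign_table_exists[where der = der and rm = rm])
      show "degree (snd j i) = degree (fst j)" if "j \<in> B" for j
        using elim(1) that degree_eq_if_sg_coeff by blast
      show "sg (coeff (fst j) 0) = sg (coeff (snd j i) 0)" if "j \<in> B" for j
        using elim(1) that by simp
      show "der j \<in> B \<and> fst (der j) = pderiv (fst j) \<and> snd (der j) i = pderiv (snd j i)"
        if "j \<in> B" "0 < degree (fst j)" for j
        using B(4)[OF that] by (auto simp: der_def split: prod.splits)
      show "rm j k \<in> B \<and> degree (fst (rm j k)) < degree (fst k) \<and>
          (\<forall>x. poly (fst k) x = 0 \<longrightarrow> sg (poly (fst j) x) = sg (poly (fst (rm j k)) x)) \<and>
          (\<forall>y. poly (snd k i) y = 0 \<longrightarrow> sg (poly (snd j i) y) = sg (poly (snd (rm j k) i) y))"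
        if "j \<in> B" "k \<in> B" "0 < degree (fst k)" "degree (fst k) \<le> degree (fst j)" for j k
        using B(3) B(5)[OF that] rm[of j k] elim(2) that unfolding rem_def by blast
    qed (fact B(1))
    then obtain p q where "sign_table B fst (\<lambda>j. snd j i) p q" by blast
    then interpret sign_table B fst "\<lambda>j. snd j i" p q .
    show ?case
    proof
      fix x
      obtain y where "q y = p x" using ex_q by blast
      then show "\<exists>y. \<forall>j\<in>A. sg (poly (fst j) x) = sg (poly (snd j i) y)"
        using compat[of x y] B(2) by (intro exI[of _ y]) auto
    qed
  qed
qed

end


section \<open>Sign transfer for real polynomial functions\<close>

text \<open>The arguments are sequences of which only the first \<open>n\<close> entries may occur.
  The type is the same for all \<open>n\<close>, as the induction on the number of variables
  requires.\<close>

inductive_set polyfun :: "nat \<Rightarrow> ((nat \<Rightarrow> real) \<Rightarrow> real) set" for n where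
  const: "(\<lambda>_. c) \<in> polyfun n"
| var: "i < n \<Longrightarrow> (\<lambda>a. a i) \<in> polyfun n"
| add: "f \<in> polyfun n \<Longrightarrow> g \<in> polyfun n \<Longrightarrow> (\<lambda>a. f a + g a) \<in> polyfun n"
| mult: "f \<in> polyfun n \<Longrightarrow> g \<in> polyfun n \<Longrightarrow> (\<lambda>a. f a * g a) \<in> polyfun n"

lemma polyfun_uminus: "f \<in> polyfun n \<Longrightarrow> (\<lambda>a. - f a) \<in> polyfun n"
  using polyfun.mult[OF polyfun.const[of "-1"]] by fastforce

lemma polyfun_mono: "n \<le> m \<Longrightarrow> polyfun n \<subseteq> polyfun m"
proof
  fix f assume "f \<in> polyfun n" and "n \<le> m"
  then show "f \<in> polyfun m" by induction (auto intro: polyfun.intros)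
qed

lemma polyfun_0_const: "f \<in> polyfun 0 \<Longrightarrow> \<exists>c. f = (\<lambda>_. c)"
  by (induction rule: polyfun.induct) auto

text \<open>The map \<open>\<phi>\<close> plays the role of evaluation at a point over
  \<open>'a\<close>. Polynomial functions in \<open>n\<close> variables become coefficients with two
  interpretations, their value under \<open>\<phi>\<close> and their value at a real point; the next
  variable is then transferred by \<open>sign_transfer\<close>.\<close>

theorem polyfun_sign_transfer:
  fixes \<phi> :: "((nat \<Rightarrow> real) \<Rightarrow> real) \<Rightarrow> 'a::rcf"
  assumes const: "\<And>c. sg (\<phi> (\<lambda>_. c)) = sg c"
    and add: "\<And>f g. f \<in> polyfun N \<Longrightarrow> g \<in> polyfun N \<Longrightarrow> \<phi> (\<lambda>a. f a + g a) = \<phi> f + \<phi> g"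
    and mult: "\<And>f g. f \<in> polyfun N \<Longrightarrow> g \<in> polyfun N \<Longrightarrow> \<phi> (\<lambda>a. f a * g a) = \<phi> f * \<phi> g"
    and A: "n \<le> N" "finite A" "A \<subseteq> polyfun n"
  shows "\<exists>a. \<forall>f\<in>A. sg (f a) = sg (\<phi> f)"
  using A
proof (induction n arbitrary: A)
  case 0
  have "sg (f a) = sg (\<phi> f)" if fA: "f \<in> A" for f and a
  proof -
    obtain c where "f = (\<lambda>_. c)" using 0 fA polyfun_0_const[of f] by auto
    then show ?thesis using const[of c] by simp
  qed
  then show ?case by blast
next
  case (Suc n)
  have sub: "f \<in> polyfun N" if "f \<in> polyfun n" for f
    using that polyfun_mono[of n N] Suc.prems(1) by auto
  have subS: "f \<in> polyfun N" if "f \<in> polyfun (Suc n)" for f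
    using that polyfun_mono[of "Suc n" N] Suc.prems(1) by auto
  define C where "C = (\<lambda>f. (\<phi> f, f)) ` polyfun n"
  define F where "F = (INF f\<in>polyfun n. principal {a. sg (f a) = sg (\<phi> f)})"
  \<comment> \<open>The value is idempotent and positive, hence 1.\<close>
  have phi1: "\<phi> (\<lambda>_. 1) = 1"
    using mult[OF polyfun.const polyfun.const, of 1 1] const[of 1] by (auto simp: sg_def split: if_splits)
  have phi0: "\<phi> (\<lambda>_. 0) = 0"
    using const[of 0] by simp
  have CI: "(a, f) \<in> C" if "f \<in> polyfun n" "a = \<phi> f" for a f
    using that by (auto simp: C_def)
  interpret coeff_ring C F
  proof
    show "(1, \<lambda>_. 1) \<in> C"
      by (rule CI) (auto simp: phi1 intro: polyfun.const)
    fix a \<alpha> assume a: "(a, \<alpha>) \<in> C"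
    then have \<alpha>: "\<alpha> \<in> polyfun n" "a = \<phi> \<alpha>" by (auto simp: C_def)
    have "\<phi> (\<lambda>i. - \<alpha> i) = - a"
      using add[OF sub[OF \<alpha>(1)] sub[OF polyfun_uminus[OF \<alpha>(1)]]] phi0 \<alpha>(2) by (simp add: eq_neg_iff_add_eq_0)
    then show "(- a, \<lambda>i. - \<alpha> i) \<in> C"
      by (intro CI polyfun_uminus \<alpha>) simp
    show "\<forall>\<^sub>F i in F. sg (\<alpha> i) = sg a"
      unfolding F_def using \<alpha> by (intro eventually_INF1[OF \<alpha>(1)]) (simp add: eventually_principal)
    fix b \<beta> assume "(b, \<beta>) \<in> C"
    then have \<beta>: "\<beta> \<in> polyfun n" "b = \<phi> \<beta>" by (auto simp: C_def)
    show "(a + b, \<lambda>i. \<alpha> i + \<beta> i) \<in> C" "(a * b, \<lambda>i. \<alpha> i * \<beta> i) \<in> C"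
      by (intro CI polyfun.add polyfun.mult \<alpha> \<beta>;
        simp add: \<alpha> \<beta> add[OF sub sub] mult[OF sub sub])+
  qed
  \<comment> \<open>If the filter were improper, finitely many of the generating sign conditions
    would be inconsistent, contrary to the induction hypothesis.\<close>
  have ne: "F \<noteq> bot"
  proof
    assume "F = bot"
    then have "eventually (\<lambda>_. False) F" by simp
    from this[unfolded F_def, THEN eventually_INF[THEN iffD1]] obtain Y where Y: "Y \<subseteq> polyfun n" "finite Y"
      "eventually (\<lambda>_. False) (INF f\<in>Y. principal {a. sg (f a) = sg (\<phi> f)})"
      by (elim exE conjE)
    obtain a where "\<forall>f\<in>Y. sg (f a) = sg (\<phi> f)"
      using Suc.IH[OF _ Y(2,1)] Suc.prems(1) by auto
    then have "a \<in> (\<Inter>f\<in>Y. {a. sg (f a) = sg (\<phi> f)})" by simp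
    moreover have "(\<Inter>f\<in>Y. {a. sg (f a) = sg (\<phi> f)}) = {}"
      using Y(3) unfolding INF_principal_finite[OF Y(2)] eventually_principal by blast
    ultimately show False by blast
  qed
  \<comment> \<open>The value of the last variable over \<open>'a\<close>. Every function in
    \<open>polyfun (Suc n)\<close> is a polynomial in this variable with coefficients in
    \<open>C\<close>, and \<open>sign_transfer\<close> provides the real counterpart
    \<open>y\<close> of \<open>\<xi>\<close>.\<close>
  define \<xi> where "\<xi> = \<phi> (\<lambda>a. a n)"
  have "\<exists>h\<in>polys. poly (fst h) \<xi> = \<phi> f \<and> (\<forall>a b. poly (snd h a) b = f (a(n := b)))"
    if "f \<in> polyfun (Suc n)" for f
    using that
  proof induction
    case (const c)
    show ?case
      by (rule bexI[OF _ polys_const[OF CI[OF polyfun.const[of c] refl]]]) simp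
  next
    case (var i)
    show ?case
    proof (cases "i = n")
      case True
      then show ?thesis by (intro bexI[OF _ polys_var]) (simp add: \<xi>_def)
    next
      case False
      then have "i < n" using var by simp
      then show ?thesis
        by (intro bexI[OF _ polys_const[OF CI[OF polyfun.var refl]]]) (use False in auto)
    qed
  next
    case (add f g)
    then obtain h k where hk: "h \<in> polys" "k \<in> polys" "poly (fst h) \<xi> = \<phi> f" "poly (fst k) \<xi> = \<phi> g"
      "\<And>a b. poly (snd h a) b = f (a(n := b))" "\<And>a b. poly (snd k a) b = g (a(n := b))" by blast
    show ?case
      by (rule bexI[OF _ polys_add[of "fst h" "snd h" "fst k" "snd k"]])
        (use hk assms(2)[OF subS subS] add.hyps in \<open>auto simp del: fun_upd_apply\<close>)
  next
    case (mult f g)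
    then obtain h k where hk: "h \<in> polys" "k \<in> polys" "poly (fst h) \<xi> = \<phi> f" "poly (fst k) \<xi> = \<phi> g"
      "\<And>a b. poly (snd h a) b = f (a(n := b))" "\<And>a b. poly (snd k a) b = g (a(n := b))" by blast
    show ?case
      by (rule bexI[OF _ polys_mult[of "fst h" "snd h" "fst k" "snd k"]])
        (use hk assms(3)[OF subS subS] mult.hyps in \<open>auto simp del: fun_upd_apply\<close>)
  qed
  then obtain hh where hh: "\<And>f. f \<in> polyfun (Suc n) \<Longrightarrow> hh f \<in> polys \<and> poly (fst (hh f)) \<xi> = \<phi> f \<and>
      (\<forall>a b. poly (snd (hh f) a) b = f (a(n := b)))"
    by metis
  have "\<forall>\<^sub>F a in F. \<forall>x. \<exists>y. \<forall>j\<in>hh ` A. sg (poly (fst j) x) = sg (poly (snd j a) y)"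
    by (rule sign_transfer) (use Suc.prems hh in auto)
  from eventually_happens[OF this] ne obtain a y where
    "\<forall>j\<in>hh ` A. sg (poly (fst j) \<xi>) = sg (poly (snd j a) y)" by blast
  then show ?case
    using hh Suc.prems(3) by (intro exI[of _ "a(n := y)"]) (auto simp: subset_iff simp del: fun_upd_apply)
qed

section \<open>Real closures\<close>

locale field_embedding =
  fixes \<iota> :: "'a::field \<Rightarrow> 'b::field"
  assumes add: "\<iota> (x + y) = \<iota> x + \<iota> y" and mult: "\<iota> (x * y) = \<iota> x * \<iota> y" and one: "\<iota> 1 = 1"
begin

lemma zero: "\<iota> 0 = 0"
proof -
  have "\<iota> 0 + \<iota> 0 = \<iota> 0 + 0" using add[of 0 0] by simp
  then show ?thesis by (rule add_left_imp_eq)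
qed

lemma eq_0_iff: "\<iota> x = 0 \<longleftrightarrow> x = 0"
  using mult[of x "inverse x"] one zero by (metis mult_zero_left right_inverse zero_neq_one)

lemma minus: "\<iota> (- x) = - \<iota> x"
  using add[of x "- x"] zero by (simp add: eq_neg_iff_add_eq_0 add.commute)

definition ev :: "'b \<Rightarrow> 'a poly \<Rightarrow> 'b" where
  "ev \<alpha> h = poly (map_poly \<iota> h) \<alpha>"

lemma ev_0 [simp]: "ev \<alpha> 0 = 0"
  by (simp add: ev_def)

lemma ev_pCons [simp]: "ev \<alpha> (pCons a h) = \<iota> a + \<alpha> * ev \<alpha> h"
  by (cases "a = 0 \<and> h = 0") (auto simp: ev_def map_poly_pCons eq_0_iff zero)

lemma ev_1 [simp]: "ev \<alpha> 1 = 1"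
  by (simp add: one_pCons one del: pCons_one)

lemma ev_add [simp]: "ev \<alpha> (h + k) = ev \<alpha> h + ev \<alpha> k"
proof (induction h arbitrary: k)
  case (pCons a h)
  then show ?case by (cases k) (simp add: add algebra_simps)
qed simp

lemma ev_smult [simp]: "ev \<alpha> (smult a h) = \<iota> a * ev \<alpha> h"
  by (induction h) (simp_all add: mult algebra_simps)

lemma ev_mult [simp]: "ev \<alpha> (h * k) = ev \<alpha> h * ev \<alpha> k"
  by (induction h) (simp_all add: zero algebra_simps)

lemma ev_root_exists:
  assumes "0 < degree h" and "\<And>p :: 'b poly. 0 < degree p \<Longrightarrow> \<exists>x. poly p x = 0"
  shows "\<exists>\<alpha>. ev \<alpha> h = 0"
  unfolding ev_def
  by (rule assms(2)) (use assms(1) in \<open>simp add: degree_map_poly eq_0_iff\<close>)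

lemma ev_of_elem: "ev (\<iota> c) h = \<iota> (poly h c)"
  by (induction h) (simp_all add: add mult zero)

end

text \<open>Any ordering of an extension containing \<alpha> that extends the given one makes all
  these weighted sums of squares nonnegative. Hence -1 among them is the obstruction to extending
  the order.\<close>

inductive_set ext_cone :: "('a::linordered_field \<Rightarrow> 'b::field) \<Rightarrow> 'b \<Rightarrow> 'b set"
  for \<iota> :: "'a \<Rightarrow> 'b" and \<alpha> :: 'b where
  zero: "0 \<in> ext_cone \<iota> \<alpha>"
| step: "0 \<le> t \<Longrightarrow> s \<in> ext_cone \<iota> \<alpha> \<Longrightarrow> \<iota> t * (field_embedding.ev \<iota> \<alpha> h)\<^sup>2 + s \<in> ext_cone \<iota> \<alpha>"

text \<open>If a root \<open>\<alpha>\<close> of \<open>f\<close> cannot be adjoined as an ordered extension, then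
  $-1 = \sum t_i h_i^2$ modulo \<open>f\<close>; the cofactor in $1 + \sum t_i h_i^2 = f g$ changes sign
  wherever \<open>f\<close> does, and it has smaller degree if the $h_i$ are reduced modulo \<open>f\<close>.\<close>

lemma IVT_if_no_ordered_extension:
  fixes \<iota> :: "'a::linordered_field \<Rightarrow> 'b::field" and f :: "'a poly"
  assumes "field_embedding \<iota>"
    and closed: "\<And>p :: 'b poly. 0 < degree p \<Longrightarrow> \<exists>x. poly p x = 0"
    and maximal: "\<And>\<alpha>. - 1 \<notin> ext_cone \<iota> \<alpha> \<Longrightarrow> \<alpha> \<in> range \<iota>"
    and ab: "a < b"
  shows "poly f a * poly f b < 0 \<Longrightarrow> \<exists>c. a < c \<and> c < b \<and> poly f c = 0"
proof (induction "degree f" arbitrary: f rule: less_induct)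
  case less
  interpret field_embedding \<iota> by fact
  have fact: ?case if "f = u * v" "degree u < degree f" "degree v < degree f" for u v
  proof -
    have "(poly u a * poly u b) * (poly v a * poly v b) < 0"
      using less.prems that(1) by (simp add: mult_ac)
    then consider "poly u a * poly u b < 0" | "poly v a * poly v b < 0"
      by (metis mult_less_0_iff)
    then show ?thesis
      using less.hyps[OF that(2)] less.hyps[OF that(3)] that(1) by cases auto
  qed
  have deg: "0 < degree f"
  proof (rule ccontr)
    assume "\<not> 0 < degree f"
    then obtain c where "f = [:c:]" by (metis degree_eq_zeroE gr0I)
    then show False using less.prems by (simp add: mult_less_0_iff)
  qed
  obtain \<alpha> where \<alpha>: "ev \<alpha> f = 0"
    using ev_root_exists[OF deg closed] by blast
  have f0: "f \<noteq> 0" using deg by auto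
  show ?case
  proof (cases "\<alpha> \<in> range \<iota>")
    case True
    then obtain c where "\<alpha> = \<iota> c" by blast
    then have c: "poly f c = 0" using \<alpha> by (simp add: ev_of_elem eq_0_iff)
    then obtain g where g: "f = [:- c, 1:] * g" by (auto simp: poly_eq_0_iff_dvd)
    then have "g \<noteq> 0" using f0 by auto
    then have dg: "degree g < degree f" unfolding g by (subst degree_mult_eq) auto
    have "c \<noteq> a" "c \<noteq> b" using less.prems c by auto
    show ?thesis
    proof (cases "a < c \<and> c < b")
      \<comment> \<open>If \<open>c\<close> lies outside the interval, the linear factor has the
        same sign at both ends, so it is the cofactor that changes sign.\<close>
      case False
      then have "0 < (a - c) * (b - c)"
        using \<open>c \<noteq> a\<close> \<open>c \<noteq> b\<close> ab by (auto simp: zero_less_mult_iff)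
      moreover have "(a - c) * (b - c) * (poly g a * poly g b) < 0"
        using less.prems unfolding g by (simp add: algebra_simps)
      ultimately have "poly g a * poly g b < 0"
        by (metis mult_less_0_iff order_less_asym)
      from less.hyps[OF dg this] obtain d where "a < d" "d < b" "poly g d = 0" by blast
      then show ?thesis unfolding g by (intro exI[of _ d]) simp
    qed (use c in auto)
  next
    case False
    then have neg: "- 1 \<in> ext_cone \<iota> \<alpha>" using maximal by blast
    \<comment> \<open>A minimal polynomial of \<alpha>. Either \<open>f\<close> splits properly as
      \<open>m * u\<close> and the induction hypothesis applies to the factors, or \<open>f\<close>
      is a constant multiple of \<open>m\<close> and itself divides every polynomial that vanishes
      at \<alpha>.\<close>
    define m where "m = (ARG_MIN degree m. m \<noteq> 0 \<and> ev \<alpha> m = 0)"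
    have m: "m \<noteq> 0" "ev \<alpha> m = 0" and m_min: "\<And>h. h \<noteq> 0 \<Longrightarrow> ev \<alpha> h = 0 \<Longrightarrow> degree m \<le> degree h"
      using arg_min_nat_lemma[of "\<lambda>m. m \<noteq> 0 \<and> ev \<alpha> m = 0" f degree] f0 \<alpha> unfolding m_def by auto
    have dvd: "m dvd h" if "ev \<alpha> h = 0" for h
    proof -
      have "ev \<alpha> h = ev \<alpha> (h div m * m + h mod m)" by simp
      then have "ev \<alpha> (h mod m) = 0" unfolding ev_add ev_mult using that m by simp
      moreover have "h mod m = 0 \<or> degree (h mod m) < degree m" using m(1) degree_mod_less by blast
      ultimately show ?thesis using m_min[of "h mod m"] by (metis mod_eq_0_iff_dvd not_less)
    qed
    obtain u where u: "f = m * u" using dvd[OF \<alpha>] by (elim dvdE)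
    have u0: "u \<noteq> 0" using u f0 by auto
    have degf: "degree f = degree m + degree u" using u m(1) u0 by (simp add: degree_mult_eq)
    have degm: "0 < degree m"
    proof (rule ccontr)
      assume "\<not> 0 < degree m"
      then obtain c where "m = [:c:]" by (metis degree_eq_zeroE gr0I)
      then show False using m by (simp add: eq_0_iff)
    qed
    show ?thesis
    proof (cases "degree u = 0")
      case False
      then show ?thesis using fact[OF u] degf degm by simp
    next
      case True
      have fdvd: "f dvd h" if "ev \<alpha> h = 0" for h
      proof -
        obtain c where "u = [:c:]" using degree_eq_zeroE[OF True] .
        then have "f = smult c m" "c \<noteq> 0" using u u0 by auto
        then show ?thesis using dvd[OF that] by (simp add: smult_dvd_iff)
      qed
      \<comment> \<open>Elements of the cone are lifted to nonnegative polynomials. Reduction modulo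
        \<open>f\<close> bounds each square by degree \<open>2 * degree f - 2\<close>, which leaves
        degree less than \<open>degree f\<close> for the cofactor \<open>g\<close>.\<close>
      have "\<exists>G. ev \<alpha> G = s \<and> (\<forall>x. 0 \<le> poly G x) \<and> degree G < 2 * degree f - 1" if "s \<in> ext_cone \<iota> \<alpha>" for s
        using that
      proof induction
        case zero
        show ?case using deg by (intro exI[of _ 0]) simp
      next
        case (step t s h)
        then obtain G where G: "ev \<alpha> G = s" "\<And>x. 0 \<le> poly G x" "degree G < 2 * degree f - 1" by blast
        define k where "k = h mod f"
        have "ev \<alpha> h = ev \<alpha> (h div f * f + h mod f)" by simp
        then have k: "ev \<alpha> h = ev \<alpha> k" unfolding ev_add ev_mult k_def using \<alpha> by simp
        have degk: "degree k < degree f" unfolding k_def using degree_mod_less_degree[OF f0] deg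
          by (metis degree_0 degree_mod_less f0)
        have "degree (smult t (k * k)) \<le> degree k + degree k"
          using degree_smult_le degree_mult_le le_trans by meson
        then have "degree (smult t (k * k) + G) < 2 * degree f - 1"
          using degk G(3) by (intro degree_add_less) auto
        then show ?case
          using G k step.hyps(1) by (intro exI[of _ "smult t (k * k) + G"]) (simp add: power2_eq_square)
      qed
      from this[OF neg] obtain G where G: "ev \<alpha> G = - 1" "\<And>x. 0 \<le> poly G x" "degree G < 2 * degree f - 1"
        by blast
      obtain g where g: "1 + G = f * g" using fdvd[of "1 + G"] G(1) by (auto elim: dvdE)
      \<comment> \<open>Thus \<open>f\<close> and \<open>g\<close> have the same nonzero sign
        everywhere. The sign change of \<open>g\<close> contradicts this, because the induction
        hypothesis turns it into a zero of \<open>g\<close>.\<close>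
      have pos: "0 < poly f x * poly g x" for x
        using arg_cong[OF g, of "\<lambda>p. poly p x"] G(2)[of x] by simp
      have "g \<noteq> 0" using pos[of 0] by auto
      then have "degree f + degree g = degree (1 + G)" using g f0 by (simp add: degree_mult_eq)
      also have "\<dots> < 2 * degree f - 1" using G(3) deg by (intro degree_add_less) auto
      finally have "degree g < degree f" by simp
      moreover have "poly g a * poly g b < 0"
        using pos[of a] pos[of b] less.prems by (auto simp: zero_less_mult_iff mult_less_0_iff)
      ultimately obtain c where "poly g c = 0" using less.hyps by blast
      then show ?thesis using pos[of c] by simp
    qed
  qed
qed

section \<open>Maximal precones and linear orders\<close>

text \<open>A preordering of the ring \<open>differences T\<close> rather than of the whole field:
  squares are required only for differences of members. One set thus records both a subring and a
  cone in it, and a maximal \<open>T\<close> enlarges the two together.\<close>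

definition precone :: "'a::field set \<Rightarrow> bool" where
  "precone T \<longleftrightarrow> 1 \<in> T \<and> - 1 \<notin> T \<and> (\<forall>x\<in>T. \<forall>y\<in>T. x + y \<in> T \<and> x * y \<in> T \<and> (x - y)\<^sup>2 \<in> T)"

definition differences :: "'a::group_add set \<Rightarrow> 'a set" where
  "differences T = {x - y |x y. x \<in> T \<and> y \<in> T}"

lemma precone_differences:
  assumes T: "precone T" and xy: "x \<in> differences T" "y \<in> differences T"
  shows "- x \<in> differences T" "x + y \<in> differences T" "x * y \<in> differences T"
proof -
  obtain a b c d where x: "x = a - b" "y = c - d" and t: "a \<in> T" "b \<in> T" "c \<in> T" "d \<in> T"
    using xy by (auto simp: differences_def)
  have cl: "x + y \<in> T" "x * y \<in> T" if "x \<in> T" "y \<in> T" for x y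
    using T that unfolding precone_def by blast+
  have "x + y = (a + c) - (b + d)" "x * y = (a * c + b * d) - (a * d + b * c)" "- x = b - a"
    by (simp_all add: x algebra_simps)
  moreover have "a + c \<in> T" "b + d \<in> T" "a * c + b * d \<in> T" "a * d + b * c \<in> T"
    by (intro cl t)+
  ultimately show "- x \<in> differences T" "x + y \<in> differences T" "x * y \<in> differences T"
    unfolding differences_def using t by blast+
qed

lemma ex_maximal_precone:
  assumes "precone T0"
  shows "\<exists>T. precone T \<and> T0 \<subseteq> T \<and> (\<forall>S. precone S \<longrightarrow> T \<subseteq> S \<longrightarrow> S = T)"
proof -
  define A where "A = {T. precone T \<and> T0 \<subseteq> T}"
  have "\<forall>C\<in>chains A. \<exists>U\<in>A. \<forall>S\<in>C. S \<subseteq> U"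
  proof
    fix C assume C: "C \<in> chains A"
    show "\<exists>U\<in>A. \<forall>S\<in>C. S \<subseteq> U"
    proof (cases "C = {}")
      case True
      then show ?thesis using assms by (auto simp: A_def)
    next
      case False
      have CA: "\<And>T. T \<in> C \<Longrightarrow> precone T \<and> T0 \<subseteq> T"
        using chainsD2[OF C] by (auto simp: A_def)
      have "precone (\<Union>C)"
        unfolding precone_def
      proof (intro conjI ballI)
        show "1 \<in> \<Union>C" "- 1 \<notin> \<Union>C" using False CA unfolding precone_def by blast+
        fix x y assume "x \<in> \<Union>C" "y \<in> \<Union>C"
        then obtain S T where ST: "S \<in> C" "T \<in> C" "x \<in> S" "y \<in> T" by blast
        then obtain T where "T \<in> C" "x \<in> T" "y \<in> T" using chainsD[OF C ST(1,2)] by blast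
        then show "x + y \<in> \<Union>C" "x * y \<in> \<Union>C" "(x - y)\<^sup>2 \<in> \<Union>C"
          using CA[of T] unfolding precone_def by blast+
      qed
      then have "\<Union>C \<in> A" using False CA by (auto simp: A_def)
      then show ?thesis by blast
    qed
  qed
  from Zorn_Lemma2[OF this] obtain M where M: "M \<in> A" "\<And>S. S \<in> A \<Longrightarrow> M \<subseteq> S \<Longrightarrow> S = M" by blast
  have "S = M" if "precone S" "M \<subseteq> S" for S
    using M(1) M(2)[of S] that by (auto simp: A_def)
  then show ?thesis using M(1) by (intro exI[of _ M]) (simp add: A_def)
qed

text \<open>By the last assumption the differences form a subfield. \<open>antisym\<close> and
  \<open>total\<close> identify \<open>T\<close> as the nonnegative elements of a linear order on
  it.\<close>

locale maximal_precone =
  fixes T :: "'a::field set"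
  assumes precone: "precone T"
    and maximal: "\<And>S. precone S \<Longrightarrow> T \<subseteq> S \<Longrightarrow> S = T"
    and inverse: "\<And>x. x \<in> differences T \<Longrightarrow> inverse x \<in> differences T"
begin

lemma closed: "x \<in> T \<Longrightarrow> y \<in> T \<Longrightarrow> x + y \<in> T" "x \<in> T \<Longrightarrow> y \<in> T \<Longrightarrow> x * y \<in> T"
  "1 \<in> T" "0 \<in> T" "- 1 \<notin> T" "x \<in> differences T \<Longrightarrow> x\<^sup>2 \<in> T"
proof -
  have *: "x + y \<in> T" "x * y \<in> T" "(x - y)\<^sup>2 \<in> T" if "x \<in> T" "y \<in> T" for x y
    using precone that unfolding precone_def by blast+
  show "x \<in> T \<Longrightarrow> y \<in> T \<Longrightarrow> x + y \<in> T" "x \<in> T \<Longrightarrow> y \<in> T \<Longrightarrow> x * y \<in> T"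
    using * by blast+
  show "1 \<in> T" "- 1 \<notin> T" using precone unfolding precone_def by blast+
  then have "(1 - 1)\<^sup>2 \<in> T" using *(3) by blast
  then show "0 \<in> T" by simp
  show "x \<in> differences T \<Longrightarrow> x\<^sup>2 \<in> T" using *(3) unfolding differences_def by blast
qed

lemma T_differences: "x \<in> T \<Longrightarrow> x \<in> differences T"
  using closed(4) by (force simp: differences_def)

lemma differences_closed: "x \<in> differences T \<Longrightarrow> - x \<in> differences T"
  "x \<in> differences T \<Longrightarrow> y \<in> differences T \<Longrightarrow> x + y \<in> differences T"
  "x \<in> differences T \<Longrightarrow> y \<in> differences T \<Longrightarrow> x * y \<in> differences T"
  using precone_differences[OF precone] by blast+

lemma differences_0_1: "0 \<in> differences T" "1 \<in> differences T"
  using T_differences closed by auto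

lemma antisym: "x \<in> T \<Longrightarrow> - x \<in> T \<Longrightarrow> x = 0"
proof (rule ccontr)
  assume x: "x \<in> T" "- x \<in> T" "x \<noteq> 0"
  then have "(inverse x)\<^sup>2 * (x * - x) \<in> T"
    by (intro closed inverse T_differences x)
  moreover have "(inverse x)\<^sup>2 * (x * - x) = - 1"
    using x(3) by (simp add: power2_eq_square field_simps)
  ultimately show False using closed(5) by simp
qed

text \<open>Otherwise $T + xT$ would be a strictly larger precone. It stays inside
  \<open>differences T\<close>, so the squares of its differences are already in
  \<open>T\<close>.\<close>

lemma adjoin:
  assumes x: "x \<in> differences T" "x \<notin> T"
  shows "\<exists>a\<in>T. \<exists>b\<in>T. - 1 = a + x * b"
proof (rule ccontr)
  assume *: "\<not> ?thesis"
  define S where "S = {a + x * b |a b. a \<in> T \<and> b \<in> T}"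
  have TS: "T \<subseteq> S"
  proof
    fix t assume "t \<in> T"
    then have "t = t + x * 0 \<and> t \<in> T \<and> 0 \<in> T" using closed by simp
    then show "t \<in> S" unfolding S_def by blast
  qed
  have xx: "x * x \<in> T" using closed(6)[OF x(1)] by (simp add: power2_eq_square)
  have SD: "y \<in> differences T" if "y \<in> S" for y
  proof -
    obtain a b where "y = a + x * b" "a \<in> T" "b \<in> T" using \<open>y \<in> S\<close> unfolding S_def by blast
    then show ?thesis using x(1) by (simp add: differences_closed T_differences)
  qed
  have "precone S"
    unfolding precone_def
  proof (intro conjI ballI)
    show "1 \<in> S" using TS closed by blast
    show "- 1 \<notin> S" using * by (auto simp: S_def)
    fix y z assume yz: "y \<in> S" "z \<in> S"
    then obtain a b c d where y: "y = a + x * b" "z = c + x * d" and T: "a \<in> T" "b \<in> T" "c \<in> T" "d \<in> T"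
      by (auto simp: S_def)
    have "y + z = (a + c) + x * (b + d)" "y * z = (a * c + x * x * (b * d)) + x * (a * d + b * c)"
      by (simp_all add: y algebra_simps)
    moreover have "a + c \<in> T" "b + d \<in> T" "a * c + x * x * (b * d) \<in> T" "a * d + b * c \<in> T"
      by (intro closed(1,2) T xx)+
    ultimately show "y + z \<in> S" "y * z \<in> S"
      unfolding S_def by blast+
    have "y + - z \<in> differences T" by (intro differences_closed SD yz)
    then have "(y + - z)\<^sup>2 \<in> T" by (rule closed(6))
    then show "(y - z)\<^sup>2 \<in> S" using TS by auto
  qed
  then have "S = T" using maximal TS by blast
  moreover have "x = 0 + x * 1 \<and> 0 \<in> T \<and> 1 \<in> T" using closed by simp
  then have "x \<in> S" unfolding S_def by blast
  ultimately show False using x(2) by simp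
qed

text \<open>If neither \<open>x\<close> nor \<open>- x\<close> could be adjoined, then $xb = -(1 +
  a)$ and $xd = 1 + c$ with \<open>a\<close>, \<open>b\<close>, \<open>c\<close>, \<open>d\<close>
  in \<open>T\<close>. Multiplying the two equations exhibits -1 as an element of
  \<open>T\<close>.\<close>

lemma total:
  assumes x: "x \<in> differences T"
  shows "x \<in> T \<or> - x \<in> T"
proof (rule ccontr)
  assume *: "\<not> ?thesis"
  obtain a b where ab: "a \<in> T" "b \<in> T" "- 1 = a + x * b"
    using adjoin[OF x] * by blast
  obtain c d where cd: "c \<in> T" "d \<in> T" "- 1 = c + - x * d"
    using adjoin[OF differences_closed(1)[OF x]] * by blast
  have "x * b = (a + x * b) - a" "x * d = c - (c + - x * d)" by simp_all
  then have e: "x * b = - 1 - a" "x * d = c - - 1" unfolding ab(3)[symmetric] cd(3)[symmetric] .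
  have "x\<^sup>2 * (b * d) = (x * b) * (x * d)" by (simp add: power2_eq_square)
  then have "- 1 = a + c + a * c + x\<^sup>2 * (b * d)"
    unfolding e by (simp add: algebra_simps)
  moreover have "a + c + a * c + x\<^sup>2 * (b * d) \<in> T"
    by (intro closed ab cd x)
  ultimately show False using closed(5) by simp
qed

end

section \<open>Formally real fields\<close>

inductive_set sos :: "'a::comm_ring_1 set" where
  zero: "0 \<in> sos"
| step: "s \<in> sos \<Longrightarrow> x\<^sup>2 + s \<in> sos"

lemma sos_square: "x\<^sup>2 \<in> sos"
  using sos.step[OF sos.zero, of x] by simp

lemma sos_add: "s \<in> sos \<Longrightarrow> t \<in> sos \<Longrightarrow> s + t \<in> sos"
  by (induction rule: sos.induct) (auto simp: add.assoc intro: sos.step)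

lemma sos_square_mult: "s \<in> sos \<Longrightarrow> x\<^sup>2 * s \<in> sos"
proof (induction rule: sos.induct)
  case (step s y)
  have "x\<^sup>2 * (y\<^sup>2 + s) = (x * y)\<^sup>2 + x\<^sup>2 * s" by (simp add: algebra_simps power_mult_distrib)
  then show ?case using step sos.step by metis
qed (auto intro: sos.zero)

lemma sos_mult: "s \<in> sos \<Longrightarrow> t \<in> sos \<Longrightarrow> s * t \<in> sos"
  by (induction rule: sos.induct) (auto simp: distrib_right intro: sos.zero sos_add sos_square_mult)

text \<open>Every \<open>c\<close> is the difference of the squares of \<open>(c + 1) / 2\<close>
  and \<open>(c - 1) / 2\<close>. Division by 2 is possible, since \<open>2 = 0\<close> would make
  -1 equal to the square of 1.\<close>

lemma to_ac_range_differences: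
  assumes "- 1 \<notin> (sos :: 'k::field set)" "to_ac ` (sos :: 'k set) \<subseteq> T"
  shows "to_ac (c :: 'k) \<in> differences T"
proof -
  have two: "(2 :: 'k) \<noteq> 0"
  proof
    assume "(2 :: 'k) = 0"
    then have "(1 :: 'k) + 1 = 0" by simp
    then have "(- 1 :: 'k) = 1" by (simp add: neg_eq_iff_add_eq_0)
    then show False using assms(1) sos_square[of "1 :: 'k"] by (metis power_one)
  qed
  have "(4 :: 'k) = 2 * 2" by simp
  then have four: "(4 :: 'k) \<noteq> 0" using two by (metis mult_eq_0_iff)
  have "((c + 1) / 2)\<^sup>2 - ((c - 1) / 2)\<^sup>2 = ((c + 1)\<^sup>2 - (c - 1)\<^sup>2) / 4"
    by (simp add: power_divide flip: diff_divide_distrib)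
  also have "(c + 1)\<^sup>2 - (c - 1)\<^sup>2 = 4 * c"
    by (simp add: algebra_simps power2_eq_square)
  finally have "c = ((c + 1) / 2)\<^sup>2 - ((c - 1) / 2)\<^sup>2"
    using four by simp
  then have "to_ac c = to_ac (((c + 1) / 2)\<^sup>2) - to_ac (((c - 1) / 2)\<^sup>2)"
    by (metis to_ac_diff)
  then show ?thesis
    unfolding differences_def using assms(2) sos_square by blast
qed

text \<open>The sums of squares of the base field form a precone of its algebraic closure. The
  differences of a maximal precone above it form a ring between the base field and the closure; its
  elements are algebraic over the base field, so it is a field.\<close>

lemma maximal_precone_exists:
  assumes fr: "- 1 \<notin> (sos :: 'k::field set)"
  shows "\<exists>T :: 'k alg_closure set. maximal_precone T \<and> range to_ac \<subseteq> differences T"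
proof -
  have "precone (to_ac ` (sos :: 'k set))"
    unfolding precone_def
  proof (intro conjI ballI)
    show "1 \<in> to_ac ` (sos :: 'k set)"
      using sos_square[of "1 :: 'k"] by (auto intro: image_eqI[of _ _ 1])
    have "- 1 = to_ac (- 1 :: 'k)" by simp
    then show "- 1 \<notin> to_ac ` (sos :: 'k set)" using fr by (metis imageE to_ac_eq_iff)
    fix x y assume "x \<in> to_ac ` (sos :: 'k set)" "y \<in> to_ac ` (sos :: 'k set)"
    then obtain a b :: 'k where ab: "x = to_ac a" "y = to_ac b" "a \<in> sos" "b \<in> sos" by blast
    have "x + y = to_ac (a + b)" "x * y = to_ac (a * b)" "(x - y)\<^sup>2 = to_ac ((a - b)\<^sup>2)"
      using ab by simp_all
    then show "x + y \<in> to_ac ` (sos :: 'k set)" "x * y \<in> to_ac ` (sos :: 'k set)"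
      "(x - y)\<^sup>2 \<in> to_ac ` (sos :: 'k set)"
      using ab(3,4) by (simp_all only: imageI sos_add sos_mult sos_square)
  qed
  then obtain T where T: "precone T" "to_ac ` (sos :: 'k set) \<subseteq> T" "\<And>S. precone S \<Longrightarrow> T \<subseteq> S \<Longrightarrow> S = T"
    using ex_maximal_precone by blast
  note range = to_ac_range_differences[OF fr T(2)]
  note D = precone_differences[OF T(1)]
  have poly: "poly (map_poly to_ac p) x \<in> differences T" if "x \<in> differences T" for x and p :: "'k poly"
    by (induction p) (use range[of 0] range D that in \<open>auto simp: map_poly_pCons\<close>)
  have inv: "inverse x \<in> differences T" if x: "x \<in> differences T" for x
  proof (cases "x = 0")
    case True
    then show ?thesis using x by simp
  next
    case False
    obtain p :: "'k poly" where p: "p \<noteq> 0" "poly (map_poly to_ac p) x = 0"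
      by (rule alg_closure_algebraic)
    \<comment> \<open>Cancelling powers of \<open>x\<close> makes the constant coefficient of the
      annihilating polynomial nonzero; the inverse of \<open>x\<close> is then a polynomial
      expression in \<open>x\<close>.\<close>
    then have "\<exists>a q. a \<noteq> 0 \<and> poly (map_poly to_ac (pCons (a :: 'k) q)) x = 0"
    proof (induction p)
      case (pCons a p)
      show ?case
      proof (cases "a = 0")
        case True
        then have "p \<noteq> 0" "poly (map_poly to_ac p) x = 0"
          using pCons.prems False by (auto simp: map_poly_pCons)
        then show ?thesis using pCons.IH by blast
      qed (use pCons.prems in blast)
    qed simp
    then obtain a q where aq: "a \<noteq> 0" "poly (map_poly to_ac (pCons (a :: 'k) q)) x = 0" by blast
    then have "to_ac a + x * poly (map_poly to_ac q) x = 0"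
      by (simp add: map_poly_pCons)
    then have "inverse x = - (to_ac (inverse a) * poly (map_poly to_ac q) x)"
      using False aq(1) by (simp add: field_simps eq_neg_iff_add_eq_0)
    then show ?thesis using D range poly[OF x] by metis
  qed
  show ?thesis
    using T inv range by (intro exI[of _ T]) (auto intro!: maximal_precone.intro)
qed

section \<open>The real Nullstellensatz for real prime ideals\<close>

definition polyfuns :: "((nat \<Rightarrow> real) \<Rightarrow> real) set" where
  "polyfuns = (\<Union>n. polyfun n)"

lemma polyfunsE2:
  assumes "f \<in> polyfuns" "g \<in> polyfuns"
  obtains n where "f \<in> polyfun n" "g \<in> polyfun n"
proof -
  obtain k l where "f \<in> polyfun k" "g \<in> polyfun l" using assms by (auto simp: polyfuns_def)
  then have "f \<in> polyfun (max k l)" "g \<in> polyfun (max k l)"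
    using polyfun_mono[of k "max k l"] polyfun_mono[of l "max k l"] by auto
  then show ?thesis by (rule that)
qed

lemma polyfuns_closed:
  "(\<lambda>_. c) \<in> polyfuns" "(\<lambda>a. a i) \<in> polyfuns"
  "f \<in> polyfuns \<Longrightarrow> (\<lambda>a. - f a) \<in> polyfuns"
  "f \<in> polyfuns \<Longrightarrow> g \<in> polyfuns \<Longrightarrow> (\<lambda>a. f a + g a) \<in> polyfuns"
  "f \<in> polyfuns \<Longrightarrow> g \<in> polyfuns \<Longrightarrow> (\<lambda>a. f a * g a) \<in> polyfuns"
proof -
  show "(\<lambda>_. c) \<in> polyfuns" "(\<lambda>a. a i) \<in> polyfuns" "f \<in> polyfuns \<Longrightarrow> (\<lambda>a. - f a) \<in> polyfuns"
    unfolding polyfuns_def using polyfun.const polyfun.var[of i "Suc i"] polyfun_uminus by blast+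
  assume "f \<in> polyfuns" "g \<in> polyfuns"
  then obtain n where "f \<in> polyfun n" "g \<in> polyfun n" by (rule polyfunsE2)
  from polyfun.add[OF this] polyfun.mult[OF this]
  show "(\<lambda>a. f a + g a) \<in> polyfuns" "(\<lambda>a. f a * g a) \<in> polyfuns"
    by (auto simp: polyfuns_def)
qed

lemma polyfuns_diff: "f \<in> polyfuns \<Longrightarrow> g \<in> polyfuns \<Longrightarrow> (\<lambda>a. f a - g a) \<in> polyfuns"
  using polyfuns_closed(4)[OF _ polyfuns_closed(3), of f g] by simp

text \<open>The domain of the functions is arbitrary, so that real sequences and quaternionic points
  are covered by the same notion.\<close>

locale real_prime_ideal =
  fixes R P :: "('e \<Rightarrow> real) set"
  assumes subset: "P \<subseteq> R"
    and zero: "(\<lambda>_. 0) \<in> P" and one: "(\<lambda>_. 1) \<notin> P"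
    and add: "f \<in> P \<Longrightarrow> g \<in> P \<Longrightarrow> (\<lambda>a. f a + g a) \<in> P"
    and mult: "f \<in> R \<Longrightarrow> g \<in> P \<Longrightarrow> (\<lambda>a. f a * g a) \<in> P"
    and prime: "f \<in> R \<Longrightarrow> g \<in> R \<Longrightarrow> (\<lambda>a. f a * g a) \<in> P \<Longrightarrow> f \<in> P \<or> g \<in> P"
    and real: "set fs \<subseteq> R \<Longrightarrow> (\<lambda>a. \<Sum>f\<leftarrow>fs. (f a)\<^sup>2) \<in> P \<Longrightarrow> set fs \<subseteq> P"

definition counterexample :: "((nat \<Rightarrow> real) \<Rightarrow> real) set \<Rightarrow> bool" where
  "counterexample P \<longleftrightarrow> real_prime_ideal polyfuns P \<and>
    (\<exists>A g. finite A \<and> A \<subseteq> P \<and> g \<in> polyfuns \<and> g \<notin> P \<and> (\<forall>a. (\<forall>f\<in>A. f a = 0) \<longrightarrow> g a = 0))"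

text \<open>Types cannot depend on terms, so the residue field of a real prime ideal is constructed for one
  fixed ideal only: a counterexample to the real Nullstellensatz, if there is any.\<close>

definition P0 :: "((nat \<Rightarrow> real) \<Rightarrow> real) set" where
  "P0 = (if \<exists>P. counterexample P then SOME P. counterexample P else {f \<in> polyfuns. f (\<lambda>_. 0) = 0})"

text \<open>Without a counterexample, \<open>P0\<close> consists of the functions vanishing at the
  origin. This makes it a real prime ideal unconditionally, as the class instances of the residue
  ring require.\<close>

interpretation P0: real_prime_ideal polyfuns P0
proof (cases "\<exists>P. counterexample P")
  case True
  then show "real_prime_ideal polyfuns P0"
    using someI_ex[OF True] by (auto simp: P0_def counterexample_def[of "Eps _"])
next
  case False
  have "(\<forall>f\<in>set fs. f (\<lambda>_. 0) = 0)"
    if "(\<Sum>f\<leftarrow>fs. (f (\<lambda>_. 0))\<^sup>2) = (0 :: real)" for fs :: "((nat \<Rightarrow> real) \<Rightarrow> real) list"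
  proof -
    have "\<forall>x\<in>set (map (\<lambda>f. (f (\<lambda>_. 0))\<^sup>2) fs). x = (0 :: real)"
      using that by (subst sum_list_nonneg_eq_0_iff[symmetric]) auto
    then show ?thesis by simp
  qed
  note sos = this
  have P0: "P0 = {f \<in> polyfuns. f (\<lambda>_. 0) = 0}" using False by (simp add: P0_def)
  show "real_prime_ideal polyfuns P0"
    unfolding P0 by unfold_locales (auto simp: polyfuns_closed dest: sos)
qed

lemma P0_uminus: "f \<in> P0 \<Longrightarrow> (\<lambda>a. - f a) \<in> P0"
  using P0.mult[OF polyfuns_closed(1)[of "-1"], of f] by simp

section \<open>The residue ring and its fraction field\<close>

definition P0_cong :: "((nat \<Rightarrow> real) \<Rightarrow> real) \<Rightarrow> ((nat \<Rightarrow> real) \<Rightarrow> real) \<Rightarrow> bool" where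
  "P0_cong f g \<longleftrightarrow> f \<in> polyfuns \<and> g \<in> polyfuns \<and> (\<lambda>a. f a - g a) \<in> P0"

lemma P0_cong_refl: "f \<in> polyfuns \<Longrightarrow> P0_cong f f"
  by (simp add: P0_cong_def P0.zero)

lemma P0_cong_sym: "P0_cong f g \<Longrightarrow> P0_cong g f"
  unfolding P0_cong_def using P0_uminus[of "\<lambda>a. f a - g a"] by simp

lemma P0_cong_trans: "P0_cong f g \<Longrightarrow> P0_cong g h \<Longrightarrow> P0_cong f h"
  unfolding P0_cong_def using P0.add[of "\<lambda>a. f a - g a" "\<lambda>a. g a - h a"] by simp

quotient_type residue_ring = "(nat \<Rightarrow> real) \<Rightarrow> real" / partial: P0_cong
proof (rule part_equivpI)
  show "\<exists>f. P0_cong f f" using P0_cong_refl polyfuns_closed(1) by blast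
  show "symp P0_cong" using P0_cong_sym by (rule sympI)
  show "transp P0_cong" using P0_cong_trans by (rule transpI)
qed

instantiation residue_ring :: comm_ring_1
begin

lift_definition zero_residue_ring :: residue_ring is "\<lambda>_. 0"
  by (intro P0_cong_refl polyfuns_closed)

lift_definition one_residue_ring :: residue_ring is "\<lambda>_. 1"
  by (intro P0_cong_refl polyfuns_closed)

lift_definition uminus_residue_ring :: "residue_ring \<Rightarrow> residue_ring" is "\<lambda>f a. - f a"
  unfolding P0_cong_def using P0_uminus by (fastforce intro: polyfuns_closed simp: algebra_simps)

lift_definition plus_residue_ring :: "residue_ring \<Rightarrow> residue_ring \<Rightarrow> residue_ring" is "\<lambda>f g a. f a + g a"
  unfolding P0_cong_def using P0.add by (fastforce intro: polyfuns_closed simp: algebra_simps)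

lift_definition minus_residue_ring :: "residue_ring \<Rightarrow> residue_ring \<Rightarrow> residue_ring" is "\<lambda>f g a. f a - g a"
proof -
  fix f f' g g' assume "P0_cong f f'" "P0_cong g g'"
  then show "P0_cong (\<lambda>a. f a - g a) (\<lambda>a. f' a - g' a)"
    unfolding P0_cong_def using P0.add[of "\<lambda>a. f a - f' a" "\<lambda>a. - (g a - g' a)"] P0_uminus[of "\<lambda>a. g a - g' a"]
    by (simp add: polyfuns_diff algebra_simps)
qed

lift_definition times_residue_ring :: "residue_ring \<Rightarrow> residue_ring \<Rightarrow> residue_ring" is "\<lambda>f g a. f a * g a"
proof -
  fix f f' g g' assume *: "P0_cong f f'" "P0_cong g g'"
  have "(\<lambda>a. g a * (f a - f' a) + f' a * (g a - g' a)) \<in> P0"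
    using * unfolding P0_cong_def by (intro P0.add P0.mult) auto
  then show "P0_cong (\<lambda>a. f a * g a) (\<lambda>a. f' a * g' a)"
    using * by (simp add: P0_cong_def polyfuns_closed algebra_simps)
qed

instance
proof
  fix x y z :: residue_ring
  show "x * y * z = x * (y * z)" "x * y = y * x" "1 * x = x" "x + y + z = x + (y + z)" "x + y = y + x"
    "0 + x = x" "- x + x = 0" "x - y = x + - y" "(x + y) * z = x * z + y * z"
    by (transfer, simp add: algebra_simps P0_cong_def polyfuns_closed polyfuns_diff P0.zero)+
  show "(0 :: residue_ring) \<noteq> 1"
    by transfer (use P0.one P0_uminus[of "\<lambda>_. - 1"] in \<open>auto simp: P0_cong_def polyfuns_closed\<close>)
qed

end

instance residue_ring :: idom
proof
  fix x y :: residue_ring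
  assume "x \<noteq> 0" "y \<noteq> 0"
  then show "x * y \<noteq> 0"
    by transfer (use P0.prime in \<open>auto simp: P0_cong_def polyfuns_closed\<close>)
qed

definition residue :: "((nat \<Rightarrow> real) \<Rightarrow> real) \<Rightarrow> residue_ring" where
  "residue = abs_residue_ring"

lemma residue_simps:
  "residue (\<lambda>_. 0) = 0" "residue (\<lambda>_. 1) = 1"
  "f \<in> polyfuns \<Longrightarrow> g \<in> polyfuns \<Longrightarrow> residue (\<lambda>a. f a + g a) = residue f + residue g"
  "f \<in> polyfuns \<Longrightarrow> g \<in> polyfuns \<Longrightarrow> residue (\<lambda>a. f a * g a) = residue f * residue g"
  by (simp_all add: residue_def zero_residue_ring_def one_residue_ring_def plus_residue_ring.abs_eq
      times_residue_ring.abs_eq P0_cong_refl)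

lemma residue_eq_0_iff: "f \<in> polyfuns \<Longrightarrow> residue f = 0 \<longleftrightarrow> f \<in> P0"
  unfolding residue_def zero_residue_ring_def
  using Quotient_rel[OF Quotient_residue_ring, of f "\<lambda>_. 0"] P0_cong_refl[of f]
    P0_cong_refl[OF polyfuns_closed(1), of 0]
  by (auto simp: P0_cong_def polyfuns_closed)

lemma residue_surj: "\<exists>f\<in>polyfuns. x = residue f"
proof -
  have "P0_cong (rep_residue_ring x) (rep_residue_ring x)" "abs_residue_ring (rep_residue_ring x) = x"
    using Quotient_residue_ring Quotient_rep_reflp Quotient_abs_rep by metis+
  then show ?thesis unfolding residue_def P0_cong_def by metis
qed

lemma residue_ring_real:
  assumes "(\<Sum>x\<leftarrow>xs. x\<^sup>2) = (0 :: residue_ring)"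
  shows "set xs \<subseteq> {0}"
proof -
  obtain r where r: "\<And>x. r x \<in> polyfuns \<and> x = residue (r x)"
    using residue_surj by metis
  define fs where "fs = map r xs"
  have fs: "set fs \<subseteq> polyfuns" "xs = map residue fs"
    using r by (auto simp: fs_def o_def map_idI[symmetric])
  have "(\<lambda>a. \<Sum>f\<leftarrow>gs. (f a)\<^sup>2) \<in> polyfuns \<and> residue (\<lambda>a. \<Sum>f\<leftarrow>gs. (f a)\<^sup>2) = (\<Sum>f\<leftarrow>gs. (residue f)\<^sup>2)"
    if "set gs \<subseteq> polyfuns" for gs
    using that
    by (induction gs) (auto simp: residue_simps polyfuns_closed power2_eq_square)
  note * = this[OF fs(1)]
  have "(\<Sum>f\<leftarrow>fs. (residue f)\<^sup>2) = 0"
    using assms unfolding fs(2) by (simp add: o_def)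
  then have "(\<lambda>a. \<Sum>f\<leftarrow>fs. (f a)\<^sup>2) \<in> P0"
    using * residue_eq_0_iff by metis
  then show ?thesis
    using P0.real[OF fs(1)] residue_eq_0_iff fs by (auto simp: subset_iff)
qed

text \<open>Clearing denominators: multiplication by the square of a common denominator keeps the
  shape of a sum of squares.\<close>

lemma residue_fract_sos:
  assumes "s \<in> (sos :: residue_ring fract set)"
  shows "\<exists>d xs. d \<noteq> 0 \<and> s * (Fract d 1)\<^sup>2 = Fract (\<Sum>x\<leftarrow>xs. x\<^sup>2) 1"
  using assms
proof induction
  case zero
  show ?case by (intro exI[of _ 1] exI[of _ "[]"]) (simp add: Zero_fract_def)
next
  case (step s y)
  then obtain d xs where d: "d \<noteq> 0" "s * (Fract d 1)\<^sup>2 = Fract (\<Sum>x\<leftarrow>xs. x\<^sup>2) 1" by blast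
  obtain a b where y: "y = Fract a b" "b \<noteq> 0" by (cases y) auto
  have *: "(\<Sum>x\<leftarrow>map ((*) b) xs. x\<^sup>2) = b\<^sup>2 * (\<Sum>x\<leftarrow>xs. x\<^sup>2)"
    by (induction xs) (simp_all add: algebra_simps power_mult_distrib)
  have "(y\<^sup>2 + s) * (Fract (b * d) 1)\<^sup>2 = y\<^sup>2 * (Fract (b * d) 1)\<^sup>2 + (Fract b 1)\<^sup>2 * (s * (Fract d 1)\<^sup>2)"
    by (simp add: algebra_simps power2_eq_square)
  also have "y\<^sup>2 * (Fract (b * d) 1)\<^sup>2 = Fract ((a * d)\<^sup>2) 1"
    using y d by (simp add: power2_eq_square eq_fract mult_ac)
  also have "(Fract b 1)\<^sup>2 * (s * (Fract d 1)\<^sup>2) = Fract (\<Sum>x\<leftarrow>map ((*) b) xs. x\<^sup>2) 1"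
    unfolding d(2) * by (simp add: power2_eq_square)
  finally have "(y\<^sup>2 + s) * (Fract (b * d) 1)\<^sup>2 = Fract (\<Sum>x\<leftarrow>(a * d) # map ((*) b) xs. x\<^sup>2) 1"
    by simp
  moreover have "b * d \<noteq> 0" using y d by simp
  ultimately show ?case by blast
qed

text \<open>If -1 were a sum of squares, the square of a common denominator \<open>d\<close> and
  further squares would add up to 0 in the residue ring, which forces \<open>d = 0\<close>.\<close>

lemma residue_fract_real: "- 1 \<notin> (sos :: residue_ring fract set)"
proof
  assume "- 1 \<in> (sos :: residue_ring fract set)"
  then obtain d xs where d: "d \<noteq> 0" "- 1 * (Fract d 1)\<^sup>2 = Fract (\<Sum>x\<leftarrow>xs. x\<^sup>2) (1 :: residue_ring)"
    using residue_fract_sos by blast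
  then have "- d\<^sup>2 = (\<Sum>x\<leftarrow>xs. x\<^sup>2)"
    by (simp add: power2_eq_square eq_fract)
  then have "(\<Sum>x\<leftarrow>d # xs. x\<^sup>2) = 0"
    by (simp add: neg_eq_iff_add_eq_0)
  from residue_ring_real[OF this] d(1) show False by simp
qed

section \<open>A real closed field containing the residue field\<close>

definition T0 :: "residue_ring fract alg_closure set" where
  "T0 = (SOME T. maximal_precone T \<and> range to_ac \<subseteq> differences T)"

lemma T0: "maximal_precone T0" "range to_ac \<subseteq> differences T0"
  using someI_ex[OF maximal_precone_exists[OF residue_fract_real]] unfolding T0_def by blast+

interpretation T0: maximal_precone T0
  by (rule T0)

typedef residue_closure = "differences T0"
  using T0.differences_0_1 by blast

setup_lifting type_definition_residue_closure

instantiation residue_closure :: linordered_field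
begin

lift_definition zero_residue_closure :: residue_closure is 0
  by (rule T0.differences_0_1)

lift_definition one_residue_closure :: residue_closure is 1
  by (rule T0.differences_0_1)

lift_definition plus_residue_closure :: "residue_closure \<Rightarrow> residue_closure \<Rightarrow> residue_closure" is "(+)"
  by (rule T0.differences_closed)

lift_definition uminus_residue_closure :: "residue_closure \<Rightarrow> residue_closure" is uminus
  by (rule T0.differences_closed)

lift_definition times_residue_closure :: "residue_closure \<Rightarrow> residue_closure \<Rightarrow> residue_closure" is "(*)"
  by (rule T0.differences_closed)

lift_definition inverse_residue_closure :: "residue_closure \<Rightarrow> residue_closure" is inverse
  by (rule T0.inverse)

lift_definition less_eq_residue_closure :: "residue_closure \<Rightarrow> residue_closure \<Rightarrow> bool" is "\<lambda>x y. y - x \<in> T0" .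

lift_definition minus_residue_closure :: "residue_closure \<Rightarrow> residue_closure \<Rightarrow> residue_closure" is "(-)"
  using T0.differences_closed(1,2) by (metis diff_conv_add_uminus)

lift_definition divide_residue_closure :: "residue_closure \<Rightarrow> residue_closure \<Rightarrow> residue_closure" is "(/)"
  unfolding divide_inverse by (intro T0.differences_closed T0.inverse)

definition "x < y \<longleftrightarrow> x \<le> y \<and> x \<noteq> y" for x y :: residue_closure

definition "\<bar>x\<bar> = (if x < 0 then - x else x)" for x :: residue_closure

definition "sgn x = (if x = 0 then 0 else if 0 < x then 1 else - 1)" for x :: residue_closure

instance
proof
  fix x y z :: residue_closure
  show "x * y * z = x * (y * z)" "x * y = y * x" "1 * x = x" "x + y + z = x + (y + z)" "x + y = y + x"
    "0 + x = x" "- x + x = 0" "(x + y) * z = x * z + y * z" "(0 :: residue_closure) \<noteq> 1"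
    "x - y = x + - y" "x div y = x * inverse y"
    "x \<noteq> 0 \<Longrightarrow> inverse x * x = 1" "inverse (0 :: residue_closure) = 0"
    "x + y - x = y" "x - y - z = x - (y + z)" "0 * x = 0" "x * 0 = 0"
    by (transfer, simp add: algebra_simps divide_inverse)+
  show "\<bar>x\<bar> = (if x < 0 then - x else x)"
    "sgn x = (if x = 0 then 0 else if 0 < x then 1 else - 1)"
    by (simp_all add: abs_residue_closure_def sgn_residue_closure_def)
  show refl: "x \<le> x" by transfer (simp add: T0.closed)
  show trans: "x \<le> y \<Longrightarrow> y \<le> z \<Longrightarrow> x \<le> z"
    by transfer (use T0.closed(1) in fastforce)
  show antisym: "x \<le> y \<Longrightarrow> y \<le> x \<Longrightarrow> x = y"
    by transfer (metis T0.antisym eq_iff_diff_eq_0 minus_diff_eq)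
  show "x \<le> y \<or> y \<le> x"
    by transfer (metis T0.total T0.differences_closed(1,2) diff_conv_add_uminus minus_diff_eq)
  show "x < y \<longleftrightarrow> x \<le> y \<and> \<not> y \<le> x"
    using refl antisym by (auto simp: less_residue_closure_def)
  show "x \<le> y \<Longrightarrow> z + x \<le> z + y"
    by transfer simp
  show "x < y \<Longrightarrow> 0 < z \<Longrightarrow> z * x < z * y"
  proof -
    assume xy: "x < y" and z: "0 < z"
    have "z * x \<le> z * y"
      using xy z unfolding less_residue_closure_def
      by transfer (metis T0.closed(2) diff_zero right_diff_distrib)
    moreover have "z * x \<noteq> z * y"
      using xy z unfolding less_residue_closure_def by transfer auto
    ultimately show ?thesis by (simp add: less_residue_closure_def)
  qed
qed

end


interpretation residue_closure: field_embedding Rep_residue_closure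
  by unfold_locales
    (simp_all add: plus_residue_closure.rep_eq times_residue_closure.rep_eq one_residue_closure.rep_eq)

lemma range_Rep: "range Rep_residue_closure = differences T0"
  using type_definition.Rep_range[OF type_definition_residue_closure] .

lemma residue_closure_maximal:
  assumes "- 1 \<notin> ext_cone Rep_residue_closure \<alpha>"
  shows "\<alpha> \<in> range Rep_residue_closure"
proof -
  let ?S = "ext_cone Rep_residue_closure \<alpha>"
  let ?ev = "residue_closure.ev \<alpha>"
  have square: "(?ev h)\<^sup>2 \<in> ?S" for h
    using ext_cone.step[OF zero_le_one ext_cone.zero, of Rep_residue_closure \<alpha> h] residue_closure.one by simp
  have plus: "s + u \<in> ?S" if "s \<in> ?S" "u \<in> ?S" for s u
    using that by induction (auto simp: add.assoc intro: ext_cone.step)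
  have weighted: "Rep_residue_closure t * (?ev h)\<^sup>2 * u \<in> ?S" if "0 \<le> t" "u \<in> ?S" for t h u
    using that(2)
  proof induction
    case (step t' s h')
    have *: "Rep_residue_closure t * (?ev h)\<^sup>2 * (Rep_residue_closure t' * (?ev h')\<^sup>2 + s) =
      Rep_residue_closure (t * t') * (?ev (h * h'))\<^sup>2 + Rep_residue_closure t * (?ev h)\<^sup>2 * s"
      by (simp add: residue_closure.mult power_mult_distrib algebra_simps)
    show ?case
      unfolding * by (rule ext_cone.step[OF mult_nonneg_nonneg[OF that(1) step.hyps(1)] step.IH])
  qed (auto intro: ext_cone.zero)
  have times: "s * u \<in> ?S" if "s \<in> ?S" "u \<in> ?S" for s u
    using that(1)
  proof induction
    case (step t s h)
    show ?case
      unfolding distrib_right by (rule plus[OF weighted[OF step.hyps(1) that(2)] step.IH])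
  qed (auto intro: ext_cone.zero)
  have ev: "\<exists>h. s = ?ev h" if "s \<in> ?S" for s
    using that
  proof induction
    case zero
    show ?case by (rule exI[of _ 0]) simp
  next
    case (step t s h)
    then obtain k where "s = ?ev k" by blast
    then show ?case
      by (intro exI[of _ "smult t (h * h) + k"]) (simp add: power2_eq_square)
  qed
  have "precone ?S"
    unfolding precone_def
  proof (intro conjI ballI plus times)
    show "1 \<in> ?S" using square[of 1] by simp
    show "- 1 \<notin> ?S" by fact
    fix s u assume "s \<in> ?S" "u \<in> ?S"
    then obtain h k where "s = ?ev h" "u = ?ev k" using ev by meson
    moreover have "?ev h - ?ev k = ?ev (h - k)"
      using residue_closure.ev_add[of \<alpha> "h - k" k] by simp
    ultimately show "(s - u)\<^sup>2 \<in> ?S" using square by simp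
  qed
  moreover have "T0 \<subseteq> ?S"
  proof
    fix x assume x: "x \<in> T0"
    then have "x \<in> range Rep_residue_closure" unfolding range_Rep by (rule T0.T_differences)
    then obtain t where t: "x = Rep_residue_closure t" by blast
    have "0 \<le> t" using x unfolding t by transfer simp
    from ext_cone.step[OF this ext_cone.zero, of Rep_residue_closure \<alpha> 1] show "x \<in> ?S"
      using t by simp
  qed
  ultimately have S: "?S = T0" by (rule T0.maximal)
  define c where "c = Rep_residue_closure (1 / 2)"
  have c: "c + c = 1"
    unfolding c_def residue_closure.add[symmetric] by (simp add: residue_closure.one)
  have "(c + \<alpha> * c)\<^sup>2 - (- c + \<alpha> * c)\<^sup>2 = (c + c) * (c + c) * \<alpha>"
    by (simp add: power2_eq_square algebra_simps)
  then have "\<alpha> = (?ev [:1 / 2, 1 / 2:])\<^sup>2 - (?ev [:- (1 / 2), 1 / 2:])\<^sup>2"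
    unfolding c by (simp add: c_def residue_closure.minus)
  moreover have "(?ev [:1 / 2, 1 / 2:])\<^sup>2 \<in> T0" "(?ev [:- (1 / 2), 1 / 2:])\<^sup>2 \<in> T0"
    using square unfolding S by this+
  ultimately show ?thesis
    unfolding range_Rep differences_def by blast
qed

instance residue_closure :: rcf
proof
  fix a b :: residue_closure and n f
  assume *: "a < b" "(\<Sum>k\<le>n. f k * a ^ k) < 0" "0 < (\<Sum>k\<le>n. f k * b ^ k)"
  define p where "p = (\<Sum>k\<le>n. Polynomial.monom (f k) k)"
  have p: "poly p x = (\<Sum>k\<le>n. f k * x ^ k)" for x
    by (simp add: p_def poly_sum poly_monom)
  have "\<exists>c. a < c \<and> c < b \<and> poly p c = 0"
    by (rule IVT_if_no_ordered_extension[OF residue_closure.field_embedding_axioms])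
      (use * p residue_closure_maximal alg_closed_imp_poly_has_root in \<open>auto simp: mult_less_0_iff\<close>)
  then show "\<exists>x. a < x \<and> x < b \<and> (\<Sum>k\<le>n. f k * x ^ k) = 0" by (simp add: p)
qed

section \<open>Transfer from the residue closure to real points\<close>

definition to_residue_closure :: "((nat \<Rightarrow> real) \<Rightarrow> real) \<Rightarrow> residue_closure" where
  "to_residue_closure f = Abs_residue_closure (to_ac (Fract (residue f) 1))"

lemma Rep_to_residue_closure: "Rep_residue_closure (to_residue_closure f) = to_ac (Fract (residue f) 1)"
  unfolding to_residue_closure_def using T0(2) by (intro Abs_residue_closure_inverse) auto

lemma to_residue_closure_simps:
  "to_residue_closure (\<lambda>_. 0) = 0"
  "f \<in> polyfuns \<Longrightarrow> g \<in> polyfuns \<Longrightarrow> to_residue_closure (\<lambda>a. f a + g a) = to_residue_closure f + to_residue_closure g"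
  "f \<in> polyfuns \<Longrightarrow> g \<in> polyfuns \<Longrightarrow> to_residue_closure (\<lambda>a. f a * g a) = to_residue_closure f * to_residue_closure g"
  unfolding Rep_residue_closure_inject[symmetric] zero_residue_closure.rep_eq plus_residue_closure.rep_eq
    times_residue_closure.rep_eq Rep_to_residue_closure
  by (simp_all add: residue_simps flip: Zero_fract_def to_ac_add to_ac_mult)

lemma to_residue_closure_eq_0_iff: "f \<in> polyfuns \<Longrightarrow> to_residue_closure f = 0 \<longleftrightarrow> f \<in> P0"
  unfolding Rep_residue_closure_inject[symmetric] zero_residue_closure.rep_eq Rep_to_residue_closure
  by (simp add: Zero_fract_def eq_fract residue_eq_0_iff)

text \<open>A positive constant is invertible, hence not in \<open>P0\<close>, and it is the square
  of the constant \<open>sqrt c\<close>; so its image is positive.\<close>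

lemma to_residue_closure_const: "sg (to_residue_closure (\<lambda>_. c)) = sg c"
proof -
  have pos: "0 < to_residue_closure (\<lambda>_. c)" if "0 < c" for c
  proof -
    have "(\<lambda>_. c) \<notin> P0"
      using P0.mult[OF polyfuns_closed(1)[of "1 / c"], of "\<lambda>_. c"] P0.one that by auto
    then have "to_residue_closure (\<lambda>_. c) \<noteq> 0"
      by (simp add: to_residue_closure_eq_0_iff polyfuns_closed)
    moreover have "to_residue_closure (\<lambda>_. c) = to_residue_closure (\<lambda>_. sqrt c) * to_residue_closure (\<lambda>_. sqrt c)"
      using to_residue_closure_simps(3)[OF polyfuns_closed(1) polyfuns_closed(1), of "sqrt c" "sqrt c"] that by simp
    ultimately show ?thesis by (metis mult_eq_0_iff zero_less_mult_iff linorder_neqE_linordered_idom)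
  qed
  consider "c = 0" | "0 < c" | "c < 0" by linarith
  then show ?thesis
  proof cases
    case 3
    have "to_residue_closure (\<lambda>_. c) + to_residue_closure (\<lambda>_. - c) = 0"
      using to_residue_closure_simps(2)[OF polyfuns_closed(1) polyfuns_closed(1), of c "- c"]
      by (simp add: to_residue_closure_simps)
    then have "to_residue_closure (\<lambda>_. c) < 0" using pos[of "- c"] 3 by (simp add: eq_neg_iff_add_eq_0[symmetric])
    then show ?thesis using 3 by (simp add: sg_def)
  qed (use pos in \<open>auto simp: to_residue_closure_simps sg_def\<close>)
qed

text \<open>The classes of the coordinate functions form a point over the residue closure at which
  \<open>A\<close> vanishes and \<open>g\<close> does not. Finitely many functions involve finitely
  many variables, so sign transfer produces a real point with the same property.\<close>

lemma P0_not_counterexample: "\<not> counterexample P0"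
proof
  assume "counterexample P0"
  then obtain A g where A: "finite A" "A \<subseteq> P0" "g \<in> polyfuns" "g \<notin> P0"
    and none: "\<forall>a. (\<forall>f\<in>A. f a = 0) \<longrightarrow> g a = 0"
    unfolding counterexample_def by (elim conjE exE)
  have PF: "insert g A \<subseteq> polyfuns" using A(2,3) P0.subset by blast
  have "\<exists>N. B \<subseteq> polyfun N" if "finite B" "B \<subseteq> polyfuns" for B
    using that
  proof induction
    case (insert f B)
    then obtain n N where "f \<in> polyfun n" "B \<subseteq> polyfun N" by (auto simp: polyfuns_def)
    then show ?case
      using polyfun_mono[of n "max n N"] polyfun_mono[of N "max n N"] by (intro exI[of _ "max n N"]) auto
  qed auto
  from this[of "insert g A"] obtain N where N: "insert g A \<subseteq> polyfun N" using A(1) PF by auto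
  have sub: "f \<in> polyfuns" if "f \<in> polyfun N" for f using that by (auto simp: polyfuns_def)
  have "\<exists>a. \<forall>f\<in>insert g A. sg (f a) = sg (to_residue_closure f)"
    by (rule polyfun_sign_transfer[where N = N])
      (use A(1) N in \<open>auto simp: to_residue_closure_const to_residue_closure_simps sub\<close>)
  then obtain a where a: "\<And>f. f \<in> insert g A \<Longrightarrow> sg (f a) = sg (to_residue_closure f)" by blast
  have "f a = 0" if "f \<in> A" for f
  proof -
    have "f \<in> polyfuns" "f \<in> P0" using that A(2) PF by auto
    then show ?thesis using a[of f] that by (simp add: to_residue_closure_eq_0_iff[THEN iffD2])
  qed
  then have "g a = 0" using none by simp
  then show False using a[of g] A(3,4) to_residue_closure_eq_0_iff[of g] by simp
qed

theorem real_nullstellensatz_prime: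
  assumes "real_prime_ideal polyfuns P" "finite A" "A \<subseteq> P" "g \<in> polyfuns" "g \<notin> P"
  shows "\<exists>a. (\<forall>f\<in>A. f a = 0) \<and> g a \<noteq> 0"
proof (rule ccontr)
  assume "\<not> ?thesis"
  then have "counterexample P"
    using assms unfolding counterexample_def by blast
  then have "counterexample P0"
    unfolding P0_def using someI_ex[of counterexample] by auto
  then show False using P0_not_counterexample by blast
qed

section \<open>Minimal primes over a real ideal\<close>

text \<open>\<open>P\<close> is the complement of a maximal multiplicative set disjoint from
  \<open>I\<close>. The multipliers in the last conjunct express that \<open>I\<close> and
  \<open>P\<close> become equal after localisation at \<open>P\<close>; through them, closure under
  addition and realness pass from \<open>I\<close> to \<open>P\<close>.\<close>

lemma ex_minimal_real_prime_ideal: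
  fixes R I :: "('e \<Rightarrow> real) set"
  assumes R1: "(\<lambda>_. 1) \<in> R"
    and Radd: "\<And>f g. f \<in> R \<Longrightarrow> g \<in> R \<Longrightarrow> (\<lambda>a. f a + g a) \<in> R"
    and Rmult: "\<And>f g. f \<in> R \<Longrightarrow> g \<in> R \<Longrightarrow> (\<lambda>a. f a * g a) \<in> R"
    and IR: "I \<subseteq> R" and I0: "(\<lambda>_. 0) \<in> I" and I1: "(\<lambda>_. 1) \<notin> I"
    and Iadd: "\<And>f g. f \<in> I \<Longrightarrow> g \<in> I \<Longrightarrow> (\<lambda>a. f a + g a) \<in> I"
    and Imult: "\<And>f g. f \<in> R \<Longrightarrow> g \<in> I \<Longrightarrow> (\<lambda>a. f a * g a) \<in> I"
    and Ireal: "\<And>fs. set fs \<subseteq> R \<Longrightarrow> (\<lambda>a. \<Sum>f\<leftarrow>fs. (f a)\<^sup>2) \<in> I \<Longrightarrow> set fs \<subseteq> I"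
  shows "\<exists>P. real_prime_ideal R P \<and> I \<subseteq> P \<and> (\<forall>f\<in>P. \<exists>t\<in>R - P. (\<lambda>a. t a * f a) \<in> I)"
proof -
  have Rpow: "(\<lambda>a. f a ^ k) \<in> R" if "f \<in> R" for f k
    by (induction k) (auto intro: R1 Rmult that)
  \<comment> \<open>With \<open>l\<close> half of \<open>k\<close>, rounded up, the square of
    \<open>f ^ l\<close> is a multiple of \<open>f ^ k\<close>, and realness yields
    \<open>f ^ l\<close>. This lowers every exponent above 1, while exponent 0 is excluded by
    \<open>I1\<close>.\<close>
  have radical: "f \<in> I" if "f \<in> R" "(\<lambda>a. f a ^ k) \<in> I" for f k
    using that(2)
  proof (induction k rule: less_induct)
    case (less k)
    consider "k = 0" | "k = 1" | l where "k \<le> 2 * l" "l < k"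
    proof -
      assume *: "k = 0 \<Longrightarrow> thesis" "k = 1 \<Longrightarrow> thesis" "\<And>l. k \<le> 2 * l \<Longrightarrow> l < k \<Longrightarrow> thesis"
      show thesis
      proof (cases "k \<le> 1")
        case False
        then show ?thesis by (intro *(3)[of "(k + 1) div 2"]) linarith+
      qed (use *(1,2) in linarith)
    qed
    then show ?case
    proof cases
      case 3
      have "(\<lambda>a. f a ^ (2 * l - k) * f a ^ k) \<in> I"
        by (intro Imult Rpow that less.prems)
      also have "(\<lambda>a. f a ^ (2 * l - k) * f a ^ k) = (\<lambda>a. \<Sum>f\<leftarrow>[\<lambda>a. f a ^ l]. (f a)\<^sup>2)"
        using 3 by (simp add: power_add[symmetric] power_mult[symmetric] mult.commute)
      finally have "(\<lambda>a. f a ^ l) \<in> I"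
        using Ireal[of "[\<lambda>a. f a ^ l]"] Rpow[OF that(1)] by simp
      then show ?thesis using less.IH 3(2) by blast
    qed (use less.prems I1 in auto)
  qed
  define A where "A = {M. M \<subseteq> R \<and> (\<lambda>_. 1) \<in> M \<and> (\<forall>f\<in>M. \<forall>g\<in>M. (\<lambda>a. f a * g a) \<in> M) \<and> M \<inter> I = {}}"
  have A1: "{\<lambda>_. 1} \<in> A" using R1 I1 by (auto simp: A_def)
  have "\<forall>C\<in>chains A. \<exists>U\<in>A. \<forall>S\<in>C. S \<subseteq> U"
  proof
    fix C assume C: "C \<in> chains A"
    show "\<exists>U\<in>A. \<forall>S\<in>C. S \<subseteq> U"
    proof (cases "C = {}")
      case False
      have CA: "S \<subseteq> R" "(\<lambda>_. 1) \<in> S" "S \<inter> I = {}"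
        "\<And>f g. f \<in> S \<Longrightarrow> g \<in> S \<Longrightarrow> (\<lambda>a. f a * g a) \<in> S" if "S \<in> C" for S
        using chainsD2[OF C] that by (auto simp: A_def)
      have "(\<lambda>a. f a * g a) \<in> \<Union>C" if fg: "f \<in> \<Union>C" "g \<in> \<Union>C" for f g
      proof -
        obtain S T where ST: "S \<in> C" "T \<in> C" "f \<in> S" "g \<in> T" using fg by blast
        then obtain T where "T \<in> C" "f \<in> T" "g \<in> T" using chainsD[OF C ST(1,2)] by blast
        then show ?thesis using CA(4) by blast
      qed
      moreover have "(\<lambda>_. 1) \<in> \<Union>C" using False CA(2) by blast
      moreover have "\<Union>C \<subseteq> R" "\<Union>C \<inter> I = {}" using CA(1,3) by blast+
      ultimately have "\<Union>C \<in> A" unfolding A_def by blast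
      then show ?thesis by blast
    qed (use A1 in blast)
  qed
  from Zorn_Lemma2[OF this] obtain M where M: "M \<in> A" "\<And>S. S \<in> A \<Longrightarrow> M \<subseteq> S \<Longrightarrow> S = M" by blast
  have M': "M \<subseteq> R" "(\<lambda>_. 1) \<in> M" "\<And>f g. f \<in> M \<Longrightarrow> g \<in> M \<Longrightarrow> (\<lambda>a. f a * g a) \<in> M" "M \<inter> I = {}"
    using M(1) by (auto simp: A_def)
  define P where "P = R - M"
  have min: "\<exists>t\<in>M. (\<lambda>a. t a * f a) \<in> I" if f: "f \<in> P" for f
  proof -
    \<comment> \<open>The multiplicative set generated by \<open>M\<close> and \<open>f\<close>. It
      is larger than \<open>M\<close> and so must meet \<open>I\<close>.\<close>
    define S where "S = {\<lambda>a. t a * f a ^ k |t k. t \<in> M}"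
    have fR: "f \<in> R" "f \<notin> M" using f by (auto simp: P_def)
    have SI: "(\<lambda>a. t a * f a ^ k) \<in> S" if "t \<in> M" for t k
      unfolding S_def using that by blast
    have fS: "f \<in> S" using SI[OF M'(2), of 1] by simp
    have MS: "t \<in> S" if "t \<in> M" for t using SI[OF that, of 0] by simp
    have mult: "(\<lambda>a. g a * h a) \<in> S" if gh: "g \<in> S" "h \<in> S" for g h
    proof -
      obtain t k u l where *: "g = (\<lambda>a. t a * f a ^ k)" "h = (\<lambda>a. u a * f a ^ l)" "t \<in> M" "u \<in> M"
        using gh unfolding S_def by blast
      have "(\<lambda>a. g a * h a) = (\<lambda>a. (t a * u a) * f a ^ (k + l))"
        unfolding * by (simp add: power_add algebra_simps)
      then show ?thesis using SI[OF M'(3)[OF *(3,4)]] by simp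
    qed
    have SR: "g \<in> R" if g: "g \<in> S" for g
    proof -
      obtain t k where *: "g = (\<lambda>a. t a * f a ^ k)" "t \<in> M" using g unfolding S_def by blast
      have "t \<in> R" using *(2) M'(1) by blast
      from Rmult[OF this Rpow[OF fR(1)]] show ?thesis unfolding * .
    qed
    have "S \<inter> I \<noteq> {}"
    proof
      assume "S \<inter> I = {}"
      then have "S \<in> A" unfolding A_def using SR mult MS[OF M'(2)] by blast
      then have "S = M" using M(2) MS by blast
      then show False using fS fR(2) by simp
    qed
    then obtain t k where t: "t \<in> M" "(\<lambda>a. t a * f a ^ k) \<in> I" unfolding S_def by blast
    have tR: "t \<in> R" using t(1) M'(1) by blast
    \<comment> \<open>The additional factors \<open>t ^ k\<close> and \<open>f\<close> complete the
      product to a power of \<open>t * f\<close>, from which \<open>radical\<close> removes the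
      exponent.\<close>
    have "(\<lambda>a. t a ^ k * (t a * f a ^ k)) \<in> I" by (intro Imult Rpow tR t(2))
    then have "(\<lambda>a. f a * (t a ^ k * (t a * f a ^ k))) \<in> I" by (rule Imult[OF fR(1)])
    also have "(\<lambda>a. f a * (t a ^ k * (t a * f a ^ k))) = (\<lambda>a. (t a * f a) ^ Suc k)"
      by (simp add: power_mult_distrib algebra_simps)
    finally have "(\<lambda>a. t a * f a) \<in> I" by (rule radical[OF Rmult[OF tR fR(1)]])
    then show ?thesis using t(1) by blast
  qed
  have PI: "f \<in> P" if "f \<in> R" "t \<in> M" "(\<lambda>a. t a * f a) \<in> I" for f t
    using that M'(3)[of t f] M'(4) unfolding P_def by blast
  have "real_prime_ideal R P"
  proof
    show "P \<subseteq> R" "(\<lambda>_. 1) \<notin> P" using M'(2) by (auto simp: P_def)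
    show "(\<lambda>_. 0) \<in> P" using I0 M'(4) IR unfolding P_def by blast
    show "(\<lambda>a. f a + g a) \<in> P" if fg: "f \<in> P" "g \<in> P" for f g
    proof -
      obtain t u where tu: "t \<in> M" "u \<in> M" "(\<lambda>a. t a * f a) \<in> I" "(\<lambda>a. u a * g a) \<in> I"
        using min[OF fg(1)] min[OF fg(2)] by blast
      have R: "t \<in> R" "u \<in> R" "f \<in> R" "g \<in> R" using tu(1,2) M'(1) fg by (auto simp: P_def)
      have "(\<lambda>a. u a * (t a * f a) + t a * (u a * g a)) \<in> I"
        by (intro Iadd Imult tu R)
      also have "(\<lambda>a. u a * (t a * f a) + t a * (u a * g a)) = (\<lambda>a. (t a * u a) * (f a + g a))"
        by (simp add: algebra_simps)
      finally show ?thesis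
        by (rule PI[OF Radd[OF R(3,4)] M'(3)[OF tu(1,2)]])
    qed
    show "(\<lambda>a. f a * g a) \<in> P" if fg: "f \<in> R" "g \<in> P" for f g
    proof -
      obtain t where t: "t \<in> M" "(\<lambda>a. t a * g a) \<in> I" using min[OF fg(2)] by blast
      have "(\<lambda>a. f a * (t a * g a)) \<in> I" by (intro Imult fg t)
      also have "(\<lambda>a. f a * (t a * g a)) = (\<lambda>a. t a * (f a * g a))" by (simp add: algebra_simps)
      finally show ?thesis
        using fg by (intro PI[OF Rmult t(1)]) (auto simp: P_def)
    qed
    show "f \<in> P \<or> g \<in> P" if "f \<in> R" "g \<in> R" "(\<lambda>a. f a * g a) \<in> P" for f g
      using that M'(3)[of f g] unfolding P_def by blast
    show "set fs \<subseteq> P" if fs: "set fs \<subseteq> R" "(\<lambda>a. \<Sum>f\<leftarrow>fs. (f a)\<^sup>2) \<in> P" for fs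
    proof
      fix f assume f: "f \<in> set fs"
      obtain t where t: "t \<in> M" "(\<lambda>a. t a * (\<Sum>f\<leftarrow>fs. (f a)\<^sup>2)) \<in> I" using min[OF fs(2)] by blast
      have tR: "t \<in> R" using t(1) M'(1) by blast
      \<comment> \<open>A second factor \<open>t\<close> turns the multiple of the sum of squares
        into the sum of the squares of \<open>t * f\<close>.\<close>
      have "(\<lambda>a. t a * (t a * (\<Sum>f\<leftarrow>fs. (f a)\<^sup>2))) \<in> I" by (intro Imult tR t)
      also have "(\<lambda>a. t a * (t a * (\<Sum>f\<leftarrow>fs. (f a)\<^sup>2))) = (\<lambda>a. \<Sum>f\<leftarrow>map (\<lambda>f a. t a * f a) fs. (f a)\<^sup>2)"
        by (simp add: o_def power_mult_distrib power2_eq_square[of "t _"] mult.assoc sum_list_const_mult)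
      finally have "set (map (\<lambda>f a. t a * f a) fs) \<subseteq> I"
        by (rule Ireal[rotated]) (use fs(1) tR Rmult in auto)
      then have "(\<lambda>a. t a * f a) \<in> I" using f by auto
      moreover have "f \<in> R" using fs(1) f by blast
      ultimately show "f \<in> P" by (intro PI[OF _ t(1)])
    qed
  qed
  moreover have "I \<subseteq> P" using IR M'(4) by (auto simp: P_def)
  moreover have "\<forall>f\<in>P. \<exists>t\<in>R - P. (\<lambda>a. t a * f a) \<in> I"
    using min M'(1) by (auto simp: P_def)
  ultimately show ?thesis by blast
qed

section \<open>Quaternionic polynomial functions\<close>

definition quat_parts :: "(quat \<Rightarrow> real) set" where
  "quat_parts = {qre, qi, qj, qk}"

definition of_re :: "real \<Rightarrow> quat" where
  "of_re a = Quat a 0 0 0"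

lemma of_re_simps: "of_re 0 = 0" "of_re 1 = 1" "of_re (a + b) = of_re a + of_re b"
  "of_re (a * b) = of_re a * of_re b" "of_re (- a) = - of_re a" "q * of_re a = of_re a * q" "qcnj (of_re a) = of_re a"
  by (simp_all add: of_re_def quat_defs qcnj_def)

lemma parts_of_re_mult: "c \<in> quat_parts \<Longrightarrow> c (of_re a * q) = a * c q"
  and parts_add: "c \<in> quat_parts \<Longrightarrow> c (q + r) = c q + c r"
  by (auto simp: quat_parts_def of_re_def quat_defs)

lemma quat_eq_0_iff: "q = 0 \<longleftrightarrow> (\<forall>c\<in>quat_parts. c q = 0)"
  by (auto simp: quat_parts_def quat_eq_iff zero_quat_def)

definition real_polyfun :: "(quat ^ 'd \<Rightarrow> real) set" where
  "real_polyfun = {s. (\<lambda>x. of_re (s x)) \<in> quat_polyfun}"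

lemma quat_polyfun_closed:
  shows "f \<in> quat_polyfun \<Longrightarrow> g \<in> quat_polyfun \<Longrightarrow> (\<lambda>x. f x + g x) \<in> quat_polyfun"
    and "f \<in> quat_polyfun \<Longrightarrow> g \<in> quat_polyfun \<Longrightarrow> (\<lambda>x. f x * g x) \<in> quat_polyfun"
    and "f \<in> quat_polyfun \<Longrightarrow> (\<lambda>x. - f x) \<in> quat_polyfun"
    and "f \<in> quat_polyfun \<Longrightarrow> (\<lambda>x. qcnj (f x)) \<in> quat_polyfun"
    and "f \<in> quat_polyfun \<Longrightarrow> g \<in> quat_polyfun \<Longrightarrow> (\<lambda>x. f x - g x) \<in> quat_polyfun"
proof -
  assume f: "f \<in> quat_polyfun"
  show "(\<lambda>x. - f x) \<in> quat_polyfun" using quat_polyfun.uminus[OF f] unfolding fun_Compl_def .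
  show "(\<lambda>x. qcnj (f x)) \<in> quat_polyfun" using quat_polyfun_cnj[OF f] unfolding fun_cnj_def .
  assume g: "g \<in> quat_polyfun"
  show "(\<lambda>x. f x + g x) \<in> quat_polyfun" using quat_polyfun.add[OF f g] unfolding plus_fun_def .
  show "(\<lambda>x. f x * g x) \<in> quat_polyfun" using quat_polyfun.mult[OF f g] unfolding times_fun_def .
  have "(\<lambda>x. f x + - g x) \<in> quat_polyfun"
    using quat_polyfun.add[OF f quat_polyfun.uminus[OF g]] unfolding plus_fun_def fun_Compl_def .
  then show "(\<lambda>x. f x - g x) \<in> quat_polyfun" by simp
qed

lemma quat_polyfun_sum':
  assumes "\<And>i. i \<in> A \<Longrightarrow> f i \<in> quat_polyfun"
  shows "(\<lambda>x. \<Sum>i\<in>A. f i x) \<in> quat_polyfun"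
  using assms
proof (induction A rule: infinite_finite_induct)
  case (insert i A)
  then have "(\<lambda>x. f i x + (\<Sum>i\<in>A. f i x)) \<in> quat_polyfun" by (intro quat_polyfun_closed(1)) auto
  then show ?case using insert.hyps by simp
qed (simp_all add: quat_polyfun.const)

lemma real_polyfun_closed:
  shows "(\<lambda>_. c) \<in> real_polyfun"
    and "f \<in> real_polyfun \<Longrightarrow> g \<in> real_polyfun \<Longrightarrow> (\<lambda>x. f x + g x) \<in> real_polyfun"
    and "f \<in> real_polyfun \<Longrightarrow> g \<in> real_polyfun \<Longrightarrow> (\<lambda>x. f x * g x) \<in> real_polyfun"
    and "f \<in> real_polyfun \<Longrightarrow> (\<lambda>x. of_re (f x)) \<in> quat_polyfun"
proof -
  show "(\<lambda>_. c) \<in> real_polyfun" unfolding real_polyfun_def mem_Collect_eq by (rule quat_polyfun.const)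
  assume "f \<in> real_polyfun"
  then show f: "(\<lambda>x. of_re (f x)) \<in> quat_polyfun" by (simp only: real_polyfun_def mem_Collect_eq)
  assume "g \<in> real_polyfun"
  then have g: "(\<lambda>x. of_re (g x)) \<in> quat_polyfun" by (simp only: real_polyfun_def mem_Collect_eq)
  show "(\<lambda>x. f x + g x) \<in> real_polyfun" "(\<lambda>x. f x * g x) \<in> real_polyfun"
    unfolding real_polyfun_def mem_Collect_eq of_re_simps(3,4) by (rule quat_polyfun_closed(1,2)[OF f g])+
qed

lemma real_polyfun_sum:
  assumes "\<And>i. i \<in> A \<Longrightarrow> f i \<in> real_polyfun"
  shows "(\<lambda>x. \<Sum>i\<in>A. f i x) \<in> real_polyfun"
  using assms
proof (induction A rule: infinite_finite_induct)
  case (insert i A)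
  then have "(\<lambda>x. f i x + (\<Sum>i\<in>A. f i x)) \<in> real_polyfun" by (intro real_polyfun_closed(2)) auto
  then show ?case using insert.hyps by simp
qed (simp_all add: real_polyfun_closed(1))

text \<open>The real part is half the sum of the value and its conjugate, and conjugation preserves
  polynomial functions.\<close>

lemma real_polyfun_qre:
  assumes "f \<in> quat_polyfun"
  shows "(\<lambda>x. qre (f x)) \<in> real_polyfun"
proof -
  have "of_re (1 / 2) * (q + qcnj q) = of_re (qre q)" for q
    by (simp add: of_re_def quat_defs qcnj_def)
  then show ?thesis
    using quat_polyfun_closed(2)[OF quat_polyfun.const[of "of_re (1 / 2)"]
      quat_polyfun_closed(1)[OF assms quat_polyfun_closed(4)[OF assms]]]
    by (simp add: real_polyfun_def)
qed

lemma real_polyfun_parts: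
  assumes f: "f \<in> quat_polyfun" and c: "c \<in> quat_parts"
  shows "(\<lambda>x. c (f x)) \<in> real_polyfun"
proof -
  have "qi q = qre (Quat 0 (- 1) 0 0 * q)" "qj q = qre (Quat 0 0 (- 1) 0 * q)"
    "qk q = qre (Quat 0 0 0 (- 1) * q)" for q
    by (simp_all add: times_quat_def)
  then have "\<exists>e. c = (\<lambda>q. qre (e * q))"
    using c unfolding quat_parts_def by (auto simp: fun_eq_iff intro: exI[of _ 1])
  then obtain e where "c = (\<lambda>q. qre (e * q))" by blast
  then show ?thesis
    using real_polyfun_qre[OF quat_polyfun_closed(2)[OF quat_polyfun.const[of e] f]] by simp
qed

text \<open>The value at \<open>k\<close> is junk if \<open>k div 4\<close> is not in the range of \<open>to_nat\<close>; only
  \<open>of_real_coords (real_coords x) = x\<close> matters.\<close>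

definition real_coords :: "quat ^ 'd \<Rightarrow> nat \<Rightarrow> real" where
  "real_coords x k = ([qre, qi, qj, qk] ! (k mod 4)) (x $ from_nat (k div 4))"

definition of_real_coords :: "(nat \<Rightarrow> real) \<Rightarrow> quat ^ 'd" where
  "of_real_coords a = (\<chi> j. Quat (a (4 * to_nat j)) (a (4 * to_nat j + 1)) (a (4 * to_nat j + 2)) (a (4 * to_nat j + 3)))"

lemma of_real_coords_real_coords: "of_real_coords (real_coords x) = x"
proof -
  have m: "(4 * n + 1) mod 4 = 1" "(4 * n + 2) mod 4 = 2" "(4 * n + 3) mod 4 = 3"
    and d: "(4 * n + 1) div 4 = n" "(4 * n + 2) div 4 = n" "(4 * n + 3) div 4 = n" for n :: nat
    by presburger+
  have "real_coords x (4 * to_nat j) = qre (x $ j)" "real_coords x (4 * to_nat j + 1) = qi (x $ j)"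
    "real_coords x (4 * to_nat j + 2) = qj (x $ j)" "real_coords x (4 * to_nat j + 3) = qk (x $ j)" for j
    unfolding real_coords_def m d by simp_all
  then show ?thesis
    by (simp add: of_real_coords_def vec_eq_iff)
qed

lemma polyfuns_of_real_coords:
  assumes "f \<in> quat_polyfun" "c \<in> quat_parts"
  shows "(\<lambda>a. c (f (of_real_coords a))) \<in> polyfuns"
  using assms
proof (induction arbitrary: c)
  case (const q)
  show ?case by (rule polyfuns_closed)
next
  case (coord i)
  then show ?case by (auto simp: quat_parts_def of_real_coords_def intro: polyfuns_closed)
next
  case (uminus f)
  from polyfuns_closed(3)[OF uminus.IH[OF uminus.prems]] uminus.prems
  show ?case by (auto simp: quat_parts_def quat_defs)
next
  case (add f g)
  from polyfuns_closed(4)[OF add.IH[OF add.prems]] add.prems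
  show ?case by (auto simp: parts_add)
next
  case (mult f g)
  have f: "\<And>c. c \<in> quat_parts \<Longrightarrow> (\<lambda>a. c (f (of_real_coords a))) \<in> polyfuns"
    and g: "\<And>c. c \<in> quat_parts \<Longrightarrow> (\<lambda>a. c (g (of_real_coords a))) \<in> polyfuns"
    using mult.IH by blast+
  have fg: "(\<lambda>a. b (f (of_real_coords a)) * c (g (of_real_coords a))) \<in> polyfuns"
    if "b \<in> quat_parts" "c \<in> quat_parts" for b c
    using polyfuns_closed(5)[OF f[OF that(1)] g[OF that(2)]] .
  consider "c = qre" | "c = qi" | "c = qj" | "c = qk"
    using mult.prems by (auto simp: quat_parts_def)
  then show ?case
    by cases (simp_all add: times_quat_def fg polyfuns_closed(4) polyfuns_diff quat_parts_def)
qed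

lemma real_polyfun_real_coords:
  assumes "h \<in> polyfuns"
  shows "(\<lambda>x :: quat ^ 'd. h (real_coords x)) \<in> real_polyfun"
proof -
  obtain n where "h \<in> polyfun n" using assms by (auto simp: polyfuns_def)
  then show ?thesis
  proof induction
    case (var i)
    have "[qre, qi, qj, qk] ! (i mod 4) \<in> set [qre, qi, qj, qk]" by (rule nth_mem) simp
    then have "[qre, qi, qj, qk] ! (i mod 4) \<in> quat_parts" by (simp add: quat_parts_def)
    from real_polyfun_parts[OF quat_polyfun.coord[of "from_nat (i div 4)"] this] show ?case
      by (simp add: real_coords_def)
  qed (auto intro: real_polyfun_closed)
qed

text \<open>\<open>P\<close> is pulled back along \<open>real_coords\<close> to an ideal
  \<open>P'\<close> of functions on sequences, and the point found there is mapped by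
  \<open>of_real_coords\<close>. Since the composite on quaternionic points is the identity,
  membership in \<open>P\<close> can be tested in \<open>P'\<close>.\<close>

theorem real_nullstellensatz_quat:
  fixes P :: "(quat ^ 'd \<Rightarrow> real) set"
  assumes "real_prime_ideal real_polyfun P" "finite A" "A \<subseteq> P" "g \<in> real_polyfun" "g \<notin> P"
  shows "\<exists>x. (\<forall>f\<in>A. f x = 0) \<and> g x \<noteq> 0"
proof -
  interpret real_prime_ideal real_polyfun P by fact
  define P' where "P' = {h \<in> polyfuns. (\<lambda>x. h (real_coords x)) \<in> P}"
  have "real_prime_ideal polyfuns P'"
  proof
    note coords = real_polyfun_real_coords
    show "P' \<subseteq> polyfuns" unfolding P'_def by blast
    show "(\<lambda>_. 0) \<in> P'" unfolding P'_def using zero polyfuns_closed(1)[of 0] by blast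
    show "(\<lambda>_. 1) \<notin> P'" unfolding P'_def using one by blast
    show "(\<lambda>a. f a + g a) \<in> P'" if "f \<in> P'" "g \<in> P'" for f g
    proof -
      have "f \<in> polyfuns" "g \<in> polyfuns" "(\<lambda>x. f (real_coords x)) \<in> P" "(\<lambda>x. g (real_coords x)) \<in> P"
        using that unfolding P'_def by blast+
      from polyfuns_closed(4)[OF this(1,2)] add[OF this(3,4)] show ?thesis unfolding P'_def by blast
    qed
    show "(\<lambda>a. f a * g a) \<in> P'" if "f \<in> polyfuns" "g \<in> P'" for f g
    proof -
      have "g \<in> polyfuns" "(\<lambda>x. g (real_coords x)) \<in> P"
        using that unfolding P'_def by blast+
      from polyfuns_closed(5)[OF that(1) this(1)] mult[OF coords[OF that(1)] this(2)]
      show ?thesis unfolding P'_def by blast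
    qed
    show "f \<in> P' \<or> g \<in> P'" if "f \<in> polyfuns" "g \<in> polyfuns" "(\<lambda>a. f a * g a) \<in> P'" for f g
    proof -
      have "(\<lambda>x. f (real_coords x) * g (real_coords x)) \<in> P" using that(3) unfolding P'_def by blast
      from prime[OF coords[OF that(1)] coords[OF that(2)] this] that(1,2) show ?thesis
        unfolding P'_def by blast
    qed
    show "set fs \<subseteq> P'" if fs: "set fs \<subseteq> polyfuns" "(\<lambda>a. \<Sum>f\<leftarrow>fs. (f a)\<^sup>2) \<in> P'" for fs
    proof -
      have "set (map (\<lambda>h x. h (real_coords x)) fs) \<subseteq> real_polyfun"
        using fs(1) coords by auto
      moreover have "(\<lambda>x. \<Sum>f\<leftarrow>map (\<lambda>h x. h (real_coords x)) fs. (f x)\<^sup>2) \<in> P"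
        using fs(2) by (simp add: P'_def o_def)
      ultimately have "set (map (\<lambda>h x. h (real_coords x)) fs) \<subseteq> P" by (rule real)
      then show ?thesis using fs(1) by (auto simp: P'_def)
    qed
  qed
  moreover have pull: "(\<lambda>a. f (of_real_coords a)) \<in> polyfuns" if "f \<in> real_polyfun" for f :: "quat ^ 'd \<Rightarrow> real"
    using polyfuns_of_real_coords[of "\<lambda>x. of_re (f x)" qre] that
    by (simp add: real_polyfun_def quat_parts_def of_re_def)
  have "(\<lambda>a. f (of_real_coords a)) \<in> P' \<longleftrightarrow> f \<in> P" if "f \<in> real_polyfun" for f
    using pull[OF that] by (simp add: P'_def of_real_coords_real_coords)
  then have "(\<lambda>f a. f (of_real_coords a)) ` A \<subseteq> P'" "(\<lambda>a. g (of_real_coords a)) \<notin> P'"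
    using assms(3-5) subset by auto
  ultimately have "\<exists>a. (\<forall>f\<in>(\<lambda>f a. f (of_real_coords a)) ` A. f a = 0) \<and> g (of_real_coords a) \<noteq> 0"
    using assms(2) pull[OF assms(4)] by (intro real_nullstellensatz_prime[of P']) simp_all
  then show ?thesis by auto
qed

section \<open>Rows of polynomial functions\<close>

definition hprod :: "('n::finite \<Rightarrow> quat) \<Rightarrow> ('n \<Rightarrow> quat) \<Rightarrow> quat" where
  "hprod w r = (\<Sum>j\<in>UNIV. w j * qcnj (r j))"

lemma hprod_diff_left: "hprod (\<lambda>j. v j - w j) r = hprod v r - hprod w r"
  and hprod_scale_left: "hprod (\<lambda>j. a * w j) r = a * hprod w r"
  by (simp_all add: hprod_def distrib_right left_diff_distrib sum.distrib sum_subtractf sum_distrib_left mult.assoc)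

lemma hprod_add_right: "hprod w (\<lambda>j. r j + s j) = hprod w r + hprod w s"
  and hprod_scale_right: "hprod w (\<lambda>j. a * r j) = hprod w r * qcnj a"
  by (simp_all add: hprod_def qcnj_add qcnj_mult distrib_left sum.distrib sum_distrib_right mult.assoc)

lemma qcnj_hprod: "qcnj (hprod w r) = hprod r w"
  by (simp add: hprod_def qcnj_sum qcnj_mult qcnj_qcnj)

definition normsq :: "('n::finite \<Rightarrow> quat) \<Rightarrow> real" where
  "normsq w = (\<Sum>j\<in>UNIV. (qre (w j))\<^sup>2 + (qi (w j))\<^sup>2 + (qj (w j))\<^sup>2 + (qk (w j))\<^sup>2)"

lemma of_re_sum: "of_re (sum f A) = (\<Sum>x\<in>A. of_re (f x))"
  by (induction A rule: infinite_finite_induct) (simp_all add: of_re_simps)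

lemma hprod_self: "hprod w w = of_re (normsq w)"
proof -
  have "q * qcnj q = of_re ((qre q)\<^sup>2 + (qi q)\<^sup>2 + (qj q)\<^sup>2 + (qk q)\<^sup>2)" for q
    by (simp add: of_re_def quat_defs qcnj_def power2_eq_square)
  then show ?thesis by (simp add: hprod_def normsq_def of_re_sum)
qed

definition poly_rows :: "(quat ^ 'd \<Rightarrow> 'n \<Rightarrow> quat) set" where
  "poly_rows = {r. \<forall>j. (\<lambda>x. r x j) \<in> quat_polyfun}"

lemma poly_rowsD: "r \<in> poly_rows \<Longrightarrow> (\<lambda>x. r x j) \<in> quat_polyfun"
  by (simp add: poly_rows_def)

lemma poly_rows_add: "r \<in> poly_rows \<Longrightarrow> s \<in> poly_rows \<Longrightarrow> (\<lambda>x j. r x j + s x j) \<in> poly_rows"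
  and poly_rows_diff: "r \<in> poly_rows \<Longrightarrow> s \<in> poly_rows \<Longrightarrow> (\<lambda>x j. r x j - s x j) \<in> poly_rows"
  and poly_rows_scale: "a \<in> quat_polyfun \<Longrightarrow> r \<in> poly_rows \<Longrightarrow> (\<lambda>x j. a x * r x j) \<in> poly_rows"
  unfolding poly_rows_def mem_Collect_eq
  by (rule allI, rule quat_polyfun_closed(1), blast, blast)
    (rule allI, rule quat_polyfun_closed(5), blast, blast,
     rule allI, rule quat_polyfun_closed(2), assumption, blast)

lemma quat_polyfun_hprod:
  fixes w r :: "quat ^ 'd \<Rightarrow> 'n::finite \<Rightarrow> quat"
  assumes "w \<in> poly_rows" "r \<in> poly_rows"
  shows "(\<lambda>x. hprod (w x) (r x)) \<in> quat_polyfun"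
  unfolding hprod_def
  by (rule quat_polyfun_sum', rule quat_polyfun_closed(2)[OF _ quat_polyfun_closed(4)]) (rule poly_rowsD assms)+

inductive_set row_span :: "(quat ^ 'd \<Rightarrow> 'n \<Rightarrow> quat) set \<Rightarrow> (quat ^ 'd \<Rightarrow> 'n \<Rightarrow> quat) set" for S where
  zero: "(\<lambda>_ _. 0) \<in> row_span S"
| step: "c \<in> row_span S \<Longrightarrow> a \<in> quat_polyfun \<Longrightarrow> r \<in> S \<Longrightarrow> (\<lambda>x j. c x j + a x * r x j) \<in> row_span S"

lemma row_span_add: "d \<in> row_span S \<Longrightarrow> c \<in> row_span S \<Longrightarrow> (\<lambda>x j. c x j + d x j) \<in> row_span S"
proof (induction rule: row_span.induct)
  case (step d a r)
  from row_span.step[OF step.IH[OF step.prems] step.hyps(2,3)] show ?case by (simp add: add.assoc)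
qed simp

lemma row_span_scale:
  assumes "c \<in> row_span S" "a \<in> quat_polyfun"
  shows "(\<lambda>x j. a x * c x j) \<in> row_span S"
  using assms(1)
proof induction
  case (step c b r)
  from row_span.step[OF step.IH quat_polyfun_closed(2)[OF assms(2) step.hyps(2)] step.hyps(3)]
  show ?case by (simp add: distrib_left mult.assoc)
qed (simp add: row_span.zero)

lemma row_span_diff:
  assumes "c \<in> row_span S" "d \<in> row_span S"
  shows "(\<lambda>x j. c x j - d x j) \<in> row_span S"
  using row_span_add[OF row_span_scale[OF assms(2) quat_polyfun.const[of "- 1"]] assms(1)] by simp

lemma row_span_base: "r \<in> S \<Longrightarrow> r \<in> row_span S"
  using row_span.step[OF row_span.zero quat_polyfun.const[of 1], of r S] by simp

lemma row_span_mono: "c \<in> row_span S \<Longrightarrow> S \<subseteq> T \<Longrightarrow> c \<in> row_span T"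
  by (induction rule: row_span.induct) (auto intro: row_span.intros)

lemma row_span_subset:
  assumes "c \<in> row_span S" "S \<subseteq> N" "(\<lambda>_ _. 0) \<in> N"
    and "\<And>r s. r \<in> N \<Longrightarrow> s \<in> N \<Longrightarrow> (\<lambda>x j. r x j + s x j) \<in> N"
    and "\<And>a r. a \<in> quat_polyfun \<Longrightarrow> r \<in> N \<Longrightarrow> (\<lambda>x j. a x * r x j) \<in> N"
  shows "c \<in> N"
  using assms(1)
proof induction
  case (step c a r)
  show ?case by (rule assms(4)[OF step.IH assms(5)]) (use step.hyps assms(2) in auto)
qed (rule assms(3))

section \<open>Orthogonality of rows modulo a real prime\<close>

locale quat_real_prime = real_prime_ideal real_polyfun P
  for P :: "(quat ^ 'd \<Rightarrow> real) set"
begin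

lemma uminus: "f \<in> P \<Longrightarrow> (\<lambda>x. - f x) \<in> P"
  using mult[OF real_polyfun_closed(1)[of "- 1"], of f] by simp

lemma diff: "f \<in> P \<Longrightarrow> g \<in> P \<Longrightarrow> (\<lambda>x. f x - g x) \<in> P"
  using add[OF _ uminus, of f g] by simp

text \<open>This is $P + Pi + Pj + Pk$, the extension of \<open>P\<close> to the quaternionic
  functions; it is a two-sided ideal stable under conjugation.\<close>

definition qideal :: "(quat ^ 'd \<Rightarrow> quat) set" where
  "qideal = {f \<in> quat_polyfun. \<forall>c\<in>quat_parts. (\<lambda>x. c (f x)) \<in> P}"

lemma qidealI:
  "f \<in> quat_polyfun \<Longrightarrow> (\<lambda>x. qre (f x)) \<in> P \<Longrightarrow> (\<lambda>x. qi (f x)) \<in> P \<Longrightarrow> (\<lambda>x. qj (f x)) \<in> P \<Longrightarrow>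
    (\<lambda>x. qk (f x)) \<in> P \<Longrightarrow> f \<in> qideal"
  by (simp add: qideal_def quat_parts_def)

lemma qidealD:
  assumes "f \<in> qideal"
  shows "f \<in> quat_polyfun" "(\<lambda>x. qre (f x)) \<in> P" "(\<lambda>x. qi (f x)) \<in> P" "(\<lambda>x. qj (f x)) \<in> P"
    "(\<lambda>x. qk (f x)) \<in> P" "c \<in> quat_parts \<Longrightarrow> (\<lambda>x. c (f x)) \<in> P"
  using assms by (auto simp: qideal_def quat_parts_def)

lemma qideal_0: "(\<lambda>_. 0) \<in> qideal"
  by (rule qidealI) (simp_all add: zero_quat_def quat_polyfun.const zero)

lemma qideal_add:
  assumes "f \<in> qideal" "g \<in> qideal"
  shows "(\<lambda>x. f x + g x) \<in> qideal"
  by (rule qidealI, rule quat_polyfun_closed(1)[OF qidealD(1)[OF assms(1)] qidealD(1)[OF assms(2)]])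
    (simp_all add: plus_quat_def add qidealD[OF assms(1)] qidealD[OF assms(2)])

lemma qideal_diff:
  assumes "f \<in> qideal" "g \<in> qideal"
  shows "(\<lambda>x. f x - g x) \<in> qideal"
  by (rule qidealI, rule quat_polyfun_closed(5)[OF qidealD(1)[OF assms(1)] qidealD(1)[OF assms(2)]])
    (simp_all add: minus_quat_def diff qidealD[OF assms(1)] qidealD[OF assms(2)])

lemma qideal_cnj:
  assumes "f \<in> qideal"
  shows "(\<lambda>x. qcnj (f x)) \<in> qideal"
  by (rule qidealI, rule quat_polyfun_closed(4)[OF qidealD(1)[OF assms]])
    (simp_all add: qcnj_def uminus qidealD[OF assms])

lemma qideal_mult_left:
  assumes a: "a \<in> quat_polyfun" and f: "f \<in> qideal"
  shows "(\<lambda>x. a x * f x) \<in> qideal"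
proof (rule qidealI)
  show "(\<lambda>x. a x * f x) \<in> quat_polyfun" by (rule quat_polyfun_closed(2)[OF a qidealD(1)[OF f]])
  have m: "(\<lambda>x. b (a x) * c (f x)) \<in> P" if "b \<in> quat_parts" "c \<in> quat_parts" for b c
    by (rule mult[OF real_polyfun_parts[OF a that(1)] qidealD(6)[OF f that(2)]])
  show "(\<lambda>x. qre (a x * f x)) \<in> P" "(\<lambda>x. qi (a x * f x)) \<in> P" "(\<lambda>x. qj (a x * f x)) \<in> P"
    "(\<lambda>x. qk (a x * f x)) \<in> P"
    by (simp_all add: times_quat_def m add diff quat_parts_def)
qed

lemma qideal_mult_right:
  assumes "a \<in> quat_polyfun" "f \<in> qideal"
  shows "(\<lambda>x. f x * a x) \<in> qideal"
  using qideal_cnj[OF qideal_mult_left[OF quat_polyfun_closed(4)[OF assms(1)] qideal_cnj[OF assms(2)]]]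
  by (simp add: qcnj_mult qcnj_qcnj)

lemma of_re_qidealD: "(\<lambda>x. of_re (s x)) \<in> qideal \<Longrightarrow> s \<in> P"
  using qidealD(2) by (force simp: of_re_def)

lemma qideal_cancel:
  assumes s: "s \<in> real_polyfun" "s \<notin> P" and f: "f \<in> quat_polyfun" "(\<lambda>x. of_re (s x) * f x) \<in> qideal"
  shows "f \<in> qideal"
  unfolding qideal_def
proof (intro CollectI conjI ballI f)
  fix c assume c: "c \<in> quat_parts"
  have "(\<lambda>x. s x * c (f x)) \<in> P"
    using qidealD(6)[OF f(2) c] by (simp add: parts_of_re_mult[OF c])
  then show "(\<lambda>x. c (f x)) \<in> P"
    using prime[OF s(1) real_polyfun_parts[OF f(1) c]] s(2) by blast
qed

lemma qideal_sum:
  assumes "\<And>i. i \<in> A \<Longrightarrow> f i \<in> qideal"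
  shows "(\<lambda>x. \<Sum>i\<in>A. f i x) \<in> qideal"
  using assms
proof (induction A rule: infinite_finite_induct)
  case (insert i A)
  then have "(\<lambda>x. f i x + (\<Sum>i\<in>A. f i x)) \<in> qideal" by (intro qideal_add) auto
  then show ?case using insert.hyps by simp
qed (simp_all add: qideal_0)

lemma normsq_real_polyfun:
  fixes w :: "quat ^ 'd \<Rightarrow> 'n::finite \<Rightarrow> quat"
  assumes "w \<in> poly_rows"
  shows "(\<lambda>x. normsq (w x)) \<in> real_polyfun"
proof -
  have "(\<lambda>x. (c (w x j))\<^sup>2) \<in> real_polyfun" if "c \<in> quat_parts" for c j
    unfolding power2_eq_square using real_polyfun_parts[OF poly_rowsD[OF assms] that] by (intro real_polyfun_closed(3))
  then show ?thesis
    unfolding normsq_def by (intro real_polyfun_sum real_polyfun_closed(2)) (auto simp: quat_parts_def)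
qed

text \<open>The square norm is a sum of squares of the real coordinates of all entries, to which
  realness of \<open>P\<close> applies.\<close>

lemma normsq_in_P:
  fixes w :: "quat ^ 'd \<Rightarrow> 'n::finite \<Rightarrow> quat"
  assumes w: "w \<in> poly_rows" and n: "(\<lambda>x. normsq (w x)) \<in> P"
  shows "(\<lambda>x. w x j) \<in> qideal"
proof -
  obtain js :: "'n list" where js: "set js = UNIV" "distinct js"
    using finite_distinct_list[OF finite] by blast
  define fs where "fs = concat (map (\<lambda>j. map (\<lambda>c x. c (w x j)) [qre, qi, qj, qk]) js)"
  have "(\<lambda>x. \<Sum>f\<leftarrow>fs. (f x)\<^sup>2) = (\<lambda>x. \<Sum>j\<leftarrow>js. (qre (w x j))\<^sup>2 + (qi (w x j))\<^sup>2 + (qj (w x j))\<^sup>2 + (qk (w x j))\<^sup>2)"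
    unfolding fs_def by (induction js) (simp_all add: fun_eq_iff)
  also have "\<dots> = (\<lambda>x. normsq (w x))"
    using js by (simp add: normsq_def sum_list_distinct_conv_sum_set)
  finally have "(\<lambda>x. \<Sum>f\<leftarrow>fs. (f x)\<^sup>2) \<in> P" using n by simp
  moreover have "set fs \<subseteq> real_polyfun"
    using real_polyfun_parts[OF poly_rowsD[OF w]] by (auto simp: fs_def quat_parts_def)
  ultimately have "set fs \<subseteq> P" by (intro real)
  moreover have "(\<lambda>x. c (w x j)) \<in> set fs" if "c \<in> quat_parts" for c
    using that js by (auto simp: fs_def quat_parts_def)
  ultimately show ?thesis using poly_rowsD[OF w] by (auto simp: qideal_def)
qed

definition orth :: "(quat ^ 'd \<Rightarrow> 'n::finite \<Rightarrow> quat) \<Rightarrow> (quat ^ 'd \<Rightarrow> 'n \<Rightarrow> quat) \<Rightarrow> bool" where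
  "orth w r \<longleftrightarrow> (\<lambda>x. hprod (w x) (r x)) \<in> qideal"

lemma orth_row_span:
  assumes "c \<in> row_span S" "\<And>r. r \<in> S \<Longrightarrow> orth w r"
  shows "orth w c"
  using assms(1)
proof induction
  case zero
  show ?case using qideal_0 by (simp add: orth_def hprod_def qcnj_0)
next
  case (step c a r)
  have "(\<lambda>x. hprod (w x) (r x) * qcnj (a x)) \<in> qideal"
    using assms(2)[OF step.hyps(3)] quat_polyfun_closed(4)[OF step.hyps(2)]
    unfolding orth_def by (intro qideal_mult_right)
  from qideal_add[OF step.IH[unfolded orth_def] this] show ?case
    by (simp add: orth_def hprod_add_right hprod_scale_right)
qed

text \<open>Orthogonalising $w_1$ against $w_0$ as $|w_0|^2 w_1 - (w_1 w_0^*) w_0$ needs no denominators.\<close>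

lemma gram_schmidt:
  fixes S :: "(quat ^ 'd \<Rightarrow> 'n::finite \<Rightarrow> quat) set"
  assumes "finite S" "S \<subseteq> poly_rows" "q \<in> poly_rows"
  shows "\<exists>s c. s \<in> real_polyfun \<and> s \<notin> P \<and> c \<in> row_span S \<and>
    (\<forall>r\<in>S. orth (\<lambda>x j. of_re (s x) * q x j - c x j) r)"
  using assms
proof (induction arbitrary: q rule: finite_induct)
  case empty
  show ?case
    using real_polyfun_closed(1) one row_span.zero by blast
next
  case (insert r S)
  have r: "r \<in> poly_rows" and S: "S \<subseteq> poly_rows" using insert.prems by auto
  have span_rows: "c \<in> poly_rows" if "c \<in> row_span S" for c
    using that S by (rule row_span_subset) (auto simp: poly_rows_add poly_rows_scale, simp add: poly_rows_def quat_polyfun.const)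
  \<comment> \<open>The induction hypothesis is applied both to the new row \<open>r\<close> and to
    \<open>q\<close>; the resulting \<open>w0\<close> and \<open>w1\<close> are orthogonal to
    \<open>S\<close> modulo \<open>P\<close>.\<close>
  obtain s0 c0 where 0: "s0 \<in> real_polyfun" "s0 \<notin> P" "c0 \<in> row_span S"
    and orth0: "\<And>p. p \<in> S \<Longrightarrow> orth (\<lambda>x j. of_re (s0 x) * r x j - c0 x j) p"
    using insert.IH[OF S r] by blast
  obtain s1 c1 where 1: "s1 \<in> real_polyfun" "s1 \<notin> P" "c1 \<in> row_span S"
    and orth1: "\<And>p. p \<in> S \<Longrightarrow> orth (\<lambda>x j. of_re (s1 x) * q x j - c1 x j) p"
    using insert.IH[OF S insert.prems(2)] by blast
  define w0 where "w0 = (\<lambda>x j. of_re (s0 x) * r x j - c0 x j)"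
  define w1 where "w1 = (\<lambda>x j. of_re (s1 x) * q x j - c1 x j)"
  have w0: "w0 \<in> poly_rows"
    unfolding w0_def by (intro poly_rows_diff poly_rows_scale real_polyfun_closed(4) 0(1) r span_rows[OF 0(3)])
  have w1: "w1 \<in> poly_rows"
    unfolding w1_def by (intro poly_rows_diff poly_rows_scale real_polyfun_closed(4) 1(1) insert.prems(2) span_rows[OF 1(3)])
  \<comment> \<open>\<open>s0 * r\<close> is the sum of \<open>w0\<close> and an element of the span
    of \<open>S\<close>, and the scalar \<open>s0\<close> outside \<open>P\<close> can be
    cancelled.\<close>
  have orth_r: "orth w r" if w: "w \<in> poly_rows" "\<And>p. p \<in> S \<Longrightarrow> orth w p" "orth w w0" for w
  proof -
    have "(\<lambda>x. hprod (w x) (w0 x) + hprod (w x) (c0 x)) \<in> qideal"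
      using w(3) orth_row_span[OF 0(3) w(2)] unfolding orth_def by (rule qideal_add)
    also have "(\<lambda>x. hprod (w x) (w0 x) + hprod (w x) (c0 x)) = (\<lambda>x. of_re (s0 x) * hprod (w x) (r x))"
      by (simp add: hprod_add_right[symmetric] w0_def hprod_scale_right of_re_simps)
    finally show ?thesis
      unfolding orth_def by (rule qideal_cancel[OF 0(1,2) quat_polyfun_hprod[OF w(1) r]])
  qed
  show ?case
  \<comment> \<open>If \<open>w0\<close> vanishes modulo \<open>P\<close>, then \<open>w1\<close> is
    already orthogonal to \<open>r\<close>. Otherwise the square norm of \<open>w0\<close> is not in
    \<open>P\<close> and may enter the multiplier of \<open>q\<close>.\<close>
  proof (cases "\<forall>j. (\<lambda>x. w0 x j) \<in> qideal")
    case True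
    have "orth w1 w0"
      unfolding orth_def hprod_def
      using True by (intro qideal_sum qideal_mult_left qideal_cnj poly_rowsD w1) auto
    then have "orth w1 r" using orth_r[OF w1] orth1 by (simp add: w1_def)
    then show ?thesis
      using 1 orth1 row_span_mono[OF 1(3), of "insert r S"] unfolding w1_def by blast
  next
    case False
    define \<delta> where "\<delta> = (\<lambda>x. normsq (w0 x))"
    have \<delta>: "\<delta> \<in> real_polyfun" "\<delta> \<notin> P"
      using False normsq_in_P[OF w0] normsq_real_polyfun[OF w0] unfolding \<delta>_def by blast+
    define h where "h = (\<lambda>x. hprod (w1 x) (w0 x))"
    have h: "h \<in> quat_polyfun" unfolding h_def by (rule quat_polyfun_hprod[OF w1 w0])
    define w where "w = (\<lambda>x j. of_re (\<delta> x) * w1 x j - h x * w0 x j)"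
    define s where "s = (\<lambda>x. \<delta> x * s1 x)"
    define c where "c = (\<lambda>x j. of_re (\<delta> x) * c1 x j + (h x * (of_re (s0 x) * r x j) - h x * c0 x j))"
    have s: "s \<in> real_polyfun" "s \<notin> P"
      using \<delta> 1(1,2) prime[OF \<delta>(1) 1(1)] unfolding s_def by (auto intro: real_polyfun_closed)
    have c: "c \<in> row_span (insert r S)"
      unfolding c_def
      by (intro row_span_add row_span_diff row_span_scale h real_polyfun_closed(4) 0(1) \<delta>(1)
        row_span_mono[OF 0(3)] row_span_mono[OF 1(3)] row_span_base) auto
    have wsc: "w = (\<lambda>x j. of_re (s x) * q x j - c x j)"
      by (simp add: w_def s_def c_def w0_def w1_def of_re_simps(4) fun_eq_iff algebra_simps)
    have w: "w \<in> poly_rows"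
      unfolding w_def by (intro poly_rows_diff poly_rows_scale real_polyfun_closed(4) \<delta>(1) h w0 w1)
    have orthS: "orth w p" if "p \<in> S" for p
    proof -
      have "(\<lambda>x. of_re (\<delta> x) * hprod (w1 x) (p x) - h x * hprod (w0 x) (p x)) \<in> qideal"
        using orth0[OF that] orth1[OF that] unfolding orth_def w0_def[symmetric] w1_def[symmetric]
        by (intro qideal_diff qideal_mult_left real_polyfun_closed(4) \<delta>(1) h)
      then show ?thesis by (simp add: orth_def w_def hprod_diff_left hprod_scale_left)
    qed
    have "hprod (w x) (w0 x) = 0" for x
      by (simp add: w_def hprod_diff_left hprod_scale_left hprod_self h_def \<delta>_def of_re_simps(6))
    then have "orth w w0" using qideal_0 by (simp add: orth_def)
    then have "orth w r" using orth_r[OF w orthS] by blast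
    then show ?thesis using s c orthS unfolding wsc by blast
  qed
qed

end

section \<open>Separation of a row from a real module\<close>

lemma sum_list_of_re_mult: "(\<Sum>f\<leftarrow>fs. of_re (g f) * q) = of_re (\<Sum>f\<leftarrow>fs. g f) * q"
  by (induction fs) (simp_all add: of_re_simps(1,3) distrib_right)

text \<open>Used to write the product of a conjugate and a row as a combination, with constant
  coefficients, of real multiples of the row.\<close>

lemma qcnj_parts: "qcnj q = of_re (qre q) - Quat 0 1 0 0 * of_re (qi q) - Quat 0 0 1 0 * of_re (qj q) - Quat 0 0 0 1 * of_re (qk q)"
  by (simp add: qcnj_def of_re_def quat_defs)

text \<open>The assumption \<open>Nreal\<close> is realness of a left ideal expressed by rows: the
  sum over \<open>ws\<close> is the \<open>i\<close>-th row of the matrix formed by adding all $w^*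
  w$.\<close>

theorem separating_vector:
  fixes N S :: "(quat ^ 'd \<Rightarrow> 'n::finite \<Rightarrow> quat) set"
  assumes N: "N \<subseteq> poly_rows" "(\<lambda>_ _. 0) \<in> N"
    and Nadd: "\<And>r s. r \<in> N \<Longrightarrow> s \<in> N \<Longrightarrow> (\<lambda>x j. r x j + s x j) \<in> N"
    and Nscale: "\<And>a r. a \<in> quat_polyfun \<Longrightarrow> r \<in> N \<Longrightarrow> (\<lambda>x j. a x * r x j) \<in> N"
    and Nreal: "\<And>ws. set ws \<subseteq> poly_rows \<Longrightarrow> (\<And>i. (\<lambda>x j. \<Sum>w\<leftarrow>ws. qcnj (w x i) * w x j) \<in> N) \<Longrightarrow> set ws \<subseteq> N"
    and q: "q \<in> poly_rows" "q \<notin> N" and S: "finite S" "S \<subseteq> N"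
  shows "\<exists>x v. (\<forall>r\<in>S. (\<Sum>j\<in>UNIV. r x j * v j) = 0) \<and> (\<Sum>j\<in>UNIV. q x j * v j) \<noteq> 0"
proof -
  have Ndiff: "(\<lambda>x j. r x j - s x j) \<in> N" if "r \<in> N" "s \<in> N" for r s
    using Nadd[OF that(1) Nscale[OF quat_polyfun.const[of "- 1"] that(2)]] by simp
  define I where "I = {s \<in> real_polyfun. (\<lambda>x j. of_re (s x) * q x j) \<in> N}"
  have Imult: "(\<lambda>a. g a * h a) \<in> I" if "g \<in> real_polyfun" "h \<in> I" for g h
  proof -
    have "h \<in> real_polyfun" "(\<lambda>x j. of_re (h x) * q x j) \<in> N"
      using that unfolding I_def by blast+
    from real_polyfun_closed(3)[OF that(1) this(1)] Nscale[OF real_polyfun_closed(4)[OF that(1)] this(2)]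
    show ?thesis by (simp add: I_def of_re_simps(4) mult.assoc)
  qed
  have "\<exists>P. real_prime_ideal real_polyfun P \<and> I \<subseteq> P \<and> (\<forall>f\<in>P. \<exists>t\<in>real_polyfun - P. (\<lambda>a. t a * f a) \<in> I)"
  proof (rule ex_minimal_real_prime_ideal)
    show "I \<subseteq> real_polyfun" by (auto simp: I_def)
    show "(\<lambda>_. 0) \<in> I" using N(2) real_polyfun_closed(1)[of 0] by (simp add: I_def of_re_simps)
    show "(\<lambda>_. 1) \<notin> I" using q(2) by (simp add: I_def of_re_simps)
    show "(\<lambda>a. f a + g a) \<in> I" if "f \<in> I" "g \<in> I" for f g
    proof -
      have "f \<in> real_polyfun" "g \<in> real_polyfun" "(\<lambda>x j. of_re (f x) * q x j) \<in> N" "(\<lambda>x j. of_re (g x) * q x j) \<in> N"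
        using that unfolding I_def by blast+
      from real_polyfun_closed(2)[OF this(1,2)] Nadd[OF this(3,4)] show ?thesis
        by (simp add: I_def of_re_simps(3) distrib_right)
    qed
    show "(\<lambda>a. f a * g a) \<in> I" if "f \<in> real_polyfun" "g \<in> I" for f g
      by (rule Imult[OF that])
    show "set fs \<subseteq> I" if fs: "set fs \<subseteq> real_polyfun" "(\<lambda>a. \<Sum>f\<leftarrow>fs. (f a)\<^sup>2) \<in> I" for fs
    proof -
      define ws where "ws = map (\<lambda>f x j. of_re (f x) * q x j) fs"
      have "set ws \<subseteq> N"
      proof (rule Nreal)
        show "set ws \<subseteq> poly_rows"
          unfolding ws_def using fs(1) q(1) real_polyfun_closed(4) poly_rows_scale by fastforce
        fix i
        have "(\<lambda>x j. of_re (\<Sum>f\<leftarrow>fs. (f x)\<^sup>2) * q x j) \<in> N" using fs(2) unfolding I_def by blast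
        from Nscale[OF quat_polyfun_closed(4)[OF poly_rowsD[OF q(1), of i]] this]
        have "(\<lambda>x j. qcnj (q x i) * (of_re (\<Sum>f\<leftarrow>fs. (f x)\<^sup>2) * q x j)) \<in> N" .
        also have "(\<lambda>x j. qcnj (q x i) * (of_re (\<Sum>f\<leftarrow>fs. (f x)\<^sup>2) * q x j)) =
            (\<lambda>x j. \<Sum>w\<leftarrow>ws. qcnj (w x i) * w x j)"
        proof (intro ext)
          fix x j
          have "qcnj (of_re a * p) * (of_re a * p') = of_re (a\<^sup>2) * (qcnj p * p')" for a p p'
            by (simp add: of_re_def quat_defs qcnj_def quat_eq_iff power2_eq_square algebra_simps)
          then have "(\<Sum>w\<leftarrow>ws. qcnj (w x i) * w x j) = (\<Sum>f\<leftarrow>fs. of_re ((f x)\<^sup>2) * (qcnj (q x i) * q x j))"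
            by (simp add: ws_def o_def)
          also have "\<dots> = of_re (\<Sum>f\<leftarrow>fs. (f x)\<^sup>2) * (qcnj (q x i) * q x j)"
            by (rule sum_list_of_re_mult)
          also have "\<dots> = qcnj (q x i) * (of_re (\<Sum>f\<leftarrow>fs. (f x)\<^sup>2) * q x j)"
            by (simp only: mult.assoc[symmetric] of_re_simps(6))
          finally show "qcnj (q x i) * (of_re (\<Sum>f\<leftarrow>fs. (f x)\<^sup>2) * q x j) = (\<Sum>w\<leftarrow>ws. qcnj (w x i) * w x j)"
            by (rule sym)
        qed
        finally show "(\<lambda>x j. \<Sum>w\<leftarrow>ws. qcnj (w x i) * w x j) \<in> N" .
      qed
      then show ?thesis using fs(1) by (auto simp: ws_def I_def)
    qed
  qed (fact real_polyfun_closed)+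
  then obtain P where P: "real_prime_ideal real_polyfun P" and IP: "I \<subseteq> P"
    and local: "\<And>f. f \<in> P \<Longrightarrow> \<exists>t\<in>real_polyfun - P. (\<lambda>a. t a * f a) \<in> I" by blast
  interpret real_prime_ideal real_polyfun P by (rule P)
  interpret quat_real_prime P by unfold_locales
  have SR: "S \<subseteq> poly_rows" using S(2) N(1) by blast
  obtain s c where s: "s \<in> real_polyfun" "s \<notin> P" and c: "c \<in> row_span S"
    and orth: "\<And>r. r \<in> S \<Longrightarrow> orth (\<lambda>x j. of_re (s x) * q x j - c x j) r"
    using gram_schmidt[OF S(1) SR q(1)] by blast
  have cN: "c \<in> N" by (rule row_span_subset[OF c S(2) N(2) Nadd Nscale])
  have cR: "c \<in> poly_rows" using cN N(1) by blast
  define w where "w = (\<lambda>x j. of_re (s x) * q x j - c x j)"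
  have w: "w \<in> poly_rows" unfolding w_def by (intro poly_rows_diff poly_rows_scale real_polyfun_closed(4) s q cR)
  have "\<exists>j. (\<lambda>x. w x j) \<notin> qideal"
  proof (rule ccontr)
    assume "\<not> ?thesis"
    then have wP: "(\<lambda>x. b (w x j)) \<in> P" if "b \<in> quat_parts" for b j
      using qidealD(6)[OF _ that] by blast
    \<comment> \<open>A product of individual multipliers serves all of \<open>F\<close>, and
      primality keeps it outside \<open>P\<close>.\<close>
    have "\<exists>t\<in>real_polyfun - P. \<forall>f\<in>F. (\<lambda>a. t a * f a) \<in> I" if "finite F" "F \<subseteq> P" for F
      using that
    proof (induction rule: finite_induct)
      case empty
      then show ?case using real_polyfun_closed(1)[of 1] one by blast
    next
      case (insert f F)
      then obtain t where t: "t \<in> real_polyfun" "t \<notin> P" "\<And>f. f \<in> F \<Longrightarrow> (\<lambda>a. t a * f a) \<in> I" by blast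
      obtain u where u: "u \<in> real_polyfun" "u \<notin> P" "(\<lambda>a. u a * f a) \<in> I" using local[of f] insert.prems by blast
      have "(\<lambda>a. t a * u a) \<in> real_polyfun" "(\<lambda>a. t a * u a) \<notin> P"
        using real_polyfun_closed(3)[OF t(1) u(1)] prime[OF t(1) u(1)] t(2) u(2) by blast+
      moreover have "(\<lambda>a. t a * u a * f a) \<in> I"
        using Imult[OF t(1) u(3)] by (simp add: mult.assoc)
      moreover have "(\<lambda>a. t a * u a * g a) \<in> I" if "g \<in> F" for g
        using Imult[OF u(1) t(3)[OF that]] by (simp add: mult_ac)
      ultimately show ?case
        by (intro bexI[of _ "\<lambda>a. t a * u a"]) auto
    qed
    note common = this
    define F where "F = (\<Union>b\<in>quat_parts. range (\<lambda>j x. b (w x j)))"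
    have "F \<subseteq> P" unfolding F_def using wP by blast
    moreover have "finite F" by (simp add: F_def quat_parts_def)
    ultimately obtain t where t: "t \<in> real_polyfun" "t \<notin> P"
      and tF: "\<And>f. f \<in> F \<Longrightarrow> (\<lambda>x. t x * f x) \<in> I"
      using common[of F] by blast
    have tI: "(\<lambda>x. t x * b (w x j)) \<in> I" if "b \<in> quat_parts" for b j
      by (rule tF) (use that in \<open>auto simp: F_def\<close>)
    define tw where "tw = (\<lambda>x j. of_re (t x) * w x j)"
    have tw: "tw \<in> poly_rows" unfolding tw_def by (intro poly_rows_scale real_polyfun_closed(4) t w)
    \<comment> \<open>Expanding, $y t w = t s (y q) - y t c$: the factor \<open>y\<close> carries
      \<open>q\<close> into \<open>N\<close>, and \<open>c\<close> belongs to \<open>N\<close>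
      anyway.\<close>
    have yN: "(\<lambda>x j. of_re (y x) * tw x j) \<in> N" if y: "y \<in> I" for y
    proof -
      have y': "y \<in> real_polyfun" "(\<lambda>x j. of_re (y x) * q x j) \<in> N" using y unfolding I_def by blast+
      have "(\<lambda>x j. of_re (t x * s x) * (of_re (y x) * q x j) - of_re (y x * t x) * c x j) \<in> N"
        by (intro Ndiff Nscale y'(2) cN real_polyfun_closed(3,4) t(1) s(1) y'(1))
      also have "(\<lambda>x j. of_re (t x * s x) * (of_re (y x) * q x j) - of_re (y x * t x) * c x j) =
          (\<lambda>x j. of_re (y x) * tw x j)"
      proof (intro ext)
        fix x j
        have *: "t x * s x * y x = y x * t x * s x" by (simp only: mult_ac)
        show "of_re (t x * s x) * (of_re (y x) * q x j) - of_re (y x * t x) * c x j = of_re (y x) * tw x j"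
          unfolding tw_def w_def
          by (simp only: right_diff_distrib of_re_simps(4)[symmetric] mult.assoc[symmetric] *)
      qed
      finally show ?thesis .
    qed
    \<comment> \<open>The real coordinates of the entries of \<open>tw\<close> belong to
      \<open>I\<close>. By \<open>yN\<close> they carry \<open>tw\<close> into \<open>N\<close>, so
      realness can be applied to the single row \<open>tw\<close>.\<close>
    have "set [tw] \<subseteq> N"
    proof (rule Nreal)
      show "set [tw] \<subseteq> poly_rows" using tw by simp
      fix i
      define y where "y = (\<lambda>b x. t x * b (w x i))"
      have yI: "y b \<in> I" if "b \<in> quat_parts" for b using tI[OF that] by (simp add: y_def)
      have y: "qre (tw x i) = y qre x" "qi (tw x i) = y qi x" "qj (tw x i) = y qj x" "qk (tw x i) = y qk x" for x
        by (simp_all add: tw_def y_def parts_of_re_mult quat_parts_def)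
      have "(\<lambda>x j. of_re (y qre x) * tw x j - Quat 0 1 0 0 * (of_re (y qi x) * tw x j)
          - Quat 0 0 1 0 * (of_re (y qj x) * tw x j) - Quat 0 0 0 1 * (of_re (y qk x) * tw x j)) \<in> N"
        by (intro Ndiff Nscale[OF quat_polyfun.const] yN yI) (simp_all add: quat_parts_def)
      then show "(\<lambda>x j. \<Sum>w\<leftarrow>[tw]. qcnj (w x i) * w x j) \<in> N"
        by (simp add: qcnj_parts[of "tw _ i"] y left_diff_distrib mult.assoc)
    qed
    then have "(\<lambda>x j. tw x j + of_re (t x) * c x j) \<in> N"
      by (intro Nadd Nscale real_polyfun_closed(4) t(1) cN) simp
    also have "(\<lambda>x j. tw x j + of_re (t x) * c x j) = (\<lambda>x j. of_re (t x * s x) * q x j)"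
      by (simp add: tw_def w_def of_re_simps(4) right_diff_distrib mult.assoc)
    finally have "(\<lambda>x. t x * s x) \<in> I"
      using real_polyfun_closed(3)[OF t(1) s(1)] by (simp add: I_def)
    then have "(\<lambda>x. t x * s x) \<in> P" using IP by blast
    then show False using prime[OF t(1) s(1)] t(2) s(2) by blast
  qed
  then have normsq: "(\<lambda>x. normsq (w x)) \<notin> P" using normsq_in_P[OF w] by blast
  have "orth w c" using orth by (intro orth_row_span[OF c]) (simp add: w_def)
  then have cw: "(\<lambda>x. hprod (c x) (w x)) \<in> qideal"
    using qideal_cnj unfolding orth_def by (fastforce simp: qcnj_hprod)
  \<comment> \<open>In $w w^* = s q w^* - c w^*$ the last term vanishes modulo \<open>P\<close>,
    because \<open>w\<close> is orthogonal to the whole span.\<close>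
  have qw: "(\<lambda>x. hprod (q x) (w x)) \<notin> qideal"
  proof
    assume "(\<lambda>x. hprod (q x) (w x)) \<in> qideal"
    from qideal_diff[OF qideal_mult_left[OF real_polyfun_closed(4)[OF s(1)] this] cw]
    have "(\<lambda>x. of_re (normsq (w x))) \<in> qideal"
      by (simp add: hprod_self[symmetric] hprod_diff_left hprod_scale_left w_def)
    from of_re_qidealD[OF this] normsq show False by contradiction
  qed
  \<comment> \<open>The Nullstellensatz speaks about real functions, so one real coordinate of $q
    w^*$ outside \<open>P\<close> is selected, while \<open>F\<close> collects all real coordinates
    of the $r w^*$.\<close>
  then obtain b where b: "b \<in> quat_parts" "(\<lambda>x. b (hprod (q x) (w x))) \<notin> P"
    using quat_polyfun_hprod[OF q(1) w] by (auto simp: qideal_def)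
  define F where "F = (\<lambda>(b, r) x. b (hprod (r x) (w x))) ` (quat_parts \<times> S)"
  have "F \<subseteq> P"
  proof -
    have "(\<lambda>x. hprod (r x) (w x)) \<in> qideal" if "r \<in> S" for r
      using qideal_cnj[OF orth[OF that, unfolded orth_def]] by (simp add: qcnj_hprod w_def)
    then show ?thesis using qidealD(6) by (auto simp: F_def)
  qed
  moreover have "finite F" using S(1) by (simp add: F_def quat_parts_def)
  ultimately obtain x where x: "\<And>f. f \<in> F \<Longrightarrow> f x = 0" "b (hprod (q x) (w x)) \<noteq> 0"
    using real_nullstellensatz_quat[OF P, of F "\<lambda>x. b (hprod (q x) (w x))"] b
      real_polyfun_parts[OF quat_polyfun_hprod[OF q(1) w] b(1)] by blast
  have "hprod (r x) (w x) = 0" if "r \<in> S" for r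
    unfolding quat_eq_0_iff using x(1) that by (auto simp: F_def)
  moreover have "hprod (q x) (w x) \<noteq> 0"
    using x(2) b(1) unfolding quat_eq_0_iff by blast
  ultimately show ?thesis
    unfolding hprod_def by (intro exI[of _ x] exI[of _ "\<lambda>j. qcnj (w x j)"]) blast
qed


section \<open>Matrices\<close>

lemma sum_fun_apply: "sum f A x = (\<Sum>k\<in>A. f k x)"
  by (induction A rule: infinite_finite_induct) simp_all

lemma matrix_ring_sel:
  "carrier quat_matrix_ring = {M. \<forall>i j. M $ i $ j \<in> quat_polyfun}"
  "M \<otimes>\<^bsub>quat_matrix_ring\<^esub> M' = M ** M'" "M \<oplus>\<^bsub>quat_matrix_ring\<^esub> M' = M + M'"
  "\<zero>\<^bsub>quat_matrix_ring\<^esub> = 0" "\<one>\<^bsub>quat_matrix_ring\<^esub> = mat 1"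
  by (simp_all add: matrix_ring_def)

lemma finsum_matrix_ring:
  fixes f :: "'k \<Rightarrow> (quat ^ 'd \<Rightarrow> quat) ^ 'n ^ 'n"
  assumes "finite A" "f \<in> A \<rightarrow> carrier quat_matrix_ring"
  shows "(\<Oplus>\<^bsub>quat_matrix_ring\<^esub>i\<in>A. f i) = sum f A"
proof -
  interpret ring "quat_matrix_ring :: ((quat ^ 'd \<Rightarrow> quat) ^ 'n ^ 'n) ring"
    by (rule ring_quat_matrix_ring)
  show ?thesis
    using assms
  proof (induction rule: finite_induct)
    case empty
    show ?case by (simp add: matrix_ring_sel(4))
  next
    case (insert i A)
    then have "(\<Oplus>\<^bsub>quat_matrix_ring\<^esub>j\<in>insert i A. f j) = f i + (\<Oplus>\<^bsub>quat_matrix_ring\<^esub>j\<in>A. f j)"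
      by (subst finsum_insert) (auto simp: matrix_ring_sel(3))
    then show ?case using insert by auto
  qed
qed

lemma matrix_star_mult_entry:
  fixes M :: "(quat ^ 'd \<Rightarrow> quat) ^ 'n ^ 'n"
  shows "((quat_matrix_star M ** M) $ i $ j) x = (\<Sum>k\<in>UNIV. qcnj ((M $ k $ i) x) * (M $ k $ j) x)"
  by (simp add: matrix_matrix_mult_def matrix_star_def fun_cnj_def sum_fun_apply)

lemma star_mult_carrier:
  fixes M :: "(quat ^ 'd \<Rightarrow> quat) ^ 'n ^ 'n"
  assumes "M \<in> carrier quat_matrix_ring"
  shows "quat_matrix_star M ** M \<in> carrier quat_matrix_ring"
proof -
  have "M $ i $ j \<in> quat_polyfun" "quat_matrix_star M $ i $ j \<in> quat_polyfun" for i j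
    using assms quat_matrix_star(1)[OF assms] unfolding matrix_ring_sel(1) by blast+
  then show ?thesis
    unfolding matrix_ring_sel(1) using quat_polyfun_matrix_mult by blast
qed

text \<open>A left ideal is determined by the module of all rows of its elements, which is encoded by the
  matrices with constant columns.\<close>

definition row_matrix :: "(quat ^ 'd \<Rightarrow> 'n \<Rightarrow> quat) \<Rightarrow> (quat ^ 'd \<Rightarrow> quat) ^ 'n ^ 'n" where
  "row_matrix r = (\<chi> i j. (\<lambda>x. r x j))"

definition matrix_row :: "(quat ^ 'd \<Rightarrow> quat) ^ 'n ^ 'n \<Rightarrow> 'n \<Rightarrow> quat ^ 'd \<Rightarrow> 'n \<Rightarrow> quat" where
  "matrix_row M k = (\<lambda>x j. (M $ k $ j) x)"

lemma row_matrix_carrier: "r \<in> poly_rows \<longleftrightarrow> row_matrix r \<in> carrier quat_matrix_ring"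
  by (simp add: poly_rows_def row_matrix_def matrix_ring_sel)

lemma matrix_row_poly_rows: "M \<in> carrier quat_matrix_ring \<Longrightarrow> matrix_row M k \<in> poly_rows"
  by (simp add: poly_rows_def matrix_row_def matrix_ring_sel)

context
  fixes J :: "((quat ^ 'd \<Rightarrow> quat) ^ 'n ^ 'n) set"
  assumes J: "real_left_ideal quat_matrix_ring quat_matrix_star J"
begin

lemma ideal_carrier: "M \<in> J \<Longrightarrow> M \<in> carrier quat_matrix_ring"
  using J additive_subgroup.a_subset unfolding real_left_ideal_def left_ideal_def by blast

lemma ideal_closed:
  "0 \<in> J" "M \<in> J \<Longrightarrow> M' \<in> J \<Longrightarrow> M + M' \<in> J" "A \<in> carrier quat_matrix_ring \<Longrightarrow> M \<in> J \<Longrightarrow> A ** M \<in> J"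
proof -
  have "additive_subgroup J quat_matrix_ring" using J unfolding real_left_ideal_def left_ideal_def by blast
  from additive_subgroup.zero_closed[OF this] additive_subgroup.a_closed[OF this, of M M']
  show "0 \<in> J" "M \<in> J \<Longrightarrow> M' \<in> J \<Longrightarrow> M + M' \<in> J" by (simp_all add: matrix_ring_sel(3,4))
  show "A \<in> carrier quat_matrix_ring \<Longrightarrow> M \<in> J \<Longrightarrow> A ** M \<in> J"
    using J unfolding real_left_ideal_def left_ideal_def matrix_ring_sel(2) by blast
qed

lemma ideal_sum: "(\<And>i. i \<in> A \<Longrightarrow> f i \<in> J) \<Longrightarrow> sum f A \<in> J"
  by (induction A rule: infinite_finite_induct) (auto intro: ideal_closed)

text \<open>Left multiplication by the matrix with ones in column \<open>k\<close> and zeros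
  elsewhere copies row \<open>k\<close> into every row.\<close>

lemma ideal_row: "M \<in> J \<Longrightarrow> row_matrix (matrix_row M k) \<in> J"
proof -
  assume M: "M \<in> J"
  define A :: "(quat ^ 'd \<Rightarrow> quat) ^ 'n ^ 'n" where "A = (\<chi> i j. (if j = k then 1 else 0))"
  have "A \<in> carrier quat_matrix_ring"
    by (simp add: A_def matrix_ring_sel quat_polyfun_0 quat_polyfun_1)
  moreover have "A ** M = row_matrix (matrix_row M k)"
    by (simp add: A_def matrix_matrix_mult_def row_matrix_def matrix_row_def vec_eq_iff
        if_distrib[of "\<lambda>a. a * _"] cong: if_cong)
  ultimately show ?thesis using ideal_closed(3) M by metis
qed

text \<open>The diagonal matrix units \<open>E k\<close> select row \<open>k\<close> from its row
  matrix, and the selected rows add up to \<open>M\<close>.\<close>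

lemma ideal_from_rows:
  assumes "\<And>k. row_matrix (matrix_row M k) \<in> J"
  shows "M \<in> J"
proof -
  define E :: "'n \<Rightarrow> (quat ^ 'd \<Rightarrow> quat) ^ 'n ^ 'n" where "E k = (\<chi> i j. (if i = k \<and> j = k then 1 else 0))" for k
  have "E k ** row_matrix (matrix_row M k) \<in> J" for k
    by (rule ideal_closed(3)[OF _ assms]) (simp add: E_def matrix_ring_sel quat_polyfun_0 quat_polyfun_1)
  then have "(\<Sum>k\<in>UNIV. E k ** row_matrix (matrix_row M k)) \<in> J" by (rule ideal_sum)
  also have "E k ** row_matrix (matrix_row M k) = (\<chi> i j. (if i = k then M $ k $ j else 0))" for k
    by (simp add: E_def matrix_matrix_mult_def row_matrix_def matrix_row_def vec_eq_iff
        if_distrib[of "\<lambda>a. a * _"] cong: if_cong)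
  then have "(\<Sum>k\<in>UNIV. E k ** row_matrix (matrix_row M k)) = M"
    by (simp add: vec_eq_iff)
  finally show ?thesis .
qed

lemma ideal_row_scale:
  assumes "a \<in> quat_polyfun" "row_matrix r \<in> J"
  shows "row_matrix (\<lambda>x j. a x * r x j) \<in> J"
proof -
  have "mat a \<in> carrier quat_matrix_ring"
    using assms(1) by (simp add: mat_def matrix_ring_sel quat_polyfun_0)
  moreover have "mat a ** row_matrix r = row_matrix (\<lambda>x j. a x * r x j)"
    by (simp add: mat_def matrix_matrix_mult_def row_matrix_def vec_eq_iff fun_eq_iff
        if_distrib[of "\<lambda>a. a * _"] cong: if_cong)
  ultimately show ?thesis using ideal_closed(3) assms(2) by metis
qed

lemma ideal_row_real:
  assumes ws: "set ws \<subseteq> poly_rows" and sum: "\<And>i. row_matrix (\<lambda>x j. \<Sum>w\<leftarrow>ws. qcnj (w x i) * w x j) \<in> J"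
  shows "w \<in> set ws \<Longrightarrow> row_matrix w \<in> J"
proof -
  \<comment> \<open>The shift by one matches list positions, which start at 0, with the index range
    \<open>{1..k}\<close> of realness.\<close>
  define b where "b k = row_matrix (ws ! (k - 1))" for k
  define k where "k = length ws"
  have b: "b \<in> {1..k} \<rightarrow> carrier quat_matrix_ring"
  proof
    fix i assume "i \<in> {1..k}"
    then have "ws ! (i - 1) \<in> set ws" by (intro nth_mem) (auto simp: k_def)
    then show "b i \<in> carrier quat_matrix_ring"
      using ws by (auto simp: b_def row_matrix_carrier[symmetric])
  qed
  define M where "M = (\<Sum>i\<in>{1..k}. quat_matrix_star (b i) ** b i)"
  have "(\<Oplus>\<^bsub>quat_matrix_ring\<^esub>i\<in>{1..k}. quat_matrix_star (b i) \<otimes>\<^bsub>quat_matrix_ring\<^esub> b i) = M"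
    unfolding M_def matrix_ring_sel(2)
    by (rule finsum_matrix_ring) (use b star_mult_carrier in auto)
  moreover have "M \<in> J"
  proof (rule ideal_from_rows)
    fix i
    have "matrix_row M i x j = of_nat CARD('n) * (\<Sum>w\<leftarrow>ws. qcnj (w x i) * w x j)" for x j
    proof -
      have "matrix_row M i x j = (\<Sum>l\<in>{1..k}. \<Sum>m\<in>(UNIV :: 'n set). qcnj ((ws ! (l - 1)) x i) * (ws ! (l - 1)) x j)"
        unfolding M_def matrix_row_def by (simp add: sum_fun_apply matrix_star_mult_entry b_def row_matrix_def)
      also have "\<dots> = of_nat CARD('n) * (\<Sum>l\<in>{1..k}. qcnj ((ws ! (l - 1)) x i) * (ws ! (l - 1)) x j)"
        by (simp add: sum_distrib_left)
      also have "(\<Sum>l\<in>{1..k}. qcnj ((ws ! (l - 1)) x i) * (ws ! (l - 1)) x j) = (\<Sum>l<k. qcnj ((ws ! l) x i) * (ws ! l) x j)"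
        by (rule sum.reindex_bij_witness[of _ Suc "\<lambda>l. l - 1"]) auto
      also have "\<dots> = (\<Sum>w\<leftarrow>ws. qcnj (w x i) * w x j)"
        by (simp add: k_def sum_list_sum_nth atLeast0LessThan)
      finally show ?thesis .
    qed
    then have "matrix_row M i = (\<lambda>x j. of_nat CARD('n) * (\<Sum>w\<leftarrow>ws. qcnj (w x i) * w x j))"
      by (intro ext)
    then show "row_matrix (matrix_row M i) \<in> J"
      using ideal_row_scale[OF quat_polyfun.const sum] by simp
  qed
  ultimately have "(\<Oplus>\<^bsub>quat_matrix_ring\<^esub>i\<in>{1..k}. quat_matrix_star (b i) \<otimes>\<^bsub>quat_matrix_ring\<^esub> b i) \<in> J"
    by simp
  then have bJ: "\<forall>i\<in>{1..k}. b i \<in> J"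
    using J b unfolding real_left_ideal_def by blast
  assume "w \<in> set ws"
  then obtain l where "l < k" "w = ws ! l" by (auto simp: in_set_conv_nth k_def)
  then show ?thesis using bspec[OF bJ, of "Suc l"] by (simp add: b_def)
qed

end

section \<open>The solution ideal and the equivalence\<close>

lemma sum_swap3: "(\<Sum>i\<in>A. \<Sum>j\<in>B. \<Sum>k\<in>C. f i j k) = (\<Sum>k\<in>C. \<Sum>i\<in>A. \<Sum>j\<in>B. f i j k)"
proof -
  have "(\<Sum>i\<in>A. \<Sum>j\<in>B. \<Sum>k\<in>C. f i j k) = (\<Sum>i\<in>A. \<Sum>k\<in>C. \<Sum>j\<in>B. f i j k)"
    by (intro sum.cong refl sum.swap)
  also have "\<dots> = (\<Sum>k\<in>C. \<Sum>i\<in>A. \<Sum>j\<in>B. f i j k)"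
    by (rule sum.swap)
  finally show ?thesis .
qed

lemma real_left_ideal_of_solutions:
  fixes Ps :: "((quat ^ 'd \<Rightarrow> quat) ^ 'n ^ 'n) set"
  shows "real_left_ideal quat_matrix_ring quat_matrix_star
    {M \<in> carrier quat_matrix_ring. \<forall>a v. (\<forall>P\<in>Ps. matrix_eval P a *v v = 0) \<longrightarrow> matrix_eval M a *v v = 0}"
    (is "real_left_ideal ?R ?s ?I")
proof -
  interpret ring ?R by (rule ring_quat_matrix_ring)
  have ev_add: "matrix_eval (M + M') a *v v = matrix_eval M a *v v + matrix_eval M' a *v v"
    and ev_uminus: "matrix_eval (- M) a *v v = - (matrix_eval M a *v v)"
    and ev_mult: "matrix_eval (M ** M') a *v v = matrix_eval M a *v (matrix_eval M' a *v v)"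
    for M M' :: "(quat ^ 'd \<Rightarrow> quat) ^ 'n ^ 'n" and a v
    unfolding matrix_vector_mul_assoc
    by (simp_all add: matrix_eval_def matrix_vector_mult_def matrix_matrix_mult_def vec_eq_iff distrib_right
        sum.distrib sum_negf sum_fun_apply)
  have ev_0: "matrix_eval 0 a *v v = 0" for a and v :: "quat ^ 'n"
    by (simp add: matrix_eval_def matrix_vector_mult_def vec_eq_iff)
  have uminus: "- M \<in> carrier ?R" "\<ominus>\<^bsub>?R\<^esub> M = - M" if "M \<in> carrier ?R" for M
  proof -
    show "- M \<in> carrier ?R" using that by (simp add: matrix_ring_sel(1) quat_polyfun.uminus)
    then show "\<ominus>\<^bsub>?R\<^esub> M = - M"
      using that by (intro minus_equality) (simp_all add: matrix_ring_sel(3,4))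
  qed
  have sub: "additive_subgroup ?I ?R"
  proof (rule additive_subgroupI, rule add.subgroupI)
    have "0 \<in> ?I" using zero_closed by (simp add: matrix_ring_sel(4) ev_0)
    then show "?I \<noteq> {}" by blast
    show "\<ominus>\<^bsub>?R\<^esub> M \<in> ?I" if "M \<in> ?I" for M
      using that uminus[of M] ev_uminus[of M] by auto
    show "M \<oplus>\<^bsub>?R\<^esub> M' \<in> ?I" if "M \<in> ?I" "M' \<in> ?I" for M M'
      using that a_closed[of M M'] ev_add by (simp add: matrix_ring_sel(3))
  qed auto
  have mult: "A \<otimes>\<^bsub>?R\<^esub> M \<in> ?I" if "A \<in> carrier ?R" "M \<in> ?I" for A M
    using that m_closed[of A M] ev_mult by (simp add: matrix_ring_sel(2))
  have real: "b l \<in> ?I"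
    if b: "b \<in> {1..k} \<rightarrow> carrier ?R" and sum: "(\<Oplus>\<^bsub>?R\<^esub>i\<in>{1..k}. ?s (b i) \<otimes>\<^bsub>?R\<^esub> b i) \<in> ?I" and l: "l \<in> {1..k}"
    for b l and k :: nat
  proof -
    have "(\<Oplus>\<^bsub>?R\<^esub>i\<in>{1..k}. ?s (b i) \<otimes>\<^bsub>?R\<^esub> b i) = (\<Sum>i\<in>{1..k}. ?s (b i) ** b i)"
      unfolding matrix_ring_sel(2)
      by (rule finsum_matrix_ring) (use b star_mult_carrier in auto)
    note sum = sum[unfolded this]
    have "matrix_eval (b l) a *v v = 0" if av: "\<forall>P\<in>Ps. matrix_eval P a *v v = 0" for a v
    proof -
      define u where "u i = matrix_eval (b i) a *v v" for i
      have "0 = (\<Sum>j\<in>UNIV. qcnj (v $ j) * (matrix_eval (\<Sum>i\<in>{1..k}. ?s (b i) ** b i) a *v v) $ j)"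
        using sum av by simp
      also have "\<dots> = (\<Sum>j\<in>UNIV. \<Sum>m\<in>UNIV. \<Sum>i\<in>{1..k}. \<Sum>n\<in>UNIV.
          qcnj (v $ j) * (qcnj ((b i $ n $ j) a) * ((b i $ n $ m) a * v $ m)))"
        by (simp add: matrix_eval_def matrix_vector_mult_def sum_fun_apply matrix_star_mult_entry
            sum_distrib_left sum_distrib_right mult.assoc)
      also have "\<dots> = (\<Sum>i\<in>{1..k}. \<Sum>n\<in>UNIV. \<Sum>j\<in>UNIV. \<Sum>m\<in>UNIV.
          qcnj (v $ j) * (qcnj ((b i $ n $ j) a) * ((b i $ n $ m) a * v $ m)))"
        by (subst sum.swap[of _ "{1..k}"])+ (intro sum.cong refl sum_swap3)
      also have "\<dots> = (\<Sum>i\<in>{1..k}. \<Sum>n\<in>UNIV. qcnj (u i $ n) * u i $ n)"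
        by (simp add: u_def matrix_eval_def matrix_vector_mult_def qcnj_sum qcnj_mult sum_product mult.assoc)
      also have "\<dots> = of_re (\<Sum>i\<in>{1..k}. normsq (\<lambda>n. qcnj (u i $ n)))"
        by (simp add: of_re_sum hprod_self[symmetric] hprod_def qcnj_qcnj)
      finally have "(\<Sum>i\<in>{1..k}. normsq (\<lambda>n. qcnj (u i $ n))) = 0"
        by (simp add: of_re_def zero_quat_def)
      then have "normsq (\<lambda>n. qcnj (u l $ n)) = 0"
        using l by (subst (asm) sum_nonneg_eq_0_iff) (auto simp: normsq_def intro!: sum_nonneg add_nonneg_nonneg)
      then have "\<forall>n. (qre (u l $ n))\<^sup>2 + (qi (u l $ n))\<^sup>2 + (qj (u l $ n))\<^sup>2 + (qk (u l $ n))\<^sup>2 = 0"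
        unfolding normsq_def by (subst (asm) sum_nonneg_eq_0_iff) (auto simp: qcnj_def)
      then have "u l = 0"
        by (simp add: vec_eq_iff quat_eq_iff zero_quat_def add_nonneg_eq_0_iff)
      then show ?thesis by (simp add: u_def)
    qed
    then show ?thesis using b l by auto
  qed
  show ?thesis
    unfolding real_left_ideal_def left_ideal_def
    by (intro conjI ballI allI impI sub) (erule (1) mult, erule (2) real)
qed

theorem theorem6:
  fixes m :: nat
    and P :: "nat \<Rightarrow> (quat ^ 'd \<Rightarrow> quat) ^ 'n ^ 'n"
    and Q :: "(quat ^ 'd \<Rightarrow> quat) ^ 'n ^ 'n"
  assumes "m \<ge> 1"
    and "\<And>i. i \<in> {1..m} \<Longrightarrow> P i \<in> carrier quat_matrix_ring"
    and "Q \<in> carrier quat_matrix_ring"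
  shows "(\<forall>(a :: quat ^ 'd) (v :: quat ^ 'n).
            (\<forall>i\<in>{1..m}. matrix_eval (P i) a *v v = 0) \<longrightarrow> matrix_eval Q a *v v = 0)
    \<longleftrightarrow> Q \<in> smallest_real_left_ideal quat_matrix_ring quat_matrix_star (P ` {1..m})"
    (is "?solutions \<longleftrightarrow> Q \<in> ?J")
proof
  interpret ring "quat_matrix_ring :: ((quat ^ 'd \<Rightarrow> quat) ^ 'n ^ 'n) ring"
    by (rule ring_quat_matrix_ring)
  have PC: "P ` {1..m} \<subseteq> carrier quat_matrix_ring" using assms(2) by blast
  note J = real_left_ideal_smallest(1,2)[OF PC, of quat_matrix_star]
  note smallest = real_left_ideal_smallest(3)[OF PC, of quat_matrix_star]
  show ?solutions if Q: "Q \<in> ?J"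
  proof -
    have "P ` {1..m} \<subseteq> {M \<in> carrier quat_matrix_ring.
        \<forall>a v. (\<forall>P\<in>P ` {1..m}. matrix_eval P a *v v = 0) \<longrightarrow> matrix_eval M a *v v = 0}"
      using PC by blast
    from subsetD[OF smallest[OF real_left_ideal_of_solutions this] Q] show ?thesis by simp
  qed
  show "Q \<in> ?J" if sol: ?solutions
  proof (rule ideal_from_rows[OF J(1)], rule ccontr)
    fix k assume k: "row_matrix (matrix_row Q k) \<notin> ?J"
    \<comment> \<open>With all rows of all \<open>P i\<close> in \<open>S\<close>, annihilation of
      \<open>S\<close> by the separating vector says that it solves the system at the point
      \<open>x\<close>, while row \<open>k\<close> of \<open>Q\<close> does not annihilate
      it.\<close>
    define S where "S = (\<Union>i\<in>{1..m}. range (matrix_row (P i)))"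
    have "\<exists>x v. (\<forall>r\<in>S. (\<Sum>j\<in>UNIV. r x j * v j) = 0) \<and> (\<Sum>j\<in>UNIV. matrix_row Q k x j * v j) \<noteq> 0"
    proof (rule separating_vector[where N = "{r. row_matrix r \<in> ?J}"])
      show "{r. row_matrix r \<in> ?J} \<subseteq> poly_rows"
        using ideal_carrier[OF J(1)] row_matrix_carrier by blast
      show "(\<lambda>_ _. 0) \<in> {r. row_matrix r \<in> ?J}"
        using ideal_closed(1)[OF J(1)] by (simp add: row_matrix_def zero_vec_def zero_fun_def)
      show "(\<lambda>x j. r x j + s x j) \<in> {r. row_matrix r \<in> ?J}"
        if "r \<in> {r. row_matrix r \<in> ?J}" "s \<in> {r. row_matrix r \<in> ?J}" for r s
      proof -
        have "row_matrix (\<lambda>x j. r x j + s x j) = row_matrix r + row_matrix s"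
          by (simp add: row_matrix_def vec_eq_iff fun_eq_iff)
        then show ?thesis using ideal_closed(2)[OF J(1)] that by simp
      qed
      show "(\<lambda>x j. a x * r x j) \<in> {r. row_matrix r \<in> ?J}"
        if "a \<in> quat_polyfun" "r \<in> {r. row_matrix r \<in> ?J}" for a r
        using ideal_row_scale[OF J(1)] that by simp
      show "set ws \<subseteq> {r. row_matrix r \<in> ?J}"
        if "set ws \<subseteq> poly_rows" "\<And>i. (\<lambda>x j. \<Sum>w\<leftarrow>ws. qcnj (w x i) * w x j) \<in> {r. row_matrix r \<in> ?J}" for ws
        using ideal_row_real[OF J(1) that(1)] that(2) by blast
      show "matrix_row Q k \<in> poly_rows" by (rule matrix_row_poly_rows[OF assms(3)])
      show "matrix_row Q k \<notin> {r. row_matrix r \<in> ?J}" using k by simp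
      show "finite S" by (simp add: S_def)
      show "S \<subseteq> {r. row_matrix r \<in> ?J}"
        using ideal_row[OF J(1)] J(2) by (auto simp: S_def)
    qed
    then obtain x v where xv: "\<And>r. r \<in> S \<Longrightarrow> (\<Sum>j\<in>UNIV. r x j * v j) = 0"
      "(\<Sum>j\<in>UNIV. matrix_row Q k x j * v j) \<noteq> 0" by blast
    have ev: "(matrix_eval M x *v (\<chi> j. v j)) $ l = (\<Sum>j\<in>UNIV. matrix_row M l x j * v j)"
      for M :: "(quat ^ 'd \<Rightarrow> quat) ^ 'n ^ 'n" and l
      by (simp add: matrix_eval_def matrix_vector_mult_def matrix_row_def)
    have "matrix_eval (P i) x *v (\<chi> j. v j) = 0" if "i \<in> {1..m}" for i
    proof -
      have "matrix_row (P i) l \<in> S" for l using that unfolding S_def by blast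
      then show ?thesis unfolding vec_eq_iff ev using xv(1) by simp
    qed
    then have "matrix_eval Q x *v (\<chi> j. v j) = 0" using sol by blast
    then show False using ev[of Q k] xv(2) by simp
  qed
qed

end
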